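(* Let $G$ be a simple graph with $v$ vertices. Then: (0) $H^{0,2v-3}_{\mathcal A_3}(G)$ is a free abelian group isomorphic to $H^1(X_{\Delta,4}(G);\mathbb Z)\oplus\mathbb Z^{t_0+\frac{d_2}{2}+d_{\ge3}}$; (1) $H^{1,2v-3}_{\mathcal A_3}(G)\cong H^2(X_{\Delta,4}(G);\mathbb Z)\oplus\mathbb Z^{t_2-\frac{d_2}{2}-sq(G)}$, where, since the exponent $t_2-\frac{d_2}{2}-sq(G)$ may be negative, this means: the torsion subgroup of $H^{1,2v-3}_{\mathcal A_3}(G)$ is isomorphic to the torsion subgroup of $H^2(X_{\Delta,4}(G);\mathbb Z)$, and $\operatorname{rank}H^{1,2v-3}_{\mathcal A_3}(G)=\operatorname{rank}H^2(X_{\Delta,4}(G);\mathbb Z)+t_2-\frac{d_2}{2}-sq(G)$.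
   Context: $\mathcal A_3=\mathbb Z[x]/(x^3)$. For a finite graph $G$ with a fixed total order on its edge set $E(G)$ and $s\subseteq E(G)$, $[G:s]$ is the spanning subgraph with edge set $s$. An enhanced state is a pair $(s,c)$ where $c$ assigns to each component $C$ of $[G:s]$ an exponent $c(C)\in\{0,1,2\}$ (weight $x^{c(C)}$); its bidegree is $(|s|,\sum_C c(C))$. $C^{i,j}_{\mathcal A_3}(G)$ is the free abelian group on enhanced states of bidegree $(i,j)$, with differential $d=\sum_{e\notin s}(-1)^{|\{f\in s:f<e\}|}d_e$, where $d_e(s,c)$ is the enhanced state on $s\cup\{e\}$ obtained, if $e$ joins distinct components $C_1,C_2$, by giving the merged component weight $x^{c(C_1)}x^{c(C_2)}\in\mathcal A_3$ (zero if the exponent sum is $\ge3$), other weights unchanged, and, if both endpoints of $e$ lie in one component, by keeping all weights. $H^{i,j}_{\mathcal A_3}(G)$ is its cohomology. Fix an orientation of each edge of $G$. A $k$-cycle means a subgraph isomorphic to a cycle of length $k$; for a cycle traversed in one direction, write $\vec e$ for its edge $e$ oriented along the traversal. $X_{\Delta,4}(G)$ is the CW complex with a single 0-cell, one 1-cell (loop) for each edge of $G$, one 2-cell for each 4-cycle with edges $e_1,e_2,e_3,e_4$ in cyclic order, attached along the word $\vec e_1\vec e_2\vec e_3\vec e_4$, and two 2-cells for each 3-cycle with edges $e_1,e_2,e_3$ in cyclic order, attached along the words $\vec e_3\vec e_2^{-1}\vec e_3\vec e_1^{-1}$ and $\vec e_1\vec e_3^{-1}\vec e_1\vec e_2^{-1}$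 (so their cellular boundaries are $2\vec e_3-\vec e_2-\vec e_1$ and $2\vec e_1-\vec e_3-\vec e_2$). Equivalently: $G$ with 2-cells glued along all 4-cycles, all vertices identified, and 2-cells added along $2\vec e_3-\vec e_2-\vec e_1$-type expressions for each 3-cycle. $t_0$ (resp. $t_2$) is the number of unordered triples of distinct vertices spanning no edge (resp. exactly two edges) of $G$; $d_2$ is the number of ordered pairs of vertices at distance $2$; $d_{\ge3}$ is the number of ordered pairs of vertices at distance at least $3$ (including pairs in different components); $sq(G)$ is the number of 4-cycles of $G$. *)

theory Defs
  imports "HOL-Algebra.Algebra" "HOL-Library.FuncSet"
begin

text \<open>ZF S: the free abelian group on the finite set S, realised as integer-valued
  functions vanishing outside S, with pointwise addition (written as HOL-Algebra mult).\<close>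
definition ZF :: "'x set \<Rightarrow> ('x \<Rightarrow> int) monoid" where
  "ZF S = \<lparr>carrier = {f. \<forall>x. x \<notin> S \<longrightarrow> f x = 0}, monoid.mult = (\<lambda>f g x. f x + g x), one = (\<lambda>x. 0)\<rparr>"

definition lin :: "'x set \<Rightarrow> 'y set \<Rightarrow> ('x \<Rightarrow> 'y \<Rightarrow> int) \<Rightarrow> ('x \<Rightarrow> int) \<Rightarrow> ('y \<Rightarrow> int)" where
  "lin S T M f = (\<lambda>y. if y \<in> T then (\<Sum>x\<in>S. f x * M x y) else 0)"

definition cohom :: "'w set \<Rightarrow> 'x set \<Rightarrow> 'y set \<Rightarrow> ('w \<Rightarrow> 'x \<Rightarrow> int) \<Rightarrow> ('x \<Rightarrow> 'y \<Rightarrow> int)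
    \<Rightarrow> ('x \<Rightarrow> int) set monoid" where
  "cohom P Q R Ain Aout =
     FactGroup ((ZF Q)\<lparr>carrier := {f \<in> carrier (ZF Q). lin Q R Aout f = (\<lambda>_. 0)}\<rparr>)
       (lin P Q Ain ` carrier (ZF P))"

definition torsion :: "('g, 'm) monoid_scheme \<Rightarrow> 'g set" where
  "torsion G = {x \<in> carrier G. \<exists>n::nat. 0 < n \<and> x [^]\<^bsub>G\<^esub> n = \<one>\<^bsub>G\<^esub>}"

definition torsion_subgroup :: "('g, 'm) monoid_scheme \<Rightarrow> ('g, 'm) monoid_scheme" where
  "torsion_subgroup G = G\<lparr>carrier := torsion G\<rparr>"

definition ab_rank :: "('g, 'm) monoid_scheme \<Rightarrow> nat" where
  "ab_rank G = (THE n::nat. (FactGroup G (torsion G)) \<cong> ZF {..<n})"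

definition simple_graph :: "'a set \<Rightarrow> 'a set set \<Rightarrow> bool" where
  "simple_graph V E \<longleftrightarrow> finite V \<and> (\<forall>e\<in>E. \<exists>x y. x \<noteq> y \<and> x \<in> V \<and> y \<in> V \<and> e = {x, y})"

definition adj :: "'a set set \<Rightarrow> 'a \<Rightarrow> 'a \<Rightarrow> bool" where
  "adj E x y \<longleftrightarrow> {x, y} \<in> E"

definition t0 :: "'a set \<Rightarrow> 'a set set \<Rightarrow> nat" where
  "t0 V E = card {T. T \<subseteq> V \<and> card T = 3 \<and> card {e \<in> E. e \<subseteq> T} = 0}"

definition t2 :: "'a set \<Rightarrow> 'a set set \<Rightarrow> nat" where
  "t2 V E = card {T. T \<subseteq> V \<and> card T = 3 \<and> card {e \<in> E. e \<subseteq> T} = 2}"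

text \<open>d_2: ordered pairs at distance exactly 2; d_ge3: ordered pairs at distance \<ge> 3
  (including pairs in different components), i.e. distinct, nonadjacent, with no common neighbour.\<close>
definition d2 :: "'a set \<Rightarrow> 'a set set \<Rightarrow> nat" where
  "d2 V E = card {(x, y). x \<in> V \<and> y \<in> V \<and> x \<noteq> y \<and> \<not> adj E x y \<and> (\<exists>z. adj E x z \<and> adj E z y)}"

definition d3 :: "'a set \<Rightarrow> 'a set set \<Rightarrow> nat" where
  "d3 V E = card {(x, y). x \<in> V \<and> y \<in> V \<and> x \<noteq> y \<and> \<not> adj E x y \<and> \<not> (\<exists>z. adj E x z \<and> adj E z y)}"

definition cycles3 :: "'a set set \<Rightarrow> 'a set set set" where
  "cycles3 E = {S. S \<subseteq> E \<and> (\<exists>a b c. distinct [a, b, c] \<and> S = {{a, b}, {b, c}, {c, a}})}"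

definition cycles4 :: "'a set set \<Rightarrow> 'a set set set" where
  "cycles4 E = {S. S \<subseteq> E \<and> (\<exists>a b c d. distinct [a, b, c, d] \<and> S = {{a, b}, {b, c}, {c, d}, {d, a}})}"

definition sq :: "'a set set \<Rightarrow> nat" where
  "sq E = card (cycles4 E)"

definition trav3 :: "'a set set \<Rightarrow> 'a \<times> 'a \<times> 'a" where
  "trav3 S = (SOME t. case t of (a, b, c) \<Rightarrow> distinct [a, b, c] \<and> S = {{a, b}, {b, c}, {c, a}})"

definition trav4 :: "'a set set \<Rightarrow> 'a \<times> 'a \<times> 'a \<times> 'a" where
  "trav4 S = (SOME t. case t of (a, b, c, d) \<Rightarrow>
      distinct [a, b, c, d] \<and> S = {{a, b}, {b, c}, {c, d}, {d, a}})"

text \<open>Coefficient of the (oriented) edge e in the oriented edge traversed from x to y;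
  the orientation of edge e is from ori e to the other endpoint.\<close>
definition oc :: "('a set \<Rightarrow> 'a) \<Rightarrow> 'a \<Rightarrow> 'a \<Rightarrow> 'a set \<Rightarrow> int" where
  "oc ori x y e = (if e = {x, y} then (if ori e = x then 1 else -1) else 0)"

definition cells2 :: "'a set set \<Rightarrow> ('a set set \<times> nat) set" where
  "cells2 E = {(S, 0) | S. S \<in> cycles4 E} \<union> {(S, i) | S i. S \<in> cycles3 E \<and> i \<in> {1, 2}}"

text \<open>Cellular boundary: coefficient of the 1-cell e in the boundary of the 2-cell.
  4-cycle e1 e2 e3 e4: word e1 e2 e3 e4; 3-cycle e1 e2 e3: boundaries
  2 e3 - e2 - e1 and 2 e1 - e3 - e2 (with e_i oriented along the traversal).\<close>
definition bd :: "('a set \<Rightarrow> 'a) \<Rightarrow> 'a set \<Rightarrow> 'a set set \<times> nat \<Rightarrow> int" where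
  "bd ori e cell = (case cell of (S, i) \<Rightarrow>
     if i = 0 then (case trav4 S of (a, b, c, d) \<Rightarrow>
                     oc ori a b e + oc ori b c e + oc ori c d e + oc ori d a e)
     else (case trav3 S of (a, b, c) \<Rightarrow>
       if i = 1 then 2 * oc ori c a e - oc ori b c e - oc ori a b e
       else 2 * oc ori a b e - oc ori c a e - oc ori b c e))"

text \<open>Cellular cochain complex of X: C^0 = Z (one 0-cell, delta^0 = 0 since all 1-cells
  are loops), C^1 = Z^E, C^2 = Z^{2-cells}, delta^1 = transpose of the cellular boundary.\<close>
definition XH1 :: "'a set set \<Rightarrow> ('a set \<Rightarrow> 'a) \<Rightarrow> ('a set \<Rightarrow> int) set monoid" where
  "XH1 E ori = cohom {()} E (cells2 E) (\<lambda>_ _. 0) (bd ori)"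

definition XH2 :: "'a set set \<Rightarrow> ('a set \<Rightarrow> 'a) \<Rightarrow> (('a set set \<times> nat) \<Rightarrow> int) set monoid" where
  "XH2 E ori = cohom E (cells2 E) ({} :: unit set) (bd ori) (\<lambda>_ _. 0)"

definition comp_of :: "'a set \<Rightarrow> 'a set set \<Rightarrow> 'a \<Rightarrow> 'a set" where
  "comp_of V s x = {y \<in> V. (x, y) \<in> {(p, q). {p, q} \<in> s}\<^sup>*}"

definition comps :: "'a set \<Rightarrow> 'a set set \<Rightarrow> 'a set set" where
  "comps V s = comp_of V s ` V"

type_synonym 'a estate = "'a set set \<times> ('a set \<Rightarrow> nat)"

text \<open>Enhanced states of bidegree (i,j): edge set s, exponent c(C) in {0,1,2} per component.\<close>
definition ES :: "'a set \<Rightarrow> 'a set set \<Rightarrow> nat \<Rightarrow> int \<Rightarrow> 'a estate set" where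
  "ES V E i j = {(s, c). s \<subseteq> E \<and> card s = i \<and> c \<in> comps V s \<rightarrow>\<^sub>E {0, 1, 2}
                   \<and> int (\<Sum>C\<in>comps V s. c C) = j}"

text \<open>Partial differential d_e (None = zero).\<close>
definition dE :: "'a set \<Rightarrow> 'a set \<Rightarrow> 'a estate \<Rightarrow> 'a estate option" where
  "dE V e st = (case st of (s, c) \<Rightarrow>
     (let T = comp_of V s ` e in
      if card T = 2 then
        (let w = (\<Sum>C\<in>T. c C) in
         if 3 \<le> w then None
         else Some (insert e s, restrict (\<lambda>D. if D = \<Union>T then w else c D) (comps V (insert e s))))
      else Some (insert e s, c)))"

definition dcoef :: "'a set \<Rightarrow> 'a set set \<Rightarrow> ('a set \<Rightarrow> nat) \<Rightarrow> 'a estate \<Rightarrow> 'a estate \<Rightarrow> int" where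
  "dcoef V E rk st t = (\<Sum>e\<in>E - fst st.
      if dE V e st = Some t then (-1) ^ card {f \<in> fst st. rk f < rk e} else 0)"

definition KhA3 :: "'a set \<Rightarrow> 'a set set \<Rightarrow> ('a set \<Rightarrow> nat) \<Rightarrow> nat \<Rightarrow> int \<Rightarrow> ('a estate \<Rightarrow> int) set monoid" where
  "KhA3 V E rk i j = cohom (if i = 0 then {} else ES V E (i - 1) j) (ES V E i j) (ES V E (i + 1) j)
                          (dcoef V E rk) (dcoef V E rk)"

end

theory Submission
  imports Defs
begin

text \<open>In degree \<open>2 v - 3\<close> the complex has only two terms: an enhanced state without edges has weight 0 on
  one vertex and 1 on another, or weight 1 on a triple, while a state with one edge \<open>e\<close> has weight 1
  on a single component. The component at \<open>(e, e)\<close> of \<open>d f\<close>, for \<open>e = a b\<close>, is \<open>f (a, b) + f (b, a)\<close>, so a cocycle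
  is antisymmetric on edges, that is, a cellular 1-cochain; the component at \<open>(e, z)\<close> is
  \<open>f (a, z) + f (b, z) + f {a, b, z}\<close>. Eliminating triples with an edge and one ordering of each pair at distance 2
  turns these conditions into the cocycle conditions on triangles and squares, and leaves triples
  without edges, one ordering of each pair at distance 2, and all ordered pairs at larger distance as free coordinates.

  Doing this modulo every integer \<open>k\<close>, with \<open>k = 0\<close> allowed, compares the kernels and also the torsion of
  the cokernels, because the torsion of the cokernel of an integer matrix \<open>m\<close> consists of the classes of \<open>m f / k\<close>
  with \<open>k\<close> dividing \<open>m f\<close>. The ranks of the cokernels then follow by counting cells.\<close>

section \<open>Integer lattices\<close>

text \<open>The targets of the two complexes are indexed by unrelated objects, so the cokernels are
  not compared by a map between targets; divisibility by \<open>k\<close> moves the comparison to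
  the sources. The shape of the 2-cells comes from one relation. For edges \<open>a b\<close> and
  \<open>b z\<close>, the components at \<open>(a b, z)\<close> and \<open>(b z, a)\<close> involve
  the same triple, and their difference says
  \<open>f (a, z) - f (z, a) = f (b, a) - f (b, z)\<close>. If \<open>a z\<close> is an edge,
  antisymmetry doubles the left side: this is the coefficient 2 of the triangle cells. In any case
  the left side does not mention \<open>b\<close>, so two common neighbours of \<open>a\<close> and
  \<open>z\<close> give equal right sides, which is the square condition. Conversely, the square
  condition makes the value at the eliminated ordering of a pair at distance 2 independent of the
  common neighbour that defines it. Ranks are defined by isomorphism with a standard free group,
  hence the work with bases: a cokernel modulo torsion is realised as the image of an integer
  endomorphism whose kernel is a saturation.\<close>

definition lattice_group :: "('x \<Rightarrow> int) set \<Rightarrow> ('x \<Rightarrow> int) monoid" where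
  "lattice_group K = \<lparr>carrier = K, monoid.mult = (\<lambda>f g x. f x + g x), one = (\<lambda>x. 0)\<rparr>"

definition int_lattice :: "('x \<Rightarrow> int) set \<Rightarrow> bool" where
  "int_lattice K \<longleftrightarrow> (\<lambda>_. 0) \<in> K \<and> (\<forall>f\<in>K. \<forall>g\<in>K. (\<lambda>x. f x - g x) \<in> K)"

definition additive_on :: "('x \<Rightarrow> int) set \<Rightarrow> (('x \<Rightarrow> int) \<Rightarrow> 'y \<Rightarrow> int) \<Rightarrow> bool" where
  "additive_on K h \<longleftrightarrow> (\<forall>f\<in>K. \<forall>g\<in>K. h (\<lambda>x. f x + g x) = (\<lambda>y. h f y + h g y))"

definition comb :: "nat \<Rightarrow> (nat \<Rightarrow> 'x \<Rightarrow> int) \<Rightarrow> (nat \<Rightarrow> int) \<Rightarrow> 'x \<Rightarrow> int" where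
  "comb n b f = (\<lambda>x. \<Sum>i<n. f i * b i x)"

text \<open>Coordinates are taken in \<open>carrier (ZF {..<n})\<close>, so they vanish from
  \<open>n\<close> on and are unique. The bijection is then already the isomorphism with
  \<open>ZF {..<n}\<close> that \<open>ab_rank\<close> asks for.\<close>

definition has_basis :: "('x \<Rightarrow> int) set \<Rightarrow> nat \<Rightarrow> bool" where
  "has_basis K n \<longleftrightarrow> (\<exists>b. bij_betw (comb n b) (carrier (ZF {..<n})) K)"

text \<open>For a sublattice \<open>K\<close> of \<open>L\<close>, the elements of \<open>L\<close>
  in the saturation are those whose class modulo \<open>K\<close> is torsion; the multiplier is
  positive as in \<open>torsion\<close>.\<close>

definition saturation :: "('x \<Rightarrow> int) set \<Rightarrow> ('x \<Rightarrow> int) set" where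
  "saturation K = {f. \<exists>k>0. (\<lambda>x. k * f x) \<in> K}"

lemma carrier_ZF [simp]: "carrier (ZF S) = {f. \<forall>x. x \<notin> S \<longrightarrow> f x = 0}"
  by (simp add: ZF_def)

lemma ZF_outside: "f \<in> carrier (ZF S) \<Longrightarrow> x \<notin> S \<Longrightarrow> f x = 0"
  by simp

lemma ZF_eq_lattice_group: "ZF S = lattice_group (carrier (ZF S))"
  by (simp add: lattice_group_def ZF_def)

lemma ZF_restrict_carrier: "(ZF S)\<lparr>carrier := K\<rparr> = lattice_group K"
  by (simp add: lattice_group_def ZF_def)

lemma lattice_group_simps [simp]:
  "carrier (lattice_group K) = K"
  "f \<otimes>\<^bsub>lattice_group K\<^esub> g = (\<lambda>x. f x + g x)"
  "\<one>\<^bsub>lattice_group K\<^esub> = (\<lambda>_. 0)"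
  by (simp_all add: lattice_group_def)

lemma ZF_simps [simp]:
  "f \<otimes>\<^bsub>ZF S\<^esub> g = (\<lambda>x. f x + g x)"
  "\<one>\<^bsub>ZF S\<^esub> = (\<lambda>_. 0)"
  by (simp_all add: ZF_def)

lemma int_lattice_ZF: "int_lattice (carrier (ZF S))"
  by (simp add: int_lattice_def)

lemma int_lattice_zero: "int_lattice K \<Longrightarrow> (\<lambda>_. 0) \<in> K"
  by (simp add: int_lattice_def)

lemma int_lattice_diff: "int_lattice K \<Longrightarrow> f \<in> K \<Longrightarrow> g \<in> K \<Longrightarrow> (\<lambda>x. f x - g x) \<in> K"
  by (simp add: int_lattice_def)

lemma int_lattice_uminus: "int_lattice K \<Longrightarrow> f \<in> K \<Longrightarrow> (\<lambda>x. - f x) \<in> K"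
  using int_lattice_diff[OF _ int_lattice_zero, of K f] by simp

lemma int_lattice_add: "int_lattice K \<Longrightarrow> f \<in> K \<Longrightarrow> g \<in> K \<Longrightarrow> (\<lambda>x. f x + g x) \<in> K"
  using int_lattice_diff[OF _ _ int_lattice_uminus, of K f g] by simp

lemma int_lattice_scale:
  assumes "int_lattice K" "f \<in> K" shows "(\<lambda>x. k * f x) \<in> K"
proof -
  have n: "(\<lambda>x. int n * f x) \<in> K" for n
  proof (induction n)
    case 0 then show ?case using assms int_lattice_zero by simp
  next
    case (Suc n) then show ?case
      using int_lattice_add[OF assms(1) Suc.IH assms(2)] by (simp add: algebra_simps)
  qed
  show ?thesis
  proof (cases k)
    case (nonneg m) then show ?thesis using n by simp
  next
    case (neg m)
    then show ?thesis using int_lattice_uminus[OF assms(1) n[of "Suc m"]] by (simp only: mult_minus_left)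
  qed
qed

lemma int_lattice_comb:
  assumes "int_lattice K" "\<And>i. i < n \<Longrightarrow> b i \<in> K" shows "comb n b f \<in> K"
  using assms(2)
proof (induction n)
  case 0 then show ?case using assms(1) int_lattice_zero by (simp add: comb_def)
next
  case (Suc n)
  then have "comb n b f \<in> K" "b n \<in> K" by auto
  from int_lattice_add[OF assms(1) this(1) int_lattice_scale[OF assms(1) this(2), of "f n"]]
  show ?case by (simp add: comb_def)
qed

lemma comm_group_lattice_group:
  assumes "int_lattice K" shows "comm_group (lattice_group K)"
proof (rule comm_groupI)
  fix f assume "f \<in> carrier (lattice_group K)"
  then show "\<exists>g\<in>carrier (lattice_group K). g \<otimes>\<^bsub>lattice_group K\<^esub> f = \<one>\<^bsub>lattice_group K\<^esub>"
    using int_lattice_uminus[OF assms, of f] by (auto intro!: bexI[of _ "\<lambda>x. - f x"])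
qed (use assms in \<open>auto simp: int_lattice_add int_lattice_zero algebra_simps\<close>)

lemma group_lattice_group: "int_lattice K \<Longrightarrow> group (lattice_group K)"
  using comm_group_lattice_group comm_group_def by blast

lemma comm_group_ZF: "comm_group (ZF S)"
  using comm_group_lattice_group[OF int_lattice_ZF] ZF_eq_lattice_group by metis

lemma pow_lattice_group: "f [^]\<^bsub>lattice_group K\<^esub> (n::nat) = (\<lambda>x. int n * f x)"
proof (induction n)
  case 0
  then show ?case by (simp add: nat_pow_def)
next
  case (Suc n)
  then show ?case by (simp add: nat_pow_def algebra_simps)
qed

lemma subgroup_lattice_group:
  assumes "int_lattice L" "int_lattice K" "K \<subseteq> L" shows "subgroup K (lattice_group L)"
proof -
  interpret group "lattice_group L" using assms(1) by (rule group_lattice_group)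
  have inv: "inv\<^bsub>lattice_group L\<^esub> f = (\<lambda>x. - f x)" if "f \<in> L" for f
    using that int_lattice_uminus[OF assms(1)] by (intro inv_equality) auto
  show ?thesis
  proof (intro subgroupI)
    fix f assume f: "f \<in> K"
    then show "inv\<^bsub>lattice_group L\<^esub> f \<in> K"
      using inv[of f] assms int_lattice_uminus[OF assms(2) f] by auto
  qed (use assms in \<open>auto intro: int_lattice_add int_lattice_zero\<close>)
qed

lemma additive_on_subset: "additive_on K h \<Longrightarrow> L \<subseteq> K \<Longrightarrow> additive_on L h"
  by (auto simp: additive_on_def)

lemma additive_on_add:
  "additive_on K h \<Longrightarrow> f \<in> K \<Longrightarrow> g \<in> K \<Longrightarrow> h (\<lambda>x. f x + g x) = (\<lambda>y. h f y + h g y)"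
  by (simp add: additive_on_def)

lemma additive_on_zero:
  assumes "int_lattice K" "additive_on K h" shows "h (\<lambda>_. 0) = (\<lambda>_. 0)"
proof
  fix y
  have "h (\<lambda>_. 0) = (\<lambda>y. h (\<lambda>_. 0) y + h (\<lambda>_. 0) y)"
    using additive_on_add[OF assms(2) int_lattice_zero int_lattice_zero] assms(1) by simp
  from fun_cong[OF this, of y] show "h (\<lambda>_. 0) y = 0" by simp
qed

lemma additive_on_diff:
  assumes "int_lattice K" "additive_on K h" "f \<in> K" "g \<in> K"
  shows "h (\<lambda>x. f x - g x) = (\<lambda>y. h f y - h g y)"
  using additive_on_add[OF assms(2) int_lattice_diff[OF assms(1,3,4)] assms(4)]
  by (simp add: fun_eq_iff)

lemma additive_on_uminus:
  assumes "int_lattice K" "additive_on K h" "f \<in> K"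
  shows "h (\<lambda>x. - f x) = (\<lambda>y. - h f y)"
  using additive_on_diff[OF assms(1,2) int_lattice_zero[OF assms(1)] assms(3)]
    additive_on_zero[OF assms(1,2)] by simp

lemma additive_on_scale:
  assumes "int_lattice K" "additive_on K h" "f \<in> K"
  shows "h (\<lambda>x. k * f x) = (\<lambda>y. k * h f y)"
proof -
  have n: "h (\<lambda>x. int n * f x) = (\<lambda>y. int n * h f y)" for n
  proof (induction n)
    case 0 then show ?case using assms additive_on_zero by simp
  next
    case (Suc n) then show ?case
      using additive_on_add[OF assms(2) int_lattice_scale[OF assms(1,3)] assms(3), of "int n"]
      by (simp add: algebra_simps)
  qed
  show ?thesis
  proof (cases k)
    case (nonneg m) then show ?thesis using n by simp
  next
    case (neg m) then show ?thesis
      using additive_on_uminus[OF assms(1,2) int_lattice_scale[OF assms(1,3)], of "int (Suc m)"] n[of "Suc m"]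
      by (simp only: mult_minus_left)
  qed
qed

lemma additive_on_comb:
  assumes "int_lattice K" "additive_on K h" "\<And>i. i < n \<Longrightarrow> b i \<in> K"
  shows "h (comb n b f) = comb n (\<lambda>i. h (b i)) f"
  using assms(3)
proof (induction n)
  case 0 then show ?case using additive_on_zero[OF assms(1,2)] by (simp add: comb_def)
next
  case (Suc n)
  then have "comb n b f \<in> K" "b n \<in> K" by (auto intro: int_lattice_comb[OF assms(1)])
  then show ?case
    using additive_on_add[OF assms(2) \<open>comb n b f \<in> K\<close> int_lattice_scale[OF assms(1) \<open>b n \<in> K\<close>, of "f n"]]
      additive_on_scale[OF assms(1,2) \<open>b n \<in> K\<close>, of "f n"] Suc
    by (simp add: comb_def)
qed

lemma int_lattice_image:
  assumes "int_lattice K" "additive_on K h" shows "int_lattice (h ` K)"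
  unfolding int_lattice_def
proof (intro conjI ballI)
  show "(\<lambda>_. 0) \<in> h ` K"
    using additive_on_zero[OF assms] int_lattice_zero[OF assms(1)] by (rule image_eqI[OF sym])
  fix f g assume "f \<in> h ` K" "g \<in> h ` K"
  then obtain u w where "u \<in> K" "w \<in> K" "f = h u" "g = h w" by blast
  then show "(\<lambda>x. f x - g x) \<in> h ` K"
    using additive_on_diff[OF assms, of u w] int_lattice_diff[OF assms(1), of u w]
    by (intro image_eqI[of _ h "\<lambda>x. u x - w x"]) simp_all
qed

lemma int_lattice_kernel:
  assumes "int_lattice K" "additive_on K h" shows "int_lattice {f \<in> K. h f = (\<lambda>_. 0)}"
  using assms unfolding int_lattice_def[of "{f \<in> K. h f = (\<lambda>_. 0)}"]
  by (auto simp: int_lattice_zero int_lattice_diff additive_on_zero additive_on_diff)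

section \<open>Bases of sublattices\<close>

lemma basis_element_mem:
  assumes "bij_betw (comb n b) (carrier (ZF {..<n})) K" "i < n"
  shows "b i \<in> K"
proof -
  have "comb n b (\<lambda>j. if j = i then 1 else 0) = b i"
    using assms(2) by (auto simp: comb_def fun_eq_iff if_distrib[of "\<lambda>a. a * _"] sum.delta cong: if_cong)
  moreover have "(\<lambda>j. if j = i then 1 else 0) \<in> carrier (ZF {..<n})" using assms(2) by auto
  ultimately show ?thesis using assms(1) by (metis bij_betwE)
qed

lemma additive_comb: "additive_on K (comb n b)"
  by (auto simp: additive_on_def comb_def algebra_simps sum.distrib)

lemma has_basis_iso:
  assumes "has_basis K n" shows "ZF {..<n} \<cong> lattice_group K"
proof -
  obtain b where "bij_betw (comb n b) (carrier (ZF {..<n})) K" using assms by (auto simp: has_basis_def)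
  then have "comb n b \<in> iso (ZF {..<n}) (lattice_group K)"
    using bij_betw_imp_surj_on additive_comb[of "carrier (ZF {..<n})" n b]
    by (auto simp: iso_def hom_def additive_on_def)
  then show ?thesis by (auto simp: is_iso_def)
qed

text \<open>The images of the unit vectors form the basis. This turns an isomorphism as in the
  definition of \<open>ab_rank\<close> back into a basis, whose size is unique.\<close>

lemma iso_has_basis:
  assumes "int_lattice K" "lattice_group K \<cong> ZF {..<n}" shows "has_basis K n"
proof -
  interpret group "lattice_group K" using assms(1) by (rule group_lattice_group)
  from iso_sym[OF assms(2)] obtain h where h: "h \<in> iso (ZF {..<n}) (lattice_group K)"
    by (auto simp: is_iso_def)
  then have bij: "bij_betw h (carrier (ZF {..<n})) K" and add: "additive_on (carrier (ZF {..<n})) h"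
    by (auto simp: iso_def hom_def additive_on_def)
  define e :: "nat \<Rightarrow> nat \<Rightarrow> int" where "e = (\<lambda>i j. if j = i then 1 else 0)"
  have "h f = comb n (\<lambda>i. h (e i)) f" if "f \<in> carrier (ZF {..<n})" for f
  proof -
    have "f = comb n e f" using that
      by (auto simp: comb_def e_def fun_eq_iff if_distrib[of "\<lambda>a. _ * a"] sum.delta cong: if_cong)
    then show ?thesis using additive_on_comb[OF int_lattice_ZF add, of n e f] by (auto simp: e_def)
  qed
  with bij have "bij_betw (comb n (\<lambda>i. h (e i))) (carrier (ZF {..<n})) K"
    by (subst bij_betw_cong[symmetric]) auto
  then show ?thesis by (auto simp: has_basis_def)
qed

text \<open>Rank adds along kernel, lattice and image: a basis of the kernel is completed by lifts
  \<open>l\<close> of a basis of the image.\<close>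

lemma has_basis_extension:
  fixes h :: "('x \<Rightarrow> int) \<Rightarrow> 'y \<Rightarrow> int"
  assumes K: "int_lattice K" and h: "additive_on K h"
    and im: "has_basis (h ` K) n" and ker: "has_basis {f \<in> K. h f = (\<lambda>_. 0)} r"
  shows "has_basis K (r + n)"
proof -
  obtain c where c: "bij_betw (comb n c) (carrier (ZF {..<n})) (h ` K)" using im by (auto simp: has_basis_def)
  obtain b where b: "bij_betw (comb r b) (carrier (ZF {..<r})) {f \<in> K. h f = (\<lambda>_. 0)}"
    using ker by (auto simp: has_basis_def)
  have "\<forall>i. \<exists>k. i < n \<longrightarrow> k \<in> K \<and> h k = c i" using basis_element_mem[OF c] by (metis imageE)
  then obtain l where l: "\<And>i. i < n \<Longrightarrow> l i \<in> K \<and> h (l i) = c i" by metis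
  have bK: "b i \<in> K" "h (b i) = (\<lambda>_. 0)" if "i < r" for i using basis_element_mem[OF b that] by auto
  define B where "B = (\<lambda>i. if i < r then b i else l (i - r))"
  have BK: "B i \<in> K" if "i < r + n" for i using that bK l by (auto simp: B_def)
  have split: "comb (r + n) B f = (\<lambda>x. comb r b f x + comb n l (\<lambda>i. f (r + i)) x)" for f
  proof -
    have "(\<Sum>i<r+n. g i) = (\<Sum>i<r. g i) + (\<Sum>i<n. g (r + i))" for g :: "nat \<Rightarrow> int"
      by (induction n) auto
    then show ?thesis by (simp add: comb_def B_def)
  qed
  show ?thesis
    unfolding has_basis_def
  proof (intro exI[of _ B], unfold bij_betw_def, intro conjI)
    have hl: "h (comb n l f) = comb n c f" for f
      using additive_on_comb[OF K h, of n l f] l by (simp add: comb_def)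
    have hb: "comb r b f \<in> K" "h (comb r b f) = (\<lambda>_. 0)" for f
      using int_lattice_comb[OF K, of r b f] additive_on_comb[OF K h, of r b f] bK by (auto simp: comb_def)
    have lK: "comb n l f \<in> K" for f using l int_lattice_comb[OF K] by blast
    have hB: "h (comb (r + n) B f) = comb n c (\<lambda>i. f (r + i))" for f
      unfolding split using additive_on_add[OF h hb(1) lK] hb(2) hl by simp
    show "inj_on (comb (r + n) B) (carrier (ZF {..<r + n}))"
    proof (rule inj_onI)
      fix f g assume f: "f \<in> carrier (ZF {..<r + n})" and g: "g \<in> carrier (ZF {..<r + n})"
        and eq: "comb (r + n) B f = comb (r + n) B g"
      have "comb n c (\<lambda>i. f (r + i)) = comb n c (\<lambda>i. g (r + i))"
        using eq hB[of f] hB[of g] by simp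
      then have hi: "(\<lambda>i. f (r + i)) = (\<lambda>i. g (r + i))"
        using c f g unfolding bij_betw_def inj_on_def by auto
      \<comment> \<open>\<open>comb r b\<close> reads coordinates below \<open>r\<close> only;
        cutting off the others puts the function into the domain on which injectivity is
        known.\<close>
      have low: "comb r b u = comb r b (\<lambda>i. if i < r then u i else 0)" for u by (simp add: comb_def)
      have "comb r b f = comb r b g" using eq hi unfolding split by (simp add: fun_eq_iff)
      then have "comb r b (\<lambda>i. if i < r then f i else 0) = comb r b (\<lambda>i. if i < r then g i else 0)"
        unfolding low[of f] low[of g] .
      then have "(\<lambda>i. if i < r then f i else 0) = (\<lambda>i. if i < r then g i else 0)"
        using b unfolding bij_betw_def inj_on_def by auto
      from fun_cong[OF this] have "f i = g i" if "i < r" for i using that by (auto dest: meta_spec[of _ i])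
      moreover have "f i = g i" if "\<not> i < r" for i using fun_cong[OF hi, of "i - r"] that by simp
      ultimately show "f = g" by blast
    qed
    show "comb (r + n) B ` carrier (ZF {..<r + n}) = K"
    proof
      show "comb (r + n) B ` carrier (ZF {..<r + n}) \<subseteq> K"
        using int_lattice_comb[OF K, of "r + n" B] BK by blast
      show "K \<subseteq> comb (r + n) B ` carrier (ZF {..<r + n})"
      proof
        fix k assume k: "k \<in> K"
        obtain u where u: "u \<in> carrier (ZF {..<n})" "h k = comb n c u"
          using c k unfolding bij_betw_def by blast
        define d where "d = (\<lambda>x. k x - comb n l u x)"
        have "d \<in> K" "h d = (\<lambda>_. 0)"
          using int_lattice_diff[OF K k lK] additive_on_diff[OF K h k lK] u hl by (auto simp: d_def)
        then obtain w where w: "w \<in> carrier (ZF {..<r})" "d = comb r b w"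
          using b unfolding bij_betw_def by blast
        define f where "f = (\<lambda>i. if i < r then w i else u (i - r))"
        have "comb r b f = comb r b w" "(\<lambda>i. f (r + i)) = u" by (auto simp: comb_def f_def)
        then have "comb (r + n) B f = (\<lambda>x. d x + comb n l u x)" using w(2) unfolding split by simp
        then have "comb (r + n) B f = k" by (simp add: d_def)
        moreover have "f \<in> carrier (ZF {..<r + n})" using u w by (auto simp: f_def)
        ultimately show "k \<in> comb (r + n) B ` carrier (ZF {..<r + n})" by blast
      qed
    qed
  qed
qed

section \<open>Linear dependence and invariance of rank\<close>

lemma homogeneous_system_solution:
  fixes A :: "'s \<Rightarrow> nat \<Rightarrow> int"
  assumes "finite S" "m < card S"
  shows "\<exists>f. (\<forall>x. x \<notin> S \<longrightarrow> f x = 0) \<and> (\<exists>x\<in>S. f x \<noteq> 0) \<and> (\<forall>j<m. (\<Sum>i\<in>S. f i * A i j) = 0)"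
  using assms
proof (induction m arbitrary: S A)
  case 0
  then obtain s where "s \<in> S" by fastforce
  then show ?case by (intro exI[of _ "\<lambda>x. if x = s then 1 else 0"]) auto
next
  case (Suc m)
  show ?case
  proof (cases "\<forall>i\<in>S. A i m = 0")
    case True
    obtain f where "\<forall>x. x \<notin> S \<longrightarrow> f x = 0" "\<exists>x\<in>S. f x \<noteq> 0" "\<forall>j<m. (\<Sum>i\<in>S. f i * A i j) = 0"
      using Suc.IH[of S A] Suc.prems by auto
    with True show ?thesis by (intro exI[of _ f]) (auto simp: less_Suc_eq)
  next
    case False
    then obtain p where p: "p \<in> S" "A p m \<noteq> 0" by blast
    \<comment> \<open>Fraction-free elimination with pivot \<open>A p m\<close>: cross-multiplied
      coefficients avoid division, so the solution stays integral.\<close>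
    obtain f where f: "\<forall>x. x \<notin> S - {p} \<longrightarrow> f x = 0" "\<exists>x\<in>S - {p}. f x \<noteq> 0"
      "\<forall>j<m. (\<Sum>i\<in>S - {p}. f i * (A p m * A i j - A i m * A p j)) = 0"
      using Suc.IH[of "S - {p}" "\<lambda>i j. A p m * A i j - A i m * A p j"] Suc.prems p
      by (auto simp: less_diff_conv)
    \<comment> \<open>The other unknowns are scaled by the pivot, and the value at \<open>p\<close>
      is what equation \<open>m\<close> then forces.\<close>
    define g where "g = (\<lambda>i. if i = p then - (\<Sum>i\<in>S - {p}. f i * A i m) else A p m * f i)"
    have "(\<Sum>i\<in>S. g i * A i j) = 0" if "j < Suc m" for j
    proof -
      have "(\<Sum>i\<in>S. g i * A i j) = g p * A p j + (\<Sum>i\<in>S - {p}. g i * A i j)"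
        using Suc.prems p by (simp add: sum.remove)
      also have "\<dots> = (\<Sum>i\<in>S - {p}. f i * (A p m * A i j - A i m * A p j))"
        by (simp add: g_def sum_distrib_left sum_distrib_right sum_subtractf algebra_simps)
      also have "\<dots> = 0" using f(3) that by (cases "j = m") (auto simp: less_Suc_eq)
      finally show ?thesis .
    qed
    moreover have "\<exists>x\<in>S. g x \<noteq> 0" using f(2) p by (auto simp: g_def)
    moreover have "\<forall>x. x \<notin> S \<longrightarrow> g x = 0" using f(1) p by (auto simp: g_def)
    ultimately show ?thesis by blast
  qed
qed

text \<open>If \<open>n\<close> exceeded \<open>m\<close>, the images of the basis vectors would
  have too few coordinates to be independent, against injectivity. The map \<open>h\<close> is
  general because both inclusions and multiplication by a constant are used later.\<close>

lemma has_basis_mono: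
  assumes K: "has_basis K n" "int_lattice K" and L: "has_basis L m"
    and h: "additive_on K h" "inj_on h K" "h ` K \<subseteq> L"
  shows "n \<le> m"
proof (rule ccontr)
  assume "\<not> n \<le> m"
  obtain b where b: "bij_betw (comb n b) (carrier (ZF {..<n})) K" using K by (auto simp: has_basis_def)
  obtain c where c: "bij_betw (comb m c) (carrier (ZF {..<m})) L" using L by (auto simp: has_basis_def)
  have bK: "b i \<in> K" if "i < n" for i using basis_element_mem[OF b that] .
  have "\<forall>i. \<exists>u. i < n \<longrightarrow> h (b i) = comb m c u"
    using bK h(3) c unfolding bij_betw_def by blast
  then obtain A where A: "\<And>i. i < n \<Longrightarrow> h (b i) = comb m c (A i)" by metis
  obtain f where f: "\<forall>x. x \<notin> {..<n} \<longrightarrow> f x = 0" "\<exists>x\<in>{..<n}. f x \<noteq> 0"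
    "\<forall>j<m. (\<Sum>i<n. f i * A i j) = 0"
    using homogeneous_system_solution[of "{..<n}" m A] \<open>\<not> n \<le> m\<close> by auto
  have "h (comb n b f) = comb n (\<lambda>i. h (b i)) f" using additive_on_comb[OF K(2) h(1)] bK by blast
  also have "\<dots> = comb n (\<lambda>i. comb m c (A i)) f" using A by (simp add: comb_def)
  also have "\<dots> = comb m c (\<lambda>j. \<Sum>i<n. f i * A i j)"
    unfolding comb_def sum_distrib_left sum_distrib_right
    by (subst sum.swap) (simp add: mult.assoc)
  also have "\<dots> = (\<lambda>_. 0)" using f(3) by (simp add: comb_def)
  finally have "h (comb n b f) = h (\<lambda>_. 0)" using additive_on_zero[OF K(2) h(1)] by simp
  then have "comb n b f = (\<lambda>_. 0)"
    by (rule inj_onD[OF h(2)]) (auto intro: int_lattice_comb[OF K(2)] bK int_lattice_zero[OF K(2)])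
  also have "\<dots> = comb n b (\<lambda>_. 0)" by (simp add: comb_def)
  finally have "f = (\<lambda>_. 0)" using b f(1) unfolding bij_betw_def inj_on_def by auto
  then show False using f(2) by auto
qed

lemma has_basis_unique:
  assumes "has_basis K n" "has_basis K m" "int_lattice K" shows "n = m"
proof -
  have "additive_on K (\<lambda>f. f)" by (simp add: additive_on_def)
  then show ?thesis
    using has_basis_mono[OF assms(1,3,2), of "\<lambda>f. f"] has_basis_mono[OF assms(2,3,1), of "\<lambda>f. f"] by auto
qed

section \<open>Existence of bases, and saturated sublattices as kernels\<close>

lemma has_basis_zero: "has_basis {\<lambda>_. 0} 0"
  unfolding has_basis_def by (intro exI[of _ undefined]) (auto simp: bij_betw_def comb_def inj_on_def fun_eq_iff)

text \<open>Functions on one point are integers, so this is the fact that every subgroup of the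
  integers is cyclic, generated by its least positive element.\<close>

lemma has_basis_unit:
  fixes K :: "(unit \<Rightarrow> int) set"
  assumes K: "int_lattice K" shows "\<exists>n. has_basis K n"
proof (cases "K = {\<lambda>_. 0}")
  case True then show ?thesis using has_basis_zero by blast
next
  case False
  then obtain f where "f \<in> K" "f \<noteq> (\<lambda>_. 0)" using int_lattice_zero[OF K] by blast
  then have f0: "f () \<noteq> 0" by (auto simp: fun_eq_iff)
  have "\<exists>m::nat. 0 < m \<and> (\<lambda>_. int m) \<in> K"
  proof (cases "f () > 0")
    case True
    then have "(\<lambda>_. int (nat (f ()))) = f" by (auto simp: fun_eq_iff)
    with True \<open>f \<in> K\<close> show ?thesis by (intro exI[of _ "nat (f ())"]) auto
  next
    case False
    then have "(\<lambda>_. int (nat (- f ()))) = (\<lambda>x. - f x)" by (auto simp: fun_eq_iff)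
    with False f0 int_lattice_uminus[OF K \<open>f \<in> K\<close>] show ?thesis by (intro exI[of _ "nat (- f ())"]) auto
  qed
  then obtain m :: nat where m: "0 < m" "(\<lambda>_. int m) \<in> K"
    and least: "\<And>k. 0 < k \<Longrightarrow> (\<lambda>_. int k) \<in> K \<Longrightarrow> m \<le> k"
    using exists_least_iff[of "\<lambda>m. 0 < m \<and> (\<lambda>_. int m) \<in> K"] by (metis not_le_imp_less)
  have "int m dvd g ()" if "g \<in> K" for g
  proof -
    \<comment> \<open>The remainder of \<open>g ()\<close> lies in \<open>K\<close> and is smaller
      than the least positive element, hence zero.\<close>
    have "(\<lambda>x. g x - (g () div int m) * int m) \<in> K"
      using int_lattice_diff[OF K that int_lattice_scale[OF K m(2), of "g () div int m"]] .
    moreover have "(\<lambda>x. g x - (g () div int m) * int m) = (\<lambda>_. int (nat (g () mod int m)))"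
      using m(1) by (auto simp: fun_eq_iff minus_div_mult_eq_mod)
    ultimately have "(\<lambda>_. int (nat (g () mod int m))) \<in> K" by simp
    with least[of "nat (g () mod int m)"] m(1) have "nat (g () mod int m) = 0"
      by (smt (verit, best) gr0I nat_less_iff not_le of_nat_0_less_iff pos_mod_bound pos_mod_sign)
    then show ?thesis using m(1) by (simp add: dvd_eq_mod_eq_0 nat_eq_iff2)
       (smt (verit, best) of_nat_0_less_iff pos_mod_sign)
  qed
  note dvd = this
  have "bij_betw (comb 1 (\<lambda>_ _. int m)) (carrier (ZF {..<1})) K"
    unfolding bij_betw_def
  proof
    show "inj_on (comb 1 (\<lambda>_ _. int m)) (carrier (ZF {..<1}))"
      using m(1) by (auto simp: inj_on_def comb_def fun_eq_iff) (metis less_one not_gr_zero)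
    show "comb 1 (\<lambda>_ _. int m) ` carrier (ZF {..<1}) = K"
    proof
      show "comb 1 (\<lambda>_ _. int m) ` carrier (ZF {..<1}) \<subseteq> K"
        using int_lattice_comb[OF K, of 1 "\<lambda>_ _. int m"] m(2) by blast
      show "K \<subseteq> comb 1 (\<lambda>_ _. int m) ` carrier (ZF {..<1})"
      proof
        fix g assume "g \<in> K"
        from dvd[OF this] obtain c where "g () = int m * c" by blast
        then have "g = comb 1 (\<lambda>_ _. int m) (\<lambda>i. if i = 0 then c else 0)" by (auto simp: comb_def)
        then show "g \<in> comb 1 (\<lambda>_ _. int m) ` carrier (ZF {..<1})"
          by (rule image_eqI[where x = "\<lambda>i. if i = 0 then c else 0"]) auto
      qed
    qed
  qed
  then show ?thesis unfolding has_basis_def by (intro exI)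
qed

lemma has_basis_insert:
  assumes K: "int_lattice K" "K \<subseteq> carrier (ZF (insert s S))"
    and ker: "has_basis {f \<in> K. f s = 0} r"
    and im: "has_basis ((\<lambda>f (_::unit). f s) ` K) n"
  shows "has_basis K (r + n)"
proof -
  have "additive_on K (\<lambda>f (_::unit). f s)" by (simp add: additive_on_def)
  moreover have "{f \<in> K. (\<lambda>_::unit. f s) = (\<lambda>_. 0)} = {f \<in> K. f s = 0}" by (auto simp: fun_eq_iff)
  ultimately show ?thesis using has_basis_extension[OF K(1) _ im, of r] ker by simp
qed

text \<open>Evaluation at the new point has an image inside the integers and a kernel supported on
  the smaller set, so the rank is built up one coordinate at a time.\<close>

lemma has_basis_exists:
  assumes "finite S" "int_lattice K" "K \<subseteq> carrier (ZF S)"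
  shows "\<exists>n. has_basis K n"
  using assms
proof (induction S arbitrary: K)
  case empty
  then have "K = {\<lambda>_. 0}" using int_lattice_zero[OF empty(1)] by (auto simp: fun_eq_iff)
  then show ?case using has_basis_zero by blast
next
  case (insert s S)
  define h where "h = (\<lambda>(f::'a \<Rightarrow> int) (_::unit). f s)"
  have h: "additive_on K h" by (simp add: additive_on_def h_def)
  have "int_lattice {f \<in> K. h f = (\<lambda>_. 0)}" by (rule int_lattice_kernel[OF insert.prems(1) h])
  then have "int_lattice {f \<in> K. f s = 0}" by (simp add: h_def fun_eq_iff)
  moreover have "{f \<in> K. f s = 0} \<subseteq> carrier (ZF S)" using insert.prems(2) by auto
  ultimately obtain r where "has_basis {f \<in> K. f s = 0} r" using insert.IH by blast
  moreover obtain n where "has_basis (h ` K) n"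
    using has_basis_unit[OF int_lattice_image[OF insert.prems(1) h]] by blast
  ultimately show ?case using has_basis_insert[OF insert.prems] by (auto simp: h_def)
qed

lemma has_basis_ZF:
  assumes "finite S" shows "has_basis (carrier (ZF S)) (card S)"
  using assms
proof (induction S)
  case empty
  have "carrier (ZF {}) = {\<lambda>_::'a. 0}" by (auto simp: fun_eq_iff)
  then show ?case using has_basis_zero by simp
next
  case (insert s S)
  have ker: "{f \<in> carrier (ZF (insert s S)). f s = 0} = carrier (ZF S)" using insert by auto
  have im: "(\<lambda>f (_::unit). f s) ` carrier (ZF (insert s S)) = UNIV"
  proof -
    have "u = (\<lambda>_. (\<lambda>x. if x = s then u () else 0) s)" for u :: "unit \<Rightarrow> int" by auto
    then have "u \<in> (\<lambda>f (_::unit). f s) ` carrier (ZF (insert s S))" for u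
      by (rule image_eqI[where x = "\<lambda>x. if x = s then u () else 0"]) auto
    then show ?thesis by blast
  qed
  have "bij_betw (comb 1 (\<lambda>_ _. 1)) (carrier (ZF {..<1})) (UNIV :: (unit \<Rightarrow> int) set)"
    unfolding bij_betw_def
  proof
    show "inj_on (comb 1 (\<lambda>_ (_::unit). 1)) (carrier (ZF {..<1}))"
      by (auto simp: inj_on_def comb_def fun_eq_iff) (metis less_one not_gr_zero)
    have "u = comb 1 (\<lambda>_ _. 1) (\<lambda>i. if i = 0 then u () else 0)" for u :: "unit \<Rightarrow> int"
      by (auto simp: comb_def)
    then have "u \<in> comb 1 (\<lambda>_ _. 1) ` carrier (ZF {..<1})" for u :: "unit \<Rightarrow> int"
      by (rule image_eqI[where x = "\<lambda>i. if i = 0 then u () else 0"]) auto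
    then show "comb 1 (\<lambda>_ (_::unit). 1) ` carrier (ZF {..<1}) = UNIV" by blast
  qed
  then have "has_basis ((\<lambda>f (_::unit). f s) ` carrier (ZF (insert s S))) 1"
    unfolding im has_basis_def by (intro exI)
  from has_basis_insert[OF int_lattice_ZF order_refl _ this] insert ker show ?case by simp
qed

text \<open>The last hypothesis says that the quotient by \<open>K\<close> is torsion-free. The map
  \<open>p\<close> realises this quotient as a sublattice of \<open>carrier (ZF Q)\<close>, to which
  the existence of bases applies.\<close>

lemma saturated_is_kernel:
  assumes "finite Q" "int_lattice K" "K \<subseteq> carrier (ZF Q)"
    and "\<And>k f. k \<noteq> 0 \<Longrightarrow> (\<lambda>x. k * f x) \<in> K \<Longrightarrow> f \<in> K"
  shows "\<exists>p. additive_on (carrier (ZF Q)) p \<and> p ` carrier (ZF Q) \<subseteq> carrier (ZF Q)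
    \<and> (\<forall>f\<in>carrier (ZF Q). p f = (\<lambda>_. 0) \<longleftrightarrow> f \<in> K)"
  using assms
proof (induction Q arbitrary: K)
  case empty
  then show ?case using int_lattice_zero[OF empty(1)]
    by (intro exI[of _ "\<lambda>f. f"]) (auto simp: additive_on_def fun_eq_iff)
next
  case (insert q Q)
  define K' where "K' = {f \<in> K. f q = 0}"
  have "int_lattice K'" using insert.prems(1) by (auto simp: K'_def int_lattice_def)
  moreover have "K' \<subseteq> carrier (ZF Q)" using insert.prems(2) by (auto simp: K'_def)
  ultimately obtain p where p: "additive_on (carrier (ZF Q)) p" "p ` carrier (ZF Q) \<subseteq> carrier (ZF Q)"
    "\<And>f. f \<in> carrier (ZF Q) \<Longrightarrow> p f = (\<lambda>_. 0) \<longleftrightarrow> f \<in> K'"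
    using insert.IH[of K'] insert.prems(3) unfolding K'_def by auto
  show ?case
  proof (cases "\<forall>f\<in>K. f q = 0")
    case True
    \<comment> \<open>No element of \<open>K\<close> sees the coordinate \<open>q\<close>, so
      \<open>p'\<close> keeps it as an equation of its own.\<close>
    define p' where "p' f = (\<lambda>x. if x = q then f q else p (f(q := 0)) x)" for f
    have pq: "p (f(q := 0)) q = 0" if "f \<in> carrier (ZF (insert q Q))" for f
      using p(2) that insert.hyps(2) by (auto simp: image_subset_iff)
    have "additive_on (carrier (ZF (insert q Q))) p'"
      unfolding additive_on_def
    proof (intro ballI)
      fix f g assume "f \<in> carrier (ZF (insert q Q))" "g \<in> carrier (ZF (insert q Q))"
      then have "f(q := 0) \<in> carrier (ZF Q)" "g(q := 0) \<in> carrier (ZF Q)" by auto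
      from additive_on_add[OF p(1) this]
      have "p ((\<lambda>x. f x + g x)(q := 0)) = (\<lambda>y. p (f(q := 0)) y + p (g(q := 0)) y)"
        by (simp add: fun_upd_def if_distrib cong: if_cong)
      then show "p' (\<lambda>x. f x + g x) = (\<lambda>y. p' f y + p' g y)" by (auto simp: p'_def)
    qed
    moreover have "p' ` carrier (ZF (insert q Q)) \<subseteq> carrier (ZF (insert q Q))"
      using p(2) by (auto simp: p'_def image_subset_iff)
    moreover have "p' f = (\<lambda>_. 0) \<longleftrightarrow> f \<in> K" if f: "f \<in> carrier (ZF (insert q Q))" for f
    proof -
      have "p' f = (\<lambda>_. 0) \<longleftrightarrow> f q = 0 \<and> p (f(q := 0)) = (\<lambda>_. 0)"
        using pq[OF f] by (auto simp: p'_def fun_eq_iff split: if_splits)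
      also have "\<dots> \<longleftrightarrow> f q = 0 \<and> f(q := 0) \<in> K'" using p(3)[of "f(q := 0)"] f by auto
      also have "\<dots> \<longleftrightarrow> f \<in> K" using True by (auto simp: K'_def fun_upd_idem)
      finally show ?thesis .
    qed
    ultimately show ?thesis by blast
  next
    case False
    then obtain k where k: "k \<in> K" "k q \<noteq> 0" by blast
    \<comment> \<open>The argument of \<open>p\<close> vanishes at \<open>q\<close>, and modulo
      \<open>K\<close> it equals \<open>k q\<close> times \<open>f\<close>; saturation lets
      membership pass back to \<open>f\<close>.\<close>
    define p' where "p' f = p (\<lambda>x. k q * f x - f q * k x)" for f
    have in': "(\<lambda>x. k q * f x - f q * k x) \<in> carrier (ZF Q)" if "f \<in> carrier (ZF (insert q Q))" for f
    proof -
      have "k x = 0" "f x = 0" if "x \<notin> insert q Q" for x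
        using \<open>f \<in> carrier (ZF (insert q Q))\<close> insert.prems(2) k that by auto
      then have "k q * f x - f q * k x = 0" if "x \<notin> Q" for x using that by (cases "x = q") auto
      then show ?thesis by simp
    qed
    have "additive_on (carrier (ZF (insert q Q))) p'"
      unfolding additive_on_def
    proof (intro ballI)
      fix f g assume "f \<in> carrier (ZF (insert q Q))" "g \<in> carrier (ZF (insert q Q))"
      from additive_on_add[OF p(1) this[THEN in']]
      show "p' (\<lambda>x. f x + g x) = (\<lambda>y. p' f y + p' g y)" by (simp add: p'_def algebra_simps)
    qed
    moreover have "p' ` carrier (ZF (insert q Q)) \<subseteq> carrier (ZF (insert q Q))"
    proof (rule image_subsetI)
      fix f assume "f \<in> carrier (ZF (insert q Q))"
      then have "p' f \<in> carrier (ZF Q)" using in'[of f] p(2) unfolding p'_def by blast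
      then show "p' f \<in> carrier (ZF (insert q Q))" by simp
    qed
    moreover have "p' f = (\<lambda>_. 0) \<longleftrightarrow> f \<in> K" if f: "f \<in> carrier (ZF (insert q Q))" for f
    proof -
      have "p' f = (\<lambda>_. 0) \<longleftrightarrow> (\<lambda>x. k q * f x - f q * k x) \<in> K"
        using p(3)[OF in'[OF f]] by (simp add: p'_def K'_def)
      also have "\<dots> \<longleftrightarrow> (\<lambda>x. k q * f x) \<in> K"
      proof
        assume "(\<lambda>x. k q * f x - f q * k x) \<in> K"
        from int_lattice_add[OF insert.prems(1) this int_lattice_scale[OF insert.prems(1) k(1), of "f q"]]
        show "(\<lambda>x. k q * f x) \<in> K" by simp
      next
        assume "(\<lambda>x. k q * f x) \<in> K"
        from int_lattice_diff[OF insert.prems(1) this int_lattice_scale[OF insert.prems(1) k(1), of "f q"]]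
        show "(\<lambda>x. k q * f x - f q * k x) \<in> K" .
      qed
      also have "\<dots> \<longleftrightarrow> f \<in> K"
        using insert.prems(3)[OF k(2)] int_lattice_scale[OF insert.prems(1)] by blast
      finally show ?thesis .
    qed
    ultimately show ?thesis by blast
  qed
qed

section \<open>Saturation and the rank of a cokernel\<close>

lemma int_lattice_saturation:
  assumes "int_lattice K" shows "int_lattice (saturation K)"
  unfolding int_lattice_def
proof (intro conjI ballI)
  show "(\<lambda>_. 0) \<in> saturation K"
    using int_lattice_zero[OF assms] by (auto simp: saturation_def intro: exI[of _ 1])
  fix f g assume "f \<in> saturation K" "g \<in> saturation K"
  then obtain k l where k: "k > 0" "(\<lambda>x. k * f x) \<in> K" and l: "l > 0" "(\<lambda>x. l * g x) \<in> K"
    by (auto simp: saturation_def)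
  have "(\<lambda>x. (k * l) * (f x - g x)) \<in> K"
    using int_lattice_diff[OF assms int_lattice_scale[OF assms k(2), of l] int_lattice_scale[OF assms l(2), of k]]
    by (simp add: algebra_simps)
  then show "(\<lambda>x. f x - g x) \<in> saturation K"
    using k l by (auto simp: saturation_def intro!: exI[of _ "k * l"])
qed

lemma saturation_subset: "K \<subseteq> saturation K"
  by (auto simp: saturation_def intro: exI[of _ 1])

lemma saturation_subset_ZF: "K \<subseteq> carrier (ZF Q) \<Longrightarrow> saturation K \<subseteq> carrier (ZF Q)"
  by (fastforce simp: saturation_def)

lemma saturation_saturated:
  assumes "int_lattice K" "k \<noteq> 0" "(\<lambda>x. k * f x) \<in> saturation K"
  shows "f \<in> saturation K"
proof -
  obtain l where l: "l > 0" "(\<lambda>x. l * (k * f x)) \<in> K" using assms(3) by (auto simp: saturation_def)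
  \<comment> \<open>The absolute value restores a positive multiplier; a negative \<open>k\<close>
    costs only a sign on the element of \<open>K\<close>.\<close>
  have "(\<lambda>x. (l * \<bar>k\<bar>) * f x) \<in> K"
    using l(2) int_lattice_uminus[OF assms(1) l(2)] by (cases "k > 0") (simp_all add: mult.assoc)
  then show ?thesis using l assms(2) by (auto simp: saturation_def intro!: exI[of _ "l * \<bar>k\<bar>"])
qed

text \<open>Since \<open>p\<close> cuts out the saturation of the image, its own image is the
  cokernel of \<open>m\<close> modulo torsion, and \<open>n\<close> is the rank of the cokernel. The
  count rests on the fact that an image and its saturation have equal rank.\<close>

lemma rank_nullity:
  fixes m :: "('x \<Rightarrow> int) \<Rightarrow> 'y \<Rightarrow> int"
  assumes P: "finite P" and Q: "finite Q"
    and m: "additive_on (carrier (ZF P)) m" "m ` carrier (ZF P) \<subseteq> carrier (ZF Q)"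
  obtains r n and p :: "('y \<Rightarrow> int) \<Rightarrow> 'y \<Rightarrow> int" where "has_basis {f \<in> carrier (ZF P). m f = (\<lambda>_. 0)} r"
    and "additive_on (carrier (ZF Q)) p" and "has_basis (p ` carrier (ZF Q)) n"
    and "\<And>f. f \<in> carrier (ZF Q) \<Longrightarrow> p f = (\<lambda>_. 0) \<longleftrightarrow> f \<in> saturation (m ` carrier (ZF P))"
    and "n + card P = card Q + r"
proof -
  let ?I = "m ` carrier (ZF P)" let ?K = "{f \<in> carrier (ZF P). m f = (\<lambda>_. 0)}"
  have I: "int_lattice ?I" by (rule int_lattice_image[OF int_lattice_ZF m(1)])
  have S: "int_lattice (saturation ?I)" by (rule int_lattice_saturation[OF I])
  have SQ: "saturation ?I \<subseteq> carrier (ZF Q)" by (rule saturation_subset_ZF[OF m(2)])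
  obtain r where r: "has_basis ?K r"
    using has_basis_exists[OF P int_lattice_kernel[OF int_lattice_ZF m(1)]] by auto
  obtain i where i: "has_basis ?I i" using has_basis_exists[OF Q I m(2)] by auto
  obtain s where s: "has_basis (saturation ?I) s" using has_basis_exists[OF Q S SQ] by auto
  obtain p where p: "additive_on (carrier (ZF Q)) p" "p ` carrier (ZF Q) \<subseteq> carrier (ZF Q)"
    "\<And>f. f \<in> carrier (ZF Q) \<Longrightarrow> p f = (\<lambda>_. 0) \<longleftrightarrow> f \<in> saturation ?I"
    using saturated_is_kernel[OF Q S SQ] saturation_saturated[OF I] by (elim meta_impE exE conjE) auto
  obtain n where n: "has_basis (p ` carrier (ZF Q)) n"
    using has_basis_exists[OF Q int_lattice_image[OF int_lattice_ZF p(1)] p(2)] by auto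
  have "card P = r + i"
    using has_basis_unique[OF has_basis_ZF[OF P] has_basis_extension[OF int_lattice_ZF m(1) i r] int_lattice_ZF] .
  have "{f \<in> carrier (ZF Q). p f = (\<lambda>_. 0)} = saturation ?I" using p(3) SQ by blast
  then have "card Q = s + n"
    using has_basis_unique[OF has_basis_ZF[OF Q] has_basis_extension[OF int_lattice_ZF p(1) n] int_lattice_ZF] s
    by simp
  have "i \<le> s"
    by (rule has_basis_mono[OF i I s, of "\<lambda>f. f"]) (auto simp: additive_on_def saturation_subset[THEN subsetD])
  obtain b where b: "bij_betw (comb s b) (carrier (ZF {..<s})) (saturation ?I)"
    using s by (auto simp: has_basis_def)
  have "\<forall>j. \<exists>k. j < s \<longrightarrow> 0 < k \<and> (\<lambda>x. k * b j x) \<in> ?I"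
    using basis_element_mem[OF b] unfolding saturation_def by blast
  then obtain k where k: "\<And>j. j < s \<Longrightarrow> 0 < k j" "\<And>j. j < s \<Longrightarrow> (\<lambda>x. k j * b j x) \<in> ?I" by metis
  \<comment> \<open>One constant carries the whole saturation into the image, because finitely many
    basis vectors generate it. Multiplication by \<open>c\<close> is injective, so the saturation
    has no larger rank than the image.\<close>
  define c where "c = (\<Prod>j<s. k j)"
  have c: "c > 0" using k(1) by (auto simp: c_def intro!: prod_pos)
  have cb: "(\<lambda>x. c * b j x) \<in> ?I" if "j < s" for j
  proof -
    have "c = (\<Prod>j\<in>{..<s} - {j}. k j) * k j" using that by (simp add: c_def prod.remove)
    then show ?thesis
      using int_lattice_scale[OF I k(2)[OF that], of "\<Prod>j\<in>{..<s} - {j}. k j"] by (simp add: mult.assoc)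
  qed
  have "s \<le> i"
  proof (rule has_basis_mono[OF s S i, of "\<lambda>f x. c * f x"])
    show "additive_on (saturation ?I) (\<lambda>f x. c * f x)" by (simp add: additive_on_def algebra_simps)
    show "inj_on (\<lambda>f x. c * f x) (saturation ?I)" using c by (auto simp: inj_on_def fun_eq_iff)
    show "(\<lambda>f x. c * f x) ` saturation ?I \<subseteq> ?I"
    proof (rule image_subsetI)
      fix f assume "f \<in> saturation ?I"
      then obtain u where u: "f = comb s b u" using b unfolding bij_betw_def by blast
      have "(\<lambda>x. c * f x) = comb s (\<lambda>j x. c * b j x) u"
        unfolding u by (simp add: comb_def sum_distrib_left algebra_simps)
      then show "(\<lambda>x. c * f x) \<in> ?I"
        using int_lattice_comb[OF I, of s "\<lambda>j x. c * b j x" u] cb by simp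
    qed
  qed
  with \<open>i \<le> s\<close> \<open>card P = r + i\<close> \<open>card Q = s + n\<close> have "n + card P = card Q + r" by simp
  then show thesis by (intro that[of r p n] r n p(1)) (rule p(3))
qed

section \<open>Homomorphisms and quotients of lattices\<close>

lemma hom_lattice_group:
  "h \<in> hom (lattice_group K) (lattice_group L) \<longleftrightarrow> h ` K \<subseteq> L \<and> additive_on K h"
  by (auto simp: hom_def additive_on_def)

lemma normal_lattice_group:
  "int_lattice L \<Longrightarrow> int_lattice I \<Longrightarrow> I \<subseteq> L \<Longrightarrow> I \<lhd> lattice_group L"
  using comm_group.normal_iff_subgroup[OF comm_group_lattice_group] subgroup_lattice_group by blast

lemma r_coset_lattice_group [simp]: "I #>\<^bsub>lattice_group L\<^esub> f = (\<lambda>g x. g x + f x) ` I"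
  by (auto simp: r_coset_def)

lemma quotient_kernel_iso:
  fixes t :: "('x \<Rightarrow> int) \<Rightarrow> 'y \<Rightarrow> int"
  assumes L: "int_lattice L" and t: "additive_on L t"
  shows "lattice_group L Mod {f \<in> L. t f = (\<lambda>_. 0)} \<cong> lattice_group (t ` L)"
proof -
  interpret group_hom "lattice_group L" "lattice_group (t ` L)" t
    by (intro group_hom.intro group_hom_axioms.intro group_lattice_group int_lattice_image assms)
      (simp add: hom_lattice_group t)
  show ?thesis using FactGroup_iso by (simp add: kernel_def)
qed

lemma quotient_iso:
  fixes t :: "('x \<Rightarrow> int) \<Rightarrow> 'y \<Rightarrow> int"
  assumes L: "int_lattice L" and L': "int_lattice L'" and t: "additive_on L t" "t ` L = L'"
    and I': "int_lattice I'" "I' \<subseteq> L'" and I: "\<And>f. f \<in> L \<Longrightarrow> t f \<in> I' \<longleftrightarrow> f \<in> I" "I \<subseteq> L"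
  shows "lattice_group L Mod I \<cong> lattice_group L' Mod I'"
proof -
  let ?G = "lattice_group L" let ?H = "lattice_group L' Mod I'"
  have nI': "I' \<lhd> lattice_group L'" by (rule normal_lattice_group[OF L' I'])
  interpret N: normal I' "lattice_group L'" by (rule nI')
  interpret G: group ?G by (rule group_lattice_group[OF L])
  interpret t: group_hom ?G "lattice_group L'" t
    by (intro group_hom.intro group_hom_axioms.intro group_lattice_group L L')
      (simp add: hom_lattice_group t)
  have "(\<lambda>f. I' #>\<^bsub>lattice_group L'\<^esub> t f) \<in> hom ?G ?H"
    using N.r_coset_hom_Mod t.homh hom_compose[of t ?G "lattice_group L'"]
    unfolding comp_def by blast
  then interpret h: group_hom ?G ?H "\<lambda>f. I' #>\<^bsub>lattice_group L'\<^esub> t f"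
    by (intro group_hom.intro group_hom_axioms.intro G.is_group N.factorgroup_is_group)
  have "(\<lambda>f. I' #>\<^bsub>lattice_group L'\<^esub> t f) ` carrier ?G = carrier ?H"
    using t(2) by (auto simp: FactGroup_def RCOSETS_def)
  moreover have "kernel ?G ?H (\<lambda>f. I' #>\<^bsub>lattice_group L'\<^esub> t f) = I"
  proof -
    have "(I' #>\<^bsub>lattice_group L'\<^esub> t f = I') \<longleftrightarrow> f \<in> I" if "f \<in> L" for f
    proof -
      have "t f \<in> carrier (lattice_group L')" using t(2) that by auto
      then have "(I' #>\<^bsub>lattice_group L'\<^esub> t f = I') \<longleftrightarrow> t f \<in> I'"
        using N.coset_join1[OF _ _ N.subgroup_axioms] N.coset_join2[OF _ N.subgroup_axioms] by blast
      then show ?thesis using I(1)[OF that] by simp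
    qed
    then show ?thesis using I(2) by (auto simp: kernel_def)
  qed
  ultimately show ?thesis using h.FactGroup_iso by simp
qed

section \<open>Torsion and rank of cokernels\<close>

lemma saturation_imageE:
  assumes "f \<in> saturation (m ` L)"
  obtains k g where "k > 0" "g \<in> L" "(\<lambda>x. k * f x) = m g"
  using assms unfolding saturation_def by (elim CollectE exE conjE imageE) (rule that)

lemma torsion_quotient:
  assumes L: "int_lattice L" and I: "int_lattice I" "I \<subseteq> L"
  shows "torsion (lattice_group L Mod I) = (\<lambda>f. I #>\<^bsub>lattice_group L\<^esub> f) ` (L \<inter> saturation I)"
proof -
  let ?G = "lattice_group L"
  interpret N: normal I ?G by (rule normal_lattice_group[OF L I])
  interpret h: group_hom ?G "?G Mod I" "\<lambda>f. I #>\<^bsub>?G\<^esub> f"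
    by (intro group_hom.intro group_hom_axioms.intro group_lattice_group[OF L] N.factorgroup_is_group N.r_coset_hom_Mod)
  have "(I #>\<^bsub>?G\<^esub> f) [^]\<^bsub>?G Mod I\<^esub> n = \<one>\<^bsub>?G Mod I\<^esub> \<longleftrightarrow> (\<lambda>x. int n * f x) \<in> I" if f: "f \<in> L" for f n
  proof -
    have "(I #>\<^bsub>?G\<^esub> f) [^]\<^bsub>?G Mod I\<^esub> n = I #>\<^bsub>?G\<^esub> (\<lambda>x. int n * f x)"
      using h.hom_nat_pow[of f n] f by (simp del: r_coset_lattice_group add: pow_lattice_group)
    moreover have "(\<lambda>x. int n * f x) \<in> carrier ?G" using int_lattice_scale[OF L f] by simp
    then have "I #>\<^bsub>?G\<^esub> (\<lambda>x. int n * f x) = I \<longleftrightarrow> (\<lambda>x. int n * f x) \<in> I"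
      using N.coset_join1[OF _ _ N.subgroup_axioms] N.coset_join2[OF _ N.subgroup_axioms] by blast
    ultimately show ?thesis by simp
  qed
  note pow = this
  have sat: "(\<exists>n::nat. 0 < n \<and> (\<lambda>x. int n * f x) \<in> I) \<longleftrightarrow> f \<in> saturation I" for f
  proof
    assume "f \<in> saturation I"
    then obtain k where "k > 0" "(\<lambda>x. k * f x) \<in> I" by (auto simp: saturation_def)
    then show "\<exists>n::nat. 0 < n \<and> (\<lambda>x. int n * f x) \<in> I" by (intro exI[of _ "nat k"]) auto
  next
    assume "\<exists>n::nat. 0 < n \<and> (\<lambda>x. int n * f x) \<in> I"
    then obtain n :: nat where "0 < n" "(\<lambda>x. int n * f x) \<in> I" by blast
    then show "f \<in> saturation I" unfolding saturation_def by (intro CollectI exI[of _ "int n"]) auto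
  qed
  have "carrier (?G Mod I) = (\<lambda>f. I #>\<^bsub>?G\<^esub> f) ` L"
    by (auto simp: FactGroup_def RCOSETS_def)
  then have "torsion (?G Mod I) = (\<lambda>f. I #>\<^bsub>?G\<^esub> f) ` {f \<in> L. \<exists>n::nat. 0 < n \<and> (\<lambda>x. int n * f x) \<in> I}"
    unfolding torsion_def using pow by (auto simp del: r_coset_lattice_group one_FactGroup intro!: imageI)
  then show ?thesis using sat by (simp add: Int_def)
qed

text \<open>This is an equality and not only an isomorphism: both groups consist of cosets of
  \<open>I\<close> with set multiplication and unit \<open>I\<close>. So the torsion of a quotient
  is again a quotient of lattices.\<close>

lemma torsion_subgroup_quotient:
  assumes "int_lattice L" "int_lattice I" "I \<subseteq> L"
  shows "torsion_subgroup (lattice_group L Mod I) = lattice_group (L \<inter> saturation I) Mod I"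
  unfolding torsion_subgroup_def torsion_quotient[OF assms]
  by (auto simp: FactGroup_def RCOSETS_def set_mult_def fun_eq_iff)

text \<open>The map \<open>p\<close> factors through the quotient by \<open>I\<close>, and the
  kernel of the induced map is the torsion. The group property is recorded for reversing an
  isomorphism that starts at the double quotient.\<close>

lemma quotient_torsion_iso:
  fixes p :: "('x \<Rightarrow> int) \<Rightarrow> 'y \<Rightarrow> int"
  assumes L: "int_lattice L" and I: "int_lattice I" "I \<subseteq> L"
    and p: "additive_on L p" "\<And>f. f \<in> L \<Longrightarrow> p f = (\<lambda>_. 0) \<longleftrightarrow> f \<in> saturation I"
  shows "(lattice_group L Mod I) Mod torsion (lattice_group L Mod I) \<cong> lattice_group (p ` L)"
    and "group ((lattice_group L Mod I) Mod torsion (lattice_group L Mod I))"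
proof -
  let ?G = "lattice_group L" let ?H = "lattice_group (p ` L)"
  have nI: "I \<lhd> ?G" by (rule normal_lattice_group[OF L I])
  interpret N: normal I ?G by (rule nI)
  interpret p: group_hom ?G ?H p
    by (intro group_hom.intro group_hom_axioms.intro group_lattice_group int_lattice_image L p)
      (simp add: hom_lattice_group p)
  have "I \<subseteq> kernel ?G ?H p"
    using p(2) I(2) saturation_subset[of I] by (auto simp: kernel_def)
  then obtain g where g: "g \<in> hom (?G Mod I) ?H" "\<And>f. f \<in> carrier ?G \<Longrightarrow> g (I #>\<^bsub>?G\<^esub> f) = p f"
    using p.FactGroup_universal_kernel[OF nI] by blast
  interpret g: group_hom "?G Mod I" ?H g
    by (intro group_hom.intro group_hom_axioms.intro N.factorgroup_is_group g(1) p.H.is_group)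
  have carrier: "carrier (?G Mod I) = (\<lambda>f. I #>\<^bsub>?G\<^esub> f) ` L"
    by (auto simp: FactGroup_def RCOSETS_def)
  have "g ` carrier (?G Mod I) = carrier ?H"
    unfolding carrier image_image using g(2) by (simp del: r_coset_lattice_group)
  moreover have "kernel (?G Mod I) ?H g = torsion (?G Mod I)"
    unfolding kernel_def torsion_quotient[OF L I] carrier using g(2) p(2)
    by (auto simp del: r_coset_lattice_group)
  ultimately show "(?G Mod I) Mod torsion (?G Mod I) \<cong> ?H" "group ((?G Mod I) Mod torsion (?G Mod I))"
    using g.FactGroup_iso normal.factorgroup_is_group[OF g.normal_kernel] by simp_all
qed

lemma ab_rank_quotient:
  fixes p :: "('x \<Rightarrow> int) \<Rightarrow> 'y \<Rightarrow> int"
  assumes L: "int_lattice L" and I: "int_lattice I" "I \<subseteq> L"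
    and p: "additive_on L p" "\<And>f. f \<in> L \<Longrightarrow> p f = (\<lambda>_. 0) \<longleftrightarrow> f \<in> saturation I"
    and n: "has_basis (p ` L) n"
  shows "ab_rank (lattice_group L Mod I) = n"
  unfolding ab_rank_def
proof (rule the_equality)
  let ?T = "(lattice_group L Mod I) Mod torsion (lattice_group L Mod I)"
  note iso = quotient_torsion_iso[OF L I p]
  have pL: "int_lattice (p ` L)" by (rule int_lattice_image[OF L p(1)])
  interpret H: group "lattice_group (p ` L)" by (rule group_lattice_group[OF pL])
  interpret Z: group "ZF {..<n}" using comm_group_ZF comm_group_def by blast
  show *: "?T \<cong> ZF {..<n}"
    using iso_trans[OF iso(1) Z.iso_sym[OF has_basis_iso[OF n]]] .
  fix k :: nat assume k: "?T \<cong> ZF {..<k}"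
  have "has_basis (p ` L) k"
  proof (rule iso_has_basis[OF pL])
    show "lattice_group (p ` L) \<cong> ZF {..<k}"
      using iso_trans[OF group.iso_sym[OF iso(2,1)] k] .
  qed
  then show "k = n" using has_basis_unique n pL by blast
qed

text \<open>The isomorphism sends the class of \<open>m f / k\<close> to the class of \<open>m' (a f) / k\<close>; it is well defined by
  the case \<open>k = 0\<close> of the first divisibility hypothesis.\<close>
lemma torsion_cokernel_iso:
  fixes m :: "('p \<Rightarrow> int) \<Rightarrow> 'q \<Rightarrow> int" and m' :: "('r \<Rightarrow> int) \<Rightarrow> 's \<Rightarrow> int"
  assumes L: "int_lattice L" "additive_on L m" "m ` L \<subseteq> carrier (ZF Q)"
    and L': "int_lattice L'" "additive_on L' m'" "m' ` L' \<subseteq> carrier (ZF Q')"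
    and a: "additive_on L a" "a ` L \<subseteq> L'"
    and dvd: "\<And>f k. f \<in> L \<Longrightarrow> \<forall>y. k dvd m f y \<Longrightarrow> \<forall>y. k dvd m' (a f) y"
    and lift: "\<And>g k. g \<in> L' \<Longrightarrow> \<forall>y. k dvd m' g y \<Longrightarrow> \<exists>f\<in>L. a f = g \<and> (\<forall>y. k dvd m f y)"
    and ker: "\<And>f k. f \<in> L \<Longrightarrow> a f = (\<lambda>_. 0) \<Longrightarrow> \<forall>y. k dvd m f y \<Longrightarrow> \<exists>u\<in>L. m f = (\<lambda>y. k * m u y)"
  shows "torsion_subgroup (lattice_group (carrier (ZF Q)) Mod (m ` L))
    \<cong> torsion_subgroup (lattice_group (carrier (ZF Q')) Mod (m' ` L'))"
proof -
  have I: "int_lattice (m ` L)" and I': "int_lattice (m' ` L')"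
    using int_lattice_image L L' by blast+
  define Y where "Y = saturation (m ` L)"
  define Y' where "Y' = saturation (m' ` L')"
  have Y: "carrier (ZF Q) \<inter> saturation (m ` L) = Y" and Y': "carrier (ZF Q') \<inter> saturation (m' ` L') = Y'"
    using saturation_subset_ZF[OF L(3)] saturation_subset_ZF[OF L'(3)] by (auto simp: Y_def Y'_def)
  \<comment> \<open>The graph of the isomorphism. Numerator and denominator of an element of
    \<open>Y\<close> are not unique, so a relation is used and shown to be total on
    \<open>Y\<close>, additive and single-valued.\<close>
  define R where "R y z \<longleftrightarrow> (\<exists>k>0. \<exists>f\<in>L. (\<lambda>x. k * y x) = m f \<and> (\<lambda>x. k * z x) = m' (a f))" for y z
  have aL: "a f \<in> L'" if "f \<in> L" for f using that a(2) by blast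
  have kern: "m' (a f) = (\<lambda>_. 0)" if "f \<in> L" "m f = (\<lambda>_. 0)" for f
    using dvd[OF that(1), of 0] that(2) by (auto simp: fun_eq_iff)
  have scale: "m (\<lambda>x. c * f x) = (\<lambda>x. c * m f x)" "m' (a (\<lambda>x. c * f x)) = (\<lambda>x. c * m' (a f) x)"
    if f: "f \<in> L" for c f
    unfolding additive_on_scale[OF L(1,2) f] additive_on_scale[OF L(1) a(1) f]
      additive_on_scale[OF L'(1,2) aL[OF f]] by (rule refl)+
  have ex: "\<exists>z. R y z" if y: "y \<in> Y" for y
  proof -
    obtain k f where k: "k > 0" "f \<in> L" "(\<lambda>x. k * y x) = m f"
      using y unfolding Y_def by (rule saturation_imageE)
    have "\<forall>x. k dvd m f x" by (simp flip: k(3))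
    from dvd[OF k(2) this] have "(\<lambda>x. k * (m' (a f) x div k)) = m' (a f)" by simp
    with k show ?thesis unfolding R_def by (intro exI[of _ "\<lambda>x. m' (a f) x div k"]) blast
  qed
  have Radd: "R (\<lambda>x. y x + y' x) (\<lambda>x. z x + z' x)" if R: "R y z" "R y' z'" for y z y' z'
  proof -
    obtain k f where k: "k > 0" "f \<in> L" "(\<lambda>x. k * y x) = m f" "(\<lambda>x. k * z x) = m' (a f)"
      using R(1) by (auto simp: R_def)
    obtain l g where l: "l > 0" "g \<in> L" "(\<lambda>x. l * y' x) = m g" "(\<lambda>x. l * z' x) = m' (a g)"
      using R(2) by (auto simp: R_def)
    \<comment> \<open>Both fractions are brought to the common denominator
      \<open>k * l\<close>.\<close>
    define u where "u = (\<lambda>x. l * f x)" define w where "w = (\<lambda>x. k * g x)"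
    have uw: "u \<in> L" "w \<in> L" unfolding u_def w_def by (rule int_lattice_scale[OF L(1)], fact)+
    have m: "m u = (\<lambda>x. l * m f x)" "m w = (\<lambda>x. k * m g x)"
      unfolding u_def w_def by (rule scale k l)+
    have m': "m' (a u) = (\<lambda>x. l * m' (a f) x)" "m' (a w) = (\<lambda>x. k * m' (a g) x)"
      unfolding u_def w_def by (rule scale k l)+
    have "m (\<lambda>x. u x + w x) = (\<lambda>x. m u x + m w x)" by (rule additive_on_add[OF L(2) uw])
    also have "\<dots> = (\<lambda>x. (k * l) * (y x + y' x))"
      unfolding m k(3)[symmetric] l(3)[symmetric] by (simp add: algebra_simps)
    finally have 1: "(\<lambda>x. (k * l) * (y x + y' x)) = m (\<lambda>x. u x + w x)" by (rule sym)
    have "m' (a (\<lambda>x. u x + w x)) = (\<lambda>x. m' (a u) x + m' (a w) x)"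
      unfolding additive_on_add[OF a(1) uw] by (rule additive_on_add[OF L'(2) aL[OF uw(1)] aL[OF uw(2)]])
    also have "\<dots> = (\<lambda>x. (k * l) * (z x + z' x))"
      unfolding m' k(4)[symmetric] l(4)[symmetric] by (simp add: algebra_simps)
    finally have 2: "(\<lambda>x. (k * l) * (z x + z' x)) = m' (a (\<lambda>x. u x + w x))" by (rule sym)
    have "k * l > 0" using k(1) l(1) by simp
    with 1 2 int_lattice_add[OF L(1) uw] show ?thesis unfolding R_def by blast
  qed
  have uniq: "z = z'" if R: "R y z" "R y z'" for y z z'
  proof -
    obtain k f where k: "k > 0" "f \<in> L" "(\<lambda>x. k * y x) = m f" "(\<lambda>x. k * z x) = m' (a f)"
      using R(1) by (auto simp: R_def)
    obtain l g where l: "l > 0" "g \<in> L" "(\<lambda>x. l * y x) = m g" "(\<lambda>x. l * z' x) = m' (a g)"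
      using R(2) by (auto simp: R_def)
    define u where "u = (\<lambda>x. l * f x)" define w where "w = (\<lambda>x. k * g x)"
    have uw: "u \<in> L" "w \<in> L" unfolding u_def w_def by (rule int_lattice_scale[OF L(1)], fact)+
    have m: "m u = (\<lambda>x. l * m f x)" "m w = (\<lambda>x. k * m g x)"
      unfolding u_def w_def by (rule scale k l)+
    have m': "m' (a u) = (\<lambda>x. l * m' (a f) x)" "m' (a w) = (\<lambda>x. k * m' (a g) x)"
      unfolding u_def w_def by (rule scale k l)+
    have "m (\<lambda>x. u x - w x) = (\<lambda>x. m u x - m w x)" by (rule additive_on_diff[OF L(1,2) uw])
    also have "\<dots> = (\<lambda>_. 0)" unfolding m k(3)[symmetric] l(3)[symmetric] by (simp add: algebra_simps)
    \<comment> \<open>Two numerators of the same fraction over \<open>k * l\<close> differ by an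
      element of the kernel of \<open>m\<close>, which \<open>a\<close> sends into the kernel of
      \<open>m'\<close>.\<close>
    finally have "(\<lambda>_. 0) = m' (a (\<lambda>x. u x - w x))" using kern int_lattice_diff[OF L(1) uw] by simp
    also have "\<dots> = (\<lambda>x. m' (a u) x - m' (a w) x)"
      unfolding additive_on_diff[OF L(1) a(1) uw] by (rule additive_on_diff[OF L'(1,2) aL[OF uw(1)] aL[OF uw(2)]])
    also have "\<dots> = (\<lambda>x. (k * l) * (z x - z' x))" 
      unfolding m' k(4)[symmetric] l(4)[symmetric] by (simp add: algebra_simps)
    finally have "(k * l) * (z x - z' x) = 0" for x by (rule fun_cong[THEN sym])
    then show ?thesis using k(1) l(1) by auto
  qed
  define t where "t y = (SOME z. R y z)" for y
  have t: "R y (t y)" if "y \<in> Y" for y using someI_ex[OF ex[OF that]] by (simp add: t_def)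
  have RY: "z \<in> Y'" if "R y z" for y z
    using that aL by (auto simp: R_def Y'_def saturation_def)
  have tadd: "additive_on Y t"
    unfolding additive_on_def
  proof (intro ballI)
    fix y y' assume "y \<in> Y" "y' \<in> Y"
    then have "(\<lambda>x. y x + y' x) \<in> Y" unfolding Y_def by (rule int_lattice_add[OF int_lattice_saturation[OF I]])
    from uniq[OF t[OF this] Radd[OF t t]] \<open>y \<in> Y\<close> \<open>y' \<in> Y\<close>
    show "t (\<lambda>x. y x + y' x) = (\<lambda>x. t y x + t y' x)" by blast
  qed
  have surj: "t ` Y = Y'"
  proof
    show "t ` Y \<subseteq> Y'" using t RY by blast
    show "Y' \<subseteq> t ` Y"
    proof
      fix z assume "z \<in> Y'"
      then obtain k g where k: "k > 0" "g \<in> L'" "(\<lambda>x. k * z x) = m' g"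
        unfolding Y'_def by (rule saturation_imageE)
      have "\<forall>x. k dvd m' g x" by (simp flip: k(3))
      \<comment> \<open>The lift has a numerator divisible by the same \<open>k\<close>, so the
        fraction exists in the source.\<close>
      from lift[OF k(2) this] obtain f where f: "f \<in> L" "a f = g" "\<forall>x. k dvd m f x" by blast
      define y where "y = (\<lambda>x. m f x div k)"
      have y: "(\<lambda>x. k * y x) = m f" using f(3) by (simp add: y_def)
      then have "y \<in> Y" using k(1) f(1) by (auto simp: Y_def saturation_def)
      moreover have "R y z" using k f y by (auto simp: R_def)
      ultimately show "z \<in> t ` Y" using uniq t by blast
    qed
  qed
  have cong: "t y \<in> m' ` L' \<longleftrightarrow> y \<in> m ` L" if y: "y \<in> Y" for y
  proof
    assume "y \<in> m ` L"
    then obtain f where f: "f \<in> L" "y = m f" by blast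
    then have "R y (m' (a f))" unfolding R_def by (intro exI[of _ 1]) auto
    then show "t y \<in> m' ` L'" using uniq[OF t[OF y]] aL[OF f(1)] by blast
  next
    assume "t y \<in> m' ` L'"
    then obtain g where g: "g \<in> L'" "t y = m' g" by blast
    obtain k f where k: "k > 0" "f \<in> L" "(\<lambda>x. k * y x) = m f" "(\<lambda>x. k * t y x) = m' (a f)"
      using t[OF y] by (auto simp: R_def)
    \<comment> \<open>The case \<open>k = 1\<close> of \<open>lift\<close> imposes no divisibility.
      Subtracting \<open>k * h\<close> leaves the numerator \<open>d\<close> of
      \<open>y - m h\<close>, whose image in the other complex is 0.\<close>
    obtain h where h: "h \<in> L" "a h = g" using lift[OF g(1), of 1] by auto
    have kh: "(\<lambda>x. k * h x) \<in> L" by (rule int_lattice_scale[OF L(1) h(1)])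
    define d where "d = (\<lambda>x. f x - k * h x)"
    have d: "d \<in> L" unfolding d_def by (rule int_lattice_diff[OF L(1) k(2) kh])
    have md: "m d = (\<lambda>x. k * (y x - m h x))"
      unfolding d_def additive_on_diff[OF L(1,2) k(2) kh] additive_on_scale[OF L(1,2) h(1)]
      unfolding k(3)[symmetric] by (simp add: algebra_simps)
    have "a d = (\<lambda>x. a f x - k * g x)"
      unfolding d_def additive_on_diff[OF L(1) a(1) k(2) kh] additive_on_scale[OF L(1) a(1) h(1)] h(2) ..
    moreover have "m' (\<lambda>x. a f x - k * g x) = (\<lambda>_. 0)"
      unfolding additive_on_diff[OF L'(1,2) aL[OF k(2)] int_lattice_scale[OF L'(1) g(1)]]
        additive_on_scale[OF L'(1,2) g(1)] k(4)[symmetric] g(2) by simp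
    ultimately have m'd: "m' (a d) = (\<lambda>_. 0)" by simp
    \<comment> \<open>The case \<open>k = 0\<close> of \<open>lift\<close> gives an \<open>e\<close>
      in the kernel of \<open>m\<close> with the same value under \<open>a\<close> as
      \<open>d\<close>. So \<open>d - e\<close> is killed by \<open>a\<close> and has the same image
      under \<open>m\<close> as \<open>d\<close>, and \<open>ker\<close> applies to it.\<close>
    then obtain e where e: "e \<in> L" "a e = a d" "\<forall>x. 0 dvd m e x"
      using lift[OF aL[OF d], of 0] by auto
    have de: "(\<lambda>x. d x - e x) \<in> L" by (rule int_lattice_diff[OF L(1) d e(1)])
    have mde: "m (\<lambda>x. d x - e x) = m d"
      unfolding additive_on_diff[OF L(1,2) d e(1)] using e(3) by simp
    obtain u where u: "u \<in> L" "m d = (\<lambda>x. k * m u x)"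
      using ker[OF de, of k] unfolding additive_on_diff[OF L(1) a(1) d e(1)] mde by (auto simp: e(2) md)
    have "y = (\<lambda>x. m h x + m u x)"
    proof
      fix x
      have "k * (y x - m h x) = k * m u x" 
        using fun_cong[OF md, of x] fun_cong[OF u(2), of x] by (rule subst)
      then show "y x = m h x + m u x" using k(1) by simp
    qed
    also have "\<dots> = m (\<lambda>x. h x + u x)" by (rule additive_on_add[OF L(2) h(1) u(1), symmetric])
    finally show "y \<in> m ` L" using int_lattice_add[OF L(1) h(1) u(1)] by blast
  qed
  have "lattice_group Y Mod (m ` L) \<cong> lattice_group Y' Mod (m' ` L')"
  proof (rule quotient_iso[OF _ _ tadd surj I' _ cong])
    show "int_lattice Y" "int_lattice Y'" unfolding Y_def Y'_def by (rule int_lattice_saturation, fact)+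
    show "m' ` L' \<subseteq> Y'" "m ` L \<subseteq> Y" unfolding Y_def Y'_def by (rule saturation_subset)+
  qed
  then show ?thesis
    unfolding torsion_subgroup_quotient[OF int_lattice_ZF I L(3)]
      torsion_subgroup_quotient[OF int_lattice_ZF I' L'(3)] Y Y' .
qed

section \<open>Two-term complexes\<close>

lemma additive_lin: "additive_on K (lin P Q A)"
  by (auto simp: additive_on_def lin_def fun_eq_iff algebra_simps sum.distrib)

lemma lin_in_ZF: "lin P Q A f \<in> carrier (ZF Q)"
  by (auto simp: lin_def)

lemma cohom_no_source:
  assumes "\<And>f. lin P Q Z f = (\<lambda>_. 0)"
  shows "cohom P Q R Z A \<cong> lattice_group {f \<in> carrier (ZF Q). lin Q R A f = (\<lambda>_. 0)}"
    and "group (cohom P Q R Z A)"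
proof -
  let ?K = "{f \<in> carrier (ZF Q). lin Q R A f = (\<lambda>_. 0)}"
  have K: "int_lattice ?K" by (rule int_lattice_kernel[OF int_lattice_ZF additive_lin])
  have id: "additive_on ?K (\<lambda>f. f)" by (simp add: additive_on_def)
  have "{f \<in> ?K. f = (\<lambda>_. 0)} = {\<lambda>_. 0}" using int_lattice_zero[OF K] by auto
  moreover have "lin P Q Z ` carrier (ZF P) = {\<lambda>_. 0}"
    using assms by auto
  ultimately have eq: "cohom P Q R Z A = lattice_group ?K Mod {f \<in> ?K. f = (\<lambda>_. 0)}"
    by (simp add: cohom_def ZF_restrict_carrier del: carrier_ZF)
  show "cohom P Q R Z A \<cong> lattice_group ?K"
    unfolding eq using quotient_kernel_iso[OF K id] by simp
  show "group (cohom P Q R Z A)"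
    unfolding eq by (intro normal.factorgroup_is_group normal_lattice_group K int_lattice_kernel[OF K id]) blast
qed

lemma cohom_no_target:
  "cohom P Q {} A Z = lattice_group (carrier (ZF Q)) Mod (lin P Q A ` carrier (ZF P))"
  unfolding cohom_def ZF_restrict_carrier by (simp add: lin_def)

text \<open>For every \<open>k\<close>, the kernel of \<open>A\<close> modulo \<open>k\<close> is
  matched with that of \<open>A'\<close> together with arbitrary values on \<open>B\<close>:
  \<open>dvd\<close> makes \<open>a\<close> respect the kernels, \<open>lift\<close> is
  surjectivity, and \<open>ker\<close> says that nothing else is left modulo \<open>k\<close>. The
  rank formula compares Euler characteristics and is written with sums to stay in the natural
  numbers.\<close>

lemma two_term_comparison:
  fixes A :: "'p \<Rightarrow> 'q \<Rightarrow> int" and A' :: "'r \<Rightarrow> 's \<Rightarrow> int"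
    and a :: "('p \<Rightarrow> int) \<Rightarrow> 'r \<Rightarrow> int" and c :: "('p \<Rightarrow> int) \<Rightarrow> 'b \<Rightarrow> int"
  assumes fin: "finite P" "finite Q" "finite R" "finite S" "finite B"
    and a: "additive_on (carrier (ZF P)) a" "a ` carrier (ZF P) \<subseteq> carrier (ZF R)"
    and c: "additive_on (carrier (ZF P)) c" "c ` carrier (ZF P) \<subseteq> carrier (ZF B)"
    and dvd: "\<And>f k. f \<in> carrier (ZF P) \<Longrightarrow> \<forall>y. k dvd lin P Q A f y \<Longrightarrow> \<forall>y. k dvd lin R S A' (a f) y"
    and lift: "\<And>g h k. g \<in> carrier (ZF R) \<Longrightarrow> h \<in> carrier (ZF B) \<Longrightarrow> \<forall>y. k dvd lin R S A' g y
      \<Longrightarrow> \<exists>f\<in>carrier (ZF P). a f = g \<and> c f = h \<and> (\<forall>y. k dvd lin P Q A f y)"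
    and ker: "\<And>f k. f \<in> carrier (ZF P) \<Longrightarrow> a f = (\<lambda>_. 0) \<Longrightarrow> c f = (\<lambda>_. 0)
      \<Longrightarrow> \<forall>y. k dvd lin P Q A f y \<Longrightarrow> \<forall>x. k dvd f x"
    and Z: "\<And>f. lin T P Z f = (\<lambda>_. 0)" and Z': "\<And>f. lin T' R Z' f = (\<lambda>_. 0)"
  shows "\<exists>n::nat. cohom T P Q Z A \<cong> ZF {..<n}"
    and "cohom T P Q Z A \<cong> cohom T' R S Z' A' \<times>\<times> ZF {..<card B}"
    and "torsion_subgroup (cohom P Q {} A Y) \<cong> torsion_subgroup (cohom R S {} A' Y')"
    and "ab_rank (cohom P Q {} A Y) + card P + card S = ab_rank (cohom R S {} A' Y') + card Q + card R + card B"
proof -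
  let ?m = "lin P Q A" and ?m' = "lin R S A'" and ?L = "carrier (ZF P)" and ?L' = "carrier (ZF R)"
  let ?K = "{f \<in> ?L. ?m f = (\<lambda>_. 0)}" and ?K' = "{f \<in> ?L'. ?m' f = (\<lambda>_. 0)}"
  have K: "int_lattice ?K" and K': "int_lattice ?K'"
    by (rule int_lattice_kernel[OF int_lattice_ZF additive_lin])+
  have im: "?m ` ?L \<subseteq> carrier (ZF Q)" "?m' ` ?L' \<subseteq> carrier (ZF S)" using lin_in_ZF by blast+
  interpret K: group "lattice_group ?K" by (rule group_lattice_group[OF K])
  interpret K': group "lattice_group ?K'" by (rule group_lattice_group[OF K'])
  interpret C': group "cohom T' R S Z' A'" by (rule cohom_no_source(2)[OF Z'])
  interpret ZB: group "ZF B" using comm_group_ZF comm_group_def by blast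
  obtain r n and p :: "('q \<Rightarrow> int) \<Rightarrow> 'q \<Rightarrow> int" where r: "has_basis ?K r" and p: "additive_on (carrier (ZF Q)) p"
    "has_basis (p ` carrier (ZF Q)) n"
    "\<And>f. f \<in> carrier (ZF Q) \<Longrightarrow> p f = (\<lambda>_. 0) \<longleftrightarrow> f \<in> saturation (?m ` ?L)"
    "n + card P = card Q + r"
    by (rule rank_nullity[OF fin(1,2) additive_lin im(1)]) (rule that)
  obtain r' n' and p' :: "('s \<Rightarrow> int) \<Rightarrow> 's \<Rightarrow> int" where r': "has_basis ?K' r'" and p': "additive_on (carrier (ZF S)) p'"
    "has_basis (p' ` carrier (ZF S)) n'"
    "\<And>f. f \<in> carrier (ZF S) \<Longrightarrow> p' f = (\<lambda>_. 0) \<longleftrightarrow> f \<in> saturation (?m' ` ?L')"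
    "n' + card R = card S + r'"
    by (rule rank_nullity[OF fin(3,4) additive_lin im(2)]) (rule that)
  have ZK: "cohom T P Q Z A \<cong> lattice_group ?K" by (rule cohom_no_source(1)[OF Z])
  have rK: "lattice_group ?K \<cong> ZF {..<r}"
    by (rule group.iso_sym[OF _ has_basis_iso[OF r]]) (use comm_group_ZF comm_group_def in blast)
  show "\<exists>n::nat. cohom T P Q Z A \<cong> ZF {..<n}" using iso_trans[OF ZK rK] by blast
  have aK: "a f \<in> ?K'" if "f \<in> ?K" for f
    using that a(2) dvd[of f 0] by (auto simp: fun_eq_iff image_subset_iff simp del: carrier_ZF)
  \<comment> \<open>Divisibility by 0 means vanishing, so the hypotheses for \<open>k = 0\<close>
    speak about cocycles.\<close>
  have bij: "bij_betw (\<lambda>f. (a f, c f)) ?K (?K' \<times> carrier (ZF B))"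
    unfolding bij_betw_def
  proof
    show "inj_on (\<lambda>f. (a f, c f)) ?K"
    proof (rule inj_onI)
      fix f g assume f: "f \<in> ?K" and g: "g \<in> ?K" and eq: "(a f, c f) = (a g, c g)"
      have "(\<lambda>x. f x - g x) \<in> ?K" by (rule int_lattice_diff[OF K f g])
      moreover have "a (\<lambda>x. f x - g x) = (\<lambda>_. 0)" "c (\<lambda>x. f x - g x) = (\<lambda>_. 0)"
        using additive_on_diff[OF int_lattice_ZF a(1), of f g] additive_on_diff[OF int_lattice_ZF c(1), of f g] f g eq
        by simp_all
      ultimately have "\<forall>x. 0 dvd f x - g x" using ker[of "\<lambda>x. f x - g x" 0] by simp
      then show "f = g" by (simp add: fun_eq_iff)
    qed
    show "(\<lambda>f. (a f, c f)) ` ?K = ?K' \<times> carrier (ZF B)"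
    proof
      show "(\<lambda>f. (a f, c f)) ` ?K \<subseteq> ?K' \<times> carrier (ZF B)" using aK c(2) by blast
      show "?K' \<times> carrier (ZF B) \<subseteq> (\<lambda>f. (a f, c f)) ` ?K"
      proof (rule subrelI)
        fix g h assume gh: "(g, h) \<in> ?K' \<times> carrier (ZF B)"
        then obtain f where "f \<in> ?L" "a f = g" "c f = h" "\<forall>y. 0 dvd ?m f y"
          using lift[of g h 0] by (auto simp del: carrier_ZF)
        then show "(g, h) \<in> (\<lambda>f. (a f, c f)) ` ?K"
          by (intro image_eqI[of _ _ f]) (auto simp: fun_eq_iff)
      qed
    qed
  qed
  have "(\<lambda>f. (a f, c f)) \<in> hom (lattice_group ?K) (lattice_group ?K' \<times>\<times> ZF B)"
  proof (rule homI)
    fix f g assume "f \<in> carrier (lattice_group ?K)" "g \<in> carrier (lattice_group ?K)"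
    then show "(a (f \<otimes>\<^bsub>lattice_group ?K\<^esub> g), c (f \<otimes>\<^bsub>lattice_group ?K\<^esub> g))
      = (a f, c f) \<otimes>\<^bsub>lattice_group ?K' \<times>\<times> ZF B\<^esub> (a g, c g)"
      using additive_on_add[OF a(1), of f g] additive_on_add[OF c(1), of f g] by simp
  qed (use bij in \<open>auto simp: bij_betw_def simp del: carrier_ZF\<close>)
  then have isoK: "lattice_group ?K \<cong> lattice_group ?K' \<times>\<times> ZF B"
    using bij unfolding is_iso_def iso_def by (auto simp: DirProd_def simp del: carrier_ZF)
  have "lattice_group ?K' \<cong> cohom T' R S Z' A'" by (rule C'.iso_sym[OF cohom_no_source(1)[OF Z']])
  moreover have "ZF B \<cong> ZF {..<card B}"
    using group.iso_sym[OF _ has_basis_iso[OF has_basis_ZF[OF fin(5)]]] comm_group_ZF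
    unfolding ZF_eq_lattice_group[symmetric] comm_group_def by blast
  ultimately have "lattice_group ?K' \<times>\<times> ZF B \<cong> cohom T' R S Z' A' \<times>\<times> ZF {..<card B}"
    by (rule K'.DirProd_iso_trans)
  then show "cohom T P Q Z A \<cong> cohom T' R S Z' A' \<times>\<times> ZF {..<card B}"
    using iso_trans[OF ZK iso_trans[OF isoK]] by blast
  \<comment> \<open>On cocycles \<open>c\<close> is onto, and \<open>a\<close> carries its kernel
    bijectively to the other lattice of cocycles, so the ranks add.\<close>
  have "r = r' + card B"
  proof -
    have "additive_on ?K c" by (rule additive_on_subset[OF c(1)]) blast
    moreover have "c ` ?K = carrier (ZF B)"
    proof -
      have "c ` ?K = snd ` (\<lambda>f. (a f, c f)) ` ?K" by (simp add: image_image)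
      also have "\<dots> = snd ` (?K' \<times> carrier (ZF B))" using bij by (simp add: bij_betw_def)
      also have "\<dots> = carrier (ZF B)" using int_lattice_zero[OF K'] unfolding snd_image_times by (intro if_not_P) blast
      finally show ?thesis .
    qed
    moreover have "has_basis {f \<in> ?K. c f = (\<lambda>_. 0)} r'"
    proof -
      let ?N = "{f \<in> ?K. c f = (\<lambda>_. 0)}"
      have N: "int_lattice ?N" by (rule int_lattice_kernel[OF K \<open>additive_on ?K c\<close>])
      have aN: "additive_on ?N a" by (rule additive_on_subset[OF a(1)]) blast
      have "a ` ?N = ?K'"
      proof
        show "a ` ?N \<subseteq> ?K'" using aK by blast
        show "?K' \<subseteq> a ` ?N"
        proof
          fix g assume "g \<in> ?K'"
          then have "(g, \<lambda>_. 0) \<in> (\<lambda>f. (a f, c f)) ` ?K" using bij by (simp add: bij_betw_def)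
          then show "g \<in> a ` ?N" by (auto simp del: carrier_ZF)
        qed
      qed
      moreover have "{f \<in> ?N. a f = (\<lambda>_. 0)} = {\<lambda>_. 0}"
      proof
        show "{f \<in> ?N. a f = (\<lambda>_. 0)} \<subseteq> {\<lambda>_. 0}"
        proof
          fix f assume "f \<in> {f \<in> ?N. a f = (\<lambda>_. 0)}"
          then have "\<forall>x. 0 dvd f x" using ker[of f 0] by (simp del: carrier_ZF)
          then show "f \<in> {\<lambda>_. 0}" by auto
        qed
        show "{\<lambda>_. 0} \<subseteq> {f \<in> ?N. a f = (\<lambda>_. 0)}"
          using int_lattice_zero[OF N] additive_on_zero[OF N aN] by blast
      qed
      ultimately show ?thesis using has_basis_extension[OF N aN, of r' 0] r' has_basis_zero by simp
    qed
    ultimately have "has_basis ?K (r' + card B)"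
      using has_basis_extension[OF K, of c] has_basis_ZF[OF fin(5)] by simp
    then show ?thesis using has_basis_unique[OF r _ K] by blast
  qed
  have "ab_rank (cohom P Q {} A Y) = n"
    unfolding cohom_no_target
    by (rule ab_rank_quotient[OF int_lattice_ZF int_lattice_image[OF int_lattice_ZF additive_lin] im(1) p(1,3,2)])
  moreover have "ab_rank (cohom R S {} A' Y') = n'"
    unfolding cohom_no_target
    by (rule ab_rank_quotient[OF int_lattice_ZF int_lattice_image[OF int_lattice_ZF additive_lin] im(2) p'(1,3,2)])
  ultimately show "ab_rank (cohom P Q {} A Y) + card P + card S
      = ab_rank (cohom R S {} A' Y') + card Q + card R + card B"
    using p(4) p'(4) \<open>r = r' + card B\<close> by simp
  show "torsion_subgroup (cohom P Q {} A Y) \<cong> torsion_subgroup (cohom R S {} A' Y')"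
    unfolding cohom_no_target
  proof (rule torsion_cokernel_iso[OF int_lattice_ZF additive_lin im(1) int_lattice_ZF additive_lin im(2) a dvd])
    fix g k assume "g \<in> ?L'" "\<forall>y. k dvd ?m' g y"
    with lift[OF this(1) int_lattice_zero[OF int_lattice_ZF] this(2)]
    show "\<exists>f\<in>?L. a f = g \<and> (\<forall>y. k dvd ?m f y)" by blast
  next
    fix f k assume f: "f \<in> ?L" "a f = (\<lambda>_. 0)" "\<forall>y. k dvd ?m f y"
    \<comment> \<open>Here \<open>ker\<close> also asks for vanishing values of \<open>c\<close>.
      Lifting 0 with the prescribed values \<open>c f\<close> gives a cocycle, and subtracting it
      changes neither \<open>a f\<close> nor the image of \<open>f\<close>.\<close>
    have "c f \<in> carrier (ZF B)" using f(1) c(2) by blast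
    moreover have "\<forall>y. 0 dvd ?m' (\<lambda>_. 0) y" by (simp add: lin_def)
    ultimately obtain e where e: "e \<in> ?L" "a e = (\<lambda>_. 0)" "c e = c f" "\<forall>y. 0 dvd ?m e y"
      using lift[OF int_lattice_zero[OF int_lattice_ZF], of "c f" 0] by blast
    define d where "d = (\<lambda>x. f x - e x)"
    have d: "d \<in> ?L" unfolding d_def by (rule int_lattice_diff[OF int_lattice_ZF f(1) e(1)])
    have md: "?m d = ?m f"
      unfolding d_def additive_on_diff[OF int_lattice_ZF additive_lin f(1) e(1)] using e(4) by simp
    have "a d = (\<lambda>_. 0)" "c d = (\<lambda>_. 0)"
      unfolding d_def additive_on_diff[OF int_lattice_ZF a(1) f(1) e(1)]
        additive_on_diff[OF int_lattice_ZF c(1) f(1) e(1)] using f(2) e(2,3) by simp_all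
    with ker[OF d] md f(3) have kd: "\<forall>x. k dvd d x" by simp
    \<comment> \<open>For \<open>k = 0\<close> the function \<open>d\<close> is zero, so the
      division is exact in that case too.\<close>
    define u where "u = (\<lambda>x. d x div k)"
    have u: "u \<in> ?L" using d by (simp add: u_def)
    have "(\<lambda>x. k * u x) = d" using kd by (simp add: u_def)
    then have "?m f = (\<lambda>y. k * ?m u y)"
      using additive_on_scale[OF int_lattice_ZF additive_lin u, of P Q A k] md by simp
    with u show "\<exists>u\<in>?L. ?m f = (\<lambda>y. k * ?m u y)" by blast
  qed
qed

section \<open>Enhanced states of the two lowest cohomological degrees\<close>

locale graph_setup =
  fixes V :: "'a set" and E :: "'a set set" and rk :: "'a set \<Rightarrow> nat" and ori :: "'a set \<Rightarrow> 'a"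
  assumes simple: "simple_graph V E" and ori: "\<forall>e\<in>E. ori e \<in> e"
begin

lemma finite_V: "finite V"
  using simple by (simp add: simple_graph_def)

lemma edgeE:
  assumes "e \<in> E" obtains a b where "a \<noteq> b" "a \<in> V" "b \<in> V" "e = {a, b}"
  using simple assms unfolding simple_graph_def by blast

lemma edge_endpoints: "{a, b} \<in> E \<Longrightarrow> a \<noteq> b \<and> a \<in> V \<and> b \<in> V"
  by (erule edgeE) (auto simp: doubleton_eq_iff)

lemma edge_subset: "e \<in> E \<Longrightarrow> e \<subseteq> V"
  by (erule edgeE) auto

lemma card_edge: "e \<in> E \<Longrightarrow> card e = 2"
  by (erule edgeE) auto

lemma finite_E: "finite E"
  using edge_subset finite_V by (meson PowI finite_Pow_iff rev_finite_subset subsetI)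

lemma comp_of_no_edge: "x \<in> V \<Longrightarrow> comp_of V {} x = {x}"
  by (auto simp: comp_of_def)

lemma comps_no_edge: "comps V {} = (\<lambda>x. {x}) ` V"
  unfolding comps_def using comp_of_no_edge by auto

lemma comp_of_edge:
  assumes e: "e \<in> E" and x: "x \<in> V" shows "comp_of V {e} x = (if x \<in> e then e else {x})"
proof -
  obtain a b where ab: "a \<noteq> b" "a \<in> V" "b \<in> V" "e = {a, b}" using e by (rule edgeE)
  let ?R = "{(p, q). {p, q} \<in> {e}}"
  have "q = p \<or> p \<in> e \<and> q \<in> e" if "(p, q) \<in> ?R\<^sup>*" for p q
    using that by (induction rule: rtrancl_induct) (auto simp: ab doubleton_eq_iff)
  moreover have "(p, q) \<in> ?R\<^sup>*" if "p \<in> e" "q \<in> e" for p q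
    using that by (auto simp: ab doubleton_eq_iff)
  ultimately show ?thesis using x edge_subset[OF e] unfolding comp_of_def by auto
qed

lemma comps_edge: "e \<in> E \<Longrightarrow> comps V {e} = insert e ((\<lambda>z. {z}) ` (V - e))"
proof -
  assume e: "e \<in> E"
  then obtain a b where "a \<noteq> b" "a \<in> V" "b \<in> V" "e = {a, b}" by (rule edgeE)
  then have "a \<in> V \<and> a \<in> e" by auto
  then show ?thesis unfolding comps_def using comp_of_edge[OF e] edge_subset[OF e] by (auto simp: image_iff)
qed

lemma card_comps_edge: "e \<in> E \<Longrightarrow> card (comps V {e}) = card V - 1"
proof -
  assume e: "e \<in> E"
  have "e \<notin> (\<lambda>z. {z}) ` (V - e)" by auto
  moreover have "card ((\<lambda>z. {z}) ` (V - e)) = card V - 2"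
    using card_Diff_subset[OF _ edge_subset[OF e]] finite_subset[OF edge_subset[OF e] finite_V] card_edge[OF e]
    by (subst card_image) auto
  moreover have "2 \<le> card V" using card_mono[OF finite_V edge_subset[OF e]] card_edge[OF e] by simp
  ultimately show ?thesis using finite_V by (simp add: comps_edge[OF e])
qed

text \<open>The vertices \<open>b\<close> and \<open>d\<close> are redundant as representatives of
  components: \<open>d\<close> is an end of \<open>f\<close> outside \<open>e\<close>, and
  \<open>b\<close> is an end of \<open>e\<close> different from the other end \<open>c\<close> of
  \<open>f\<close>. This choice leaves \<open>a\<close> and \<open>c\<close> available even when the
  edges share a vertex.\<close>

lemma card_comps_two_edges:
  assumes "e \<in> E" "f \<in> E" "e \<noteq> f" shows "card (comps V {e, f}) + 2 \<le> card V"
proof -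
  have same: "comp_of V {e, f} p = comp_of V {e, f} q" if "{p, q} \<in> {e, f}" for p q
  proof -
    let ?R = "{(p, q). {p, q} \<in> {e, f}}"
    have "(p, q) \<in> ?R" "(q, p) \<in> ?R" using that by (auto simp: insert_commute)
    then have "(p, y) \<in> ?R\<^sup>* \<longleftrightarrow> (q, y) \<in> ?R\<^sup>*" for y by (meson converse_rtrancl_into_rtrancl)
    then show ?thesis by (simp add: comp_of_def)
  qed
  have "\<not> f \<subseteq> e" using assms card_edge card_subset_eq by (metis card.infinite zero_neq_numeral)
  then obtain d where d: "d \<in> f" "d \<notin> e" by blast
  obtain c where c: "f = {c, d}" "c \<noteq> d" using edgeE[OF assms(2)] d(1) by (metis insertE insert_commute singletonD)
  obtain a b where ab: "e = {a, b}" "a \<noteq> b" "b \<noteq> c"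
    using edgeE[OF assms(1)] by (metis insert_commute)
  let ?c = "comp_of V {e, f}"
  have "a \<in> V" "b \<in> V" "c \<in> V" "d \<in> V" using ab c edge_subset assms by auto
  have "?c a = ?c b" "?c c = ?c d" by (rule same, simp add: ab c)+
  have "?c ` V \<subseteq> ?c ` (V - {b, d})"
  proof (rule image_subsetI)
    fix x assume x: "x \<in> V"
    have "a \<in> V - {b, d}" "c \<in> V - {b, d}" using ab c d \<open>a \<in> V\<close> \<open>c \<in> V\<close> by auto
    then show "?c x \<in> ?c ` (V - {b, d})"
      using x \<open>?c a = ?c b\<close> \<open>?c c = ?c d\<close> by (cases "x = b \<or> x = d") auto
  qed
  then have "card (comps V {e, f}) \<le> card (?c ` (V - {b, d}))"
    unfolding comps_def using finite_V by (intro card_mono) auto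
  also have "\<dots> \<le> card (V - {b, d})" using finite_V by (intro card_image_le) auto
  also have "\<dots> = card V - 2"
    using \<open>b \<in> V\<close> \<open>d \<in> V\<close> ab d finite_V by (subst card_Diff_subset) auto
  finally have "card (comps V {e, f}) \<le> card V - 2" .
  moreover have "card {b, d} \<le> card V" using \<open>b \<in> V\<close> \<open>d \<in> V\<close> finite_V by (intro card_mono) auto
  moreover have "card {b, d} = 2" using ab d by auto
  ultimately show ?thesis by simp
qed

section \<open>Classification of the states in degree \<open>top_degree\<close>\<close>

abbreviation "top_degree \<equiv> 2 * int (card V) - 3"

text \<open>Components weigh at most 2 each, and two edges leave at most \<open>card V - 2\<close>
  of them, so the total weight misses the degree by at least 1.\<close>

lemma ES_2_empty: "ES V E 2 top_degree = {}"
proof -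
  have False if st: "(s, c) \<in> ES V E 2 top_degree" for s c
  proof -
    from st have s: "s \<subseteq> E" "card s = 2" and c: "c \<in> comps V s \<rightarrow>\<^sub>E {0, 1, 2}"
      and sum: "int (\<Sum>C\<in>comps V s. c C) = top_degree" by (auto simp: ES_def)
    obtain e f where ef: "s = {e, f}" "e \<noteq> f" using s(2) by (meson card_2_iff)
    have "(\<Sum>C\<in>comps V s. c C) \<le> card (comps V s) * 2"
      using sum_bounded_above[of "comps V s" c 2] c by (force dest: PiE_mem)
    then show False using sum card_comps_two_edges[of e f] s ef by (simp del: of_nat_sum)
  qed
  then show ?thesis by (metis ex_in_conv surj_pair)
qed

text \<open>Weights are counted by their deficit from 2, which is 2 for weight 0 and 1 for weight 1.
  In degree \<open>top_degree\<close> the total deficit is 3 for a state without edges and 1 for a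
  state with one edge.\<close>

lemma sum_exponents:
  assumes "finite S" "\<And>C. C \<in> S \<Longrightarrow> c C \<in> {0, 1, 2 :: nat}"
  shows "int (\<Sum>C\<in>S. c C) = 2 * int (card S) - 2 * int (card {C \<in> S. c C = 0}) - int (card {C \<in> S. c C = 1})"
  using assms
proof (induction S)
  case (insert C S)
  have "{D \<in> insert C S. c D = i} = (if c C = i then insert C {D \<in> S. c D = i} else {D \<in> S. c D = i})" for i
    by auto
  moreover have "c C = 0 \<or> c C = 1 \<or> c C = 2" using insert.prems[of C] by simp
  moreover have "int (sum c S) = 2 * int (card S) - 2 * int (card {C \<in> S. c C = 0}) - int (card {C \<in> S. c C = 1})"
    using insert.IH insert.prems by blast
  ultimately show ?case using insert.hyps by (elim disjE) simp_all
qed simp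

text \<open>As in the next two definitions, the restriction matches the extensional functions of
  \<open>ES\<close>, so states with the same edges are equal when they agree on the
  components.\<close>

definition stP :: "'a \<Rightarrow> 'a \<Rightarrow> 'a estate" where
  "stP x y = ({}, \<lambda>C\<in>comps V {}. if C = {x} then 0 else if C = {y} then 1 else 2)"

definition stT :: "'a set \<Rightarrow> 'a estate" where
  "stT T = ({}, \<lambda>C\<in>comps V {}. if C \<subseteq> T then 1 else 2)"

definition stE :: "'a set \<Rightarrow> 'a set \<Rightarrow> 'a estate" where
  "stE e D = ({e}, \<lambda>C\<in>comps V {e}. if C = D then 1 else 2)"

definition pairs :: "('a \<times> 'a) set" where "pairs = {(x, y). x \<in> V \<and> y \<in> V \<and> x \<noteq> y}"
definition triples :: "'a set set" where "triples = {T. T \<subseteq> V \<and> card T = 3}"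

lemma restrict_eq_iff: "restrict f A = restrict g A \<longleftrightarrow> (\<forall>x\<in>A. f x = g x)"
  by (auto simp: restrict_def fun_eq_iff)

lemma PiE_restrict_eq: "c \<in> A \<rightarrow>\<^sub>E S \<Longrightarrow> c = restrict f A \<longleftrightarrow> (\<forall>x\<in>A. c x = f x)"
  using PiE_restrict[of c A "\<lambda>_. S"] restrict_eq_iff[of c A f] by auto

lemma stP_apply: "v \<in> V \<Longrightarrow> snd (stP x y) {v} = (if v = x then 0 else if v = y then 1 else 2)"
  by (simp add: stP_def comps_no_edge)

lemma stT_apply: "v \<in> V \<Longrightarrow> snd (stT T) {v} = (if v \<in> T then 1 else 2)"
  by (simp add: stT_def comps_no_edge)

lemma stP_eq_iff:
  assumes "(x, y) \<in> pairs" "(x', y') \<in> pairs" shows "stP x y = stP x' y' \<longleftrightarrow> x = x' \<and> y = y'"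
proof
  assume eq: "stP x y = stP x' y'"
  have "x \<in> V" "y \<in> V" "x \<noteq> y" using assms(1) by (auto simp: pairs_def)
  then have "snd (stP x' y') {x} = 0" "snd (stP x' y') {y} = 1"
    unfolding eq[symmetric] by (simp_all add: stP_apply)
  then show "x = x' \<and> y = y'"
    using \<open>x \<in> V\<close> \<open>y \<in> V\<close> by (simp add: stP_apply split: if_splits)
qed simp

lemma stT_eq_iff:
  assumes "T \<subseteq> V" "T' \<subseteq> V" shows "stT T = stT T' \<longleftrightarrow> T = T'"
proof
  assume eq: "stT T = stT T'"
  have "v \<in> T \<longleftrightarrow> v \<in> T'" if "v \<in> V" for v
  proof -
    have "(if v \<in> T then 1 else 2 :: nat) = (if v \<in> T' then 1 else 2)"
      unfolding stT_apply[OF that, symmetric] eq ..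
    then show ?thesis by (simp split: if_splits)
  qed
  then show "T = T'" using assms by blast
qed simp

lemma stP_neq_stT: "(x, y) \<in> pairs \<Longrightarrow> stP x y \<noteq> stT T"
  using stP_apply[of x x y] stT_apply[of x T] by (auto simp: pairs_def split: if_splits)

lemma stE_eq_iff:
  "e \<in> E \<Longrightarrow> D \<in> comps V {e} \<Longrightarrow> D' \<in> comps V {e'} \<Longrightarrow> stE e D = stE e' D' \<longleftrightarrow> e = e' \<and> D = D'"
  by (auto simp: stE_def restrict_eq_iff split: if_splits)

text \<open>The deficit is 3, and 2 + 1 and 1 + 1 + 1 are the only ways to write it with parts 1 and
  2.\<close>

lemma ES_0: "ES V E 0 top_degree = case_prod stP ` pairs \<union> stT ` triples"
proof -
  have inj: "inj_on (\<lambda>x. {x}) S" for S :: "'a set" by auto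
  have set: "{C \<in> comps V {}. P C} = (\<lambda>x. {x}) ` {x \<in> V. P {x}}" for P
    by (auto simp: comps_no_edge)
  have card_sets: "card {C \<in> comps V {}. P C} = card {x \<in> V. P {x}}" for P
    unfolding set by (rule card_image[OF inj])
  have card_comps: "card (comps V {}) = card V" using card_sets[of "\<lambda>_. True"] by simp
  have fin: "finite (comps V {})" using finite_V by (simp add: comps_no_edge)
  have mem: "({}, c) \<in> ES V E 0 top_degree \<longleftrightarrow> 2 * card {x \<in> V. c {x} = 0} + card {x \<in> V. c {x} = 1} = 3"
    if c: "c \<in> comps V {} \<rightarrow>\<^sub>E {0, 1, 2}" for c
  proof -
    have "C \<in> comps V {} \<Longrightarrow> c C \<in> {0, 1, 2}" for C using c by (rule PiE_mem)
    from sum_exponents[OF fin this] c show ?thesis by (auto simp: ES_def card_sets card_comps)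
  qed
  show ?thesis
  proof (intro equalityI subsetI)
    fix st assume st: "st \<in> ES V E 0 top_degree"
    then obtain c where c: "st = ({}, c)" "c \<in> comps V {} \<rightarrow>\<^sub>E {0, 1, 2}"
      using finite_E by (auto simp: ES_def dest: finite_subset)
    have cV: "c {x} \<in> {0, 1, 2}" if "x \<in> V" for x
      using PiE_mem[OF c(2), of "{x}"] that by (auto simp: comps_no_edge)
    let ?A = "{x \<in> V. c {x} = 0}" and ?B = "{x \<in> V. c {x} = 1}"
    have "2 * card ?A + card ?B = 3" using mem[OF c(2)] st c(1) by simp
    then have "card ?A = 1 \<and> card ?B = 1 \<or> card ?A = 0 \<and> card ?B = 3" by arith
    then show "st \<in> case_prod stP ` pairs \<union> stT ` triples"
    proof
      assume 1: "card ?A = 1 \<and> card ?B = 1"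
      then obtain x y where xy: "?A = {x}" "?B = {y}" by (auto simp: card_1_singleton_iff)
      then have "x \<in> ?A" "y \<in> ?B" by blast+
      then have p: "(x, y) \<in> pairs" by (auto simp: pairs_def)
      have "c {v} = (if {v} = {x} then 0 else if {v} = {y} then 1 else 2)" if "v \<in> V" for v
        using cV[OF that] xy that \<open>x \<in> ?A\<close> \<open>y \<in> ?B\<close> by auto
      then have "st = stP x y"
        unfolding stP_def c(1) using PiE_restrict_eq[OF c(2)] by (auto simp: comps_no_edge)
      with p show ?thesis by force
    next
      assume 2: "card ?A = 0 \<and> card ?B = 3"
      then have "?A = {}" using finite_V by simp
      moreover have "c {v} = (if {v} \<subseteq> ?B then 1 else 2)" if "v \<in> V" for v
        using cV[OF that] that \<open>?A = {}\<close> by auto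
      then have "st = stT ?B"
        unfolding stT_def c(1) using PiE_restrict_eq[OF c(2)] by (auto simp: comps_no_edge)
      moreover have "?B \<in> triples" using 2 by (auto simp: triples_def)
      ultimately show ?thesis by blast
    qed
  next
    fix st assume "st \<in> case_prod stP ` pairs \<union> stT ` triples"
    then consider x y where "(x, y) \<in> pairs" "st = stP x y" | T where "T \<in> triples" "st = stT T" by auto
    then show "st \<in> ES V E 0 top_degree"
    proof cases
      case 1
      define c where "c = (\<lambda>C\<in>comps V {}. if C = {x} then 0 else if C = {y} then 1 else (2::nat))"
      have sets: "{v \<in> V. c {v} = 0} = {x}" "{v \<in> V. c {v} = 1} = {y}"
        using 1(1) by (auto simp: c_def pairs_def comps_no_edge split: if_splits)
      have "c \<in> comps V {} \<rightarrow>\<^sub>E {0, 1, 2}" by (simp add: c_def)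
      then have "({}, c) \<in> ES V E 0 top_degree" by (subst mem) (simp_all only: sets, simp_all)
      then show ?thesis using 1(2) by (simp add: stP_def c_def)
    next
      case 2
      define c where "c = (\<lambda>C\<in>comps V {}. if C \<subseteq> T then 1 else (2::nat))"
      have sets: "{v \<in> V. c {v} = 0} = {}" "{v \<in> V. c {v} = 1} = T"
        using 2(1) by (auto simp: c_def triples_def comps_no_edge split: if_splits)
      have "c \<in> comps V {} \<rightarrow>\<^sub>E {0, 1, 2}" by (simp add: c_def)
      moreover have "card T = 3" using 2(1) by (simp add: triples_def)
      ultimately have "({}, c) \<in> ES V E 0 top_degree"
        by (subst mem) (simp_all only: sets card.empty mult_0_right add_0)
      then show ?thesis using 2(2) by (simp add: stT_def c_def)
    qed
  qed
qed

text \<open>One edge leaves \<open>card V - 1\<close> components and hence deficit 1, which a single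
  component of weight 1 must supply.\<close>

lemma ES_1: "ES V E 1 top_degree = {stE e D | e D. e \<in> E \<and> D \<in> comps V {e}}"
proof -
  have fin: "finite (comps V {e})" for e using finite_V by (simp add: comps_def)
  \<comment> \<open>Keeps the natural number subtraction in \<open>card V - 1\<close> exact.\<close>
  have pos: "1 \<le> card V" if "e \<in> E" for e
    using edgeE[OF that] finite_V by (metis One_nat_def Suc_leI card_gt_0_iff empty_iff)
  have mem: "({e}, c) \<in> ES V E 1 top_degree \<longleftrightarrow>
      2 * card {C \<in> comps V {e}. c C = 0} + card {C \<in> comps V {e}. c C = 1} = 1"
    if e: "e \<in> E" and c: "c \<in> comps V {e} \<rightarrow>\<^sub>E {0, 1, 2}" for e c
  proof -
    have "C \<in> comps V {e} \<Longrightarrow> c C \<in> {0, 1, 2}" for C using c by (rule PiE_mem)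
    from sum_exponents[OF fin this] c e pos[OF e] show ?thesis
      by (auto simp: ES_def card_comps_edge[OF e] of_nat_diff)
  qed
  show ?thesis
  proof (intro equalityI subsetI)
    fix st assume st: "st \<in> ES V E 1 top_degree"
    then obtain e c where c: "st = ({e}, c)" "e \<in> E" "c \<in> comps V {e} \<rightarrow>\<^sub>E {0, 1, 2}"
      by (auto simp: ES_def card_1_singleton_iff)
    have cC: "c C \<in> {0, 1, 2}" if "C \<in> comps V {e}" for C using PiE_mem[OF c(3) that] .
    let ?A = "{C \<in> comps V {e}. c C = 0}" and ?B = "{C \<in> comps V {e}. c C = 1}"
    have "2 * card ?A + card ?B = 1" using mem[OF c(2,3)] st c(1) by simp
    then have "card ?A = 0" "card ?B = 1" by arith+
    then obtain D where D: "?A = {}" "?B = {D}" using fin[of e] by (auto simp: card_1_singleton_iff)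
    then have "D \<in> comps V {e}" by blast
    moreover have "c C = (if C = D then 1 else 2)" if "C \<in> comps V {e}" for C
      using cC[OF that] D that by auto
    then have "st = stE e D"
      unfolding stE_def c(1) using PiE_restrict_eq[OF c(3)] by auto
    ultimately show "st \<in> {stE e D | e D. e \<in> E \<and> D \<in> comps V {e}}" using c(2) by blast
  next
    fix st assume "st \<in> {stE e D | e D. e \<in> E \<and> D \<in> comps V {e}}"
    then obtain e D where e: "st = stE e D" "e \<in> E" "D \<in> comps V {e}" by blast
    define c where "c = (\<lambda>C\<in>comps V {e}. if C = D then 1 else (2::nat))"
    have sets: "{C \<in> comps V {e}. c C = 0} = {}" "{C \<in> comps V {e}. c C = 1} = {D}"
      using e(3) by (auto simp: c_def split: if_splits)
    have "c \<in> comps V {e} \<rightarrow>\<^sub>E {0, 1, 2}" by (simp add: c_def)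
    then have "({e}, c) \<in> ES V E 1 top_degree"
      by (subst mem[OF e(2)]) (simp_all only: sets card.empty mult_0_right add_0 card_insert_if, simp_all)
    then show "st \<in> ES V E 1 top_degree" using e(1) by (simp add: stE_def c_def)
  qed
qed

end

section \<open>The differential\<close>

context graph_setup
begin

lemma dE_no_edge:
  assumes "{a, b} \<in> E"
  shows "dE V {a, b} ({}, c) = (if 3 \<le> c {a} + c {b} then None
    else Some ({{a, b}}, \<lambda>D\<in>comps V {{a, b}}. if D = {a, b} then c {a} + c {b} else c D))"
proof -
  have ab: "a \<noteq> b" "a \<in> V" "b \<in> V" using edge_endpoints[OF assms] by auto
  then have T: "comp_of V {} ` {a, b} = {{a}, {b}}" by (simp add: comp_of_no_edge)
  have sums: "card {{a}, {b}} = 2" "\<Union>{{a}, {b}} = {a, b}" "sum c {{a}, {b}} = c {a} + c {b}" using ab by auto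
  show ?thesis by (simp only: dE_def prod.case Let_def T sums refl if_True)
qed

lemma dE_eq_stE:
  assumes e: "{a, b} \<in> E" and D: "D \<in> comps V {{a, b}}"
  shows "dE V {a, b} ({}, c) = Some (stE {a, b} D) \<longleftrightarrow>
    c {a} + c {b} = (if D = {a, b} then 1 else 2) \<and> (\<forall>v\<in>V - {a, b}. c {v} = (if D = {v} then 1 else 2))"
    (is "?L = ?R")
proof -
  have "?L \<longleftrightarrow> c {a} + c {b} < 3 \<and>
      (\<forall>C\<in>comps V {{a, b}}. (if C = {a, b} then c {a} + c {b} else c C) = (if C = D then 1 else 2))"
    unfolding dE_no_edge[OF e] stE_def by (simp add: restrict_eq_iff)
  also have "\<dots> \<longleftrightarrow> c {a} + c {b} < 3 \<and> c {a} + c {b} = (if D = {a, b} then 1 else 2) \<and>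
      (\<forall>v\<in>V - {a, b}. c {v} = (if D = {v} then 1 else 2))"
  proof -
    have split: "(\<forall>C\<in>comps V {{a, b}}. P C) \<longleftrightarrow> P {a, b} \<and> (\<forall>v\<in>V - {a, b}. P {v})" for P
      unfolding comps_edge[OF e] by simp
    have ne: "{v} \<noteq> {a, b}" for v using edge_endpoints[OF e] by auto
    have sym: "{a, b} = D \<longleftrightarrow> D = {a, b}" "{v} = D \<longleftrightarrow> D = {v}" for v by auto
    show ?thesis unfolding split by (simp only: ne sym if_True if_False refl)
  qed
  \<comment> \<open>A merged weight of 1 or 2 satisfies the truncation bound.\<close>
  also have "\<dots> \<longleftrightarrow> ?R" by auto
  finally show ?thesis .
qed

text \<open>No component of a \<open>stE\<close> state has weight 0, so \<open>x\<close> must be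
  merged. The merged weight is that of the other end: it is 1 if that end is \<open>y\<close>, and
  then the edge carries the 1; otherwise it is 2 and \<open>y\<close> still carries the 1.\<close>

lemma stP_hits:
  assumes e: "{a, b} \<in> E" and D: "D \<in> comps V {{a, b}}" and xy: "(x, y) \<in> pairs"
  shows "dE V {a, b} (stP x y) = Some (stE {a, b} D) \<longleftrightarrow>
    (if D = {a, b} then {x, y} = {a, b} else x \<in> {a, b} \<and> D = {y})"
proof -
  have ab: "a \<noteq> b" "a \<in> V" "b \<in> V" using edge_endpoints[OF e] by auto
  have V: "x \<in> V" "y \<in> V" "x \<noteq> y" using xy by (auto simp: pairs_def)
  have val: "snd (stP x y) {v} = (if v = x then 0 else if v = y then 1 else 2)" if "v \<in> V" for v
    using stP_apply[OF that] .
  have "stP x y = ({}, snd (stP x y))" by (simp add: stP_def)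
  then have "dE V {a, b} (stP x y) = Some (stE {a, b} D) \<longleftrightarrow>
    snd (stP x y) {a} + snd (stP x y) {b} = (if D = {a, b} then 1 else 2) \<and>
    (\<forall>v\<in>V - {a, b}. snd (stP x y) {v} = (if D = {v} then 1 else 2))"
    using dE_eq_stE[OF e D, of "snd (stP x y)"] by simp
  also have "\<dots> \<longleftrightarrow> (if D = {a, b} then {x, y} = {a, b} else x \<in> {a, b} \<and> D = {y})"
  proof (cases "x \<in> {a, b}")
    case False
    then have "\<not> (\<forall>v\<in>V - {a, b}. snd (stP x y) {v} = (if D = {v} then 1 else 2))"
      using V val[of x] by (intro notI) (drule bspec[of _ _ x], auto split: if_splits)
    then show ?thesis using False by auto
  next
    case True
    \<comment> \<open>Stated for an unnamed other end \<open>u\<close>, since \<open>x\<close> may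
      be either end of the edge.\<close>
    have key: "snd (stP x y) {x} + snd (stP x y) {u} = (if D = {a, b} then 1 else 2) \<and>
        (\<forall>v\<in>V - {a, b}. snd (stP x y) {v} = (if D = {v} then 1 else 2))
        \<longleftrightarrow> (if D = {a, b} then y = u else D = {y})"
      if u: "{a, b} = {x, u}" for u
    proof -
      have u': "u \<in> V" "u \<noteq> x" using u ab by (auto simp: doubleton_eq_iff)
      have vals: "snd (stP x y) {x} = 0" "snd (stP x y) {u} = (if u = y then 1 else 2)"
        using val V u' by simp_all
      have rest: "(\<forall>v\<in>V - {a, b}. snd (stP x y) {v} = (if D = {v} then 1 else 2))
        \<longleftrightarrow> (\<forall>v\<in>V - {a, b}. v = y \<longleftrightarrow> D = {v})"
      proof (rule ball_cong[OF refl])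
        fix v assume v: "v \<in> V - {a, b}"
        then show "snd (stP x y) {v} = (if D = {v} then 1 else 2) \<longleftrightarrow> (v = y \<longleftrightarrow> D = {v})"
          using val[of v] True by auto
      qed
      show ?thesis
      proof (cases "D = {a, b}")
        case D: True
        have "D \<noteq> {v}" for v using ab D by auto
        then show ?thesis unfolding vals rest using D u V by auto
      next
        case False
        then obtain z where z: "D = {z}" "z \<in> V - {a, b}" using D comps_edge[OF e] by auto
        then show ?thesis unfolding vals rest using False u V by auto
      qed
    qed
    from True show ?thesis
    proof
      assume "x = a"
      then show ?thesis using key[of b] ab by (auto simp: doubleton_eq_iff)
    next
      assume "x \<in> {b}"
      then show ?thesis using key[of a] ab by (auto simp: doubleton_eq_iff add.commute insert_commute)
    qed
  qed
  finally show ?thesis .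
qed

text \<open>Merging weights 1 and 2, or 2 and 2, gives zero. So two vertices of \<open>T\<close> are
  merged, to weight 2, and the third keeps its weight 1.\<close>

lemma stT_hits:
  assumes e: "{a, b} \<in> E" and D: "D \<in> comps V {{a, b}}" and T: "T \<in> triples"
  shows "dE V {a, b} (stT T) = Some (stE {a, b} D) \<longleftrightarrow> D \<noteq> {a, b} \<and> T = D \<union> {a, b}"
proof -
  have ab: "a \<noteq> b" "a \<in> V" "b \<in> V" using edge_endpoints[OF e] by auto
  have V: "T \<subseteq> V" "card T = 3" using T by (auto simp: triples_def)
  have val: "snd (stT T) {v} = (if v \<in> T then 1 else 2)" if "v \<in> V" for v using stT_apply[OF that] .
  have "stT T = ({}, snd (stT T))" by (simp add: stT_def)
  then have "dE V {a, b} (stT T) = Some (stE {a, b} D) \<longleftrightarrow>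
    snd (stT T) {a} + snd (stT T) {b} = (if D = {a, b} then 1 else 2) \<and>
    (\<forall>v\<in>V - {a, b}. snd (stT T) {v} = (if D = {v} then 1 else 2))"
    using dE_eq_stE[OF e D, of "snd (stT T)"] by simp
  also have "\<dots> \<longleftrightarrow> D \<noteq> {a, b} \<and> a \<in> T \<and> b \<in> T \<and> (\<forall>v\<in>V - {a, b}. v \<in> T \<longleftrightarrow> D = {v})"
    using ab by (auto simp: val)
  also have "\<dots> \<longleftrightarrow> D \<noteq> {a, b} \<and> T = D \<union> {a, b}"
  proof (cases "D = {a, b}")
    case False
    then obtain z where z: "D = {z}" "z \<in> V" "z \<noteq> a" "z \<noteq> b" using D comps_edge[OF e] by auto
    have "a \<in> T \<and> b \<in> T \<and> (\<forall>v\<in>V - {a, b}. v \<in> T \<longleftrightarrow> z = v) \<longleftrightarrow> T = {z} \<union> {a, b}"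
    proof
      assume L: "a \<in> T \<and> b \<in> T \<and> (\<forall>v\<in>V - {a, b}. v \<in> T \<longleftrightarrow> z = v)"
      have "v \<in> T \<longleftrightarrow> v \<in> {z} \<union> {a, b}" for v
        using L V(1) z(2) by (cases "v \<in> {a, b}"; cases "v \<in> V") auto
      then show "T = {z} \<union> {a, b}" by blast
    next
      assume "T = {z} \<union> {a, b}"
      then show "a \<in> T \<and> b \<in> T \<and> (\<forall>v\<in>V - {a, b}. v \<in> T \<longleftrightarrow> z = v)" by auto
    qed
    then show ?thesis using False by (simp add: z(1))
  qed simp
  finally show ?thesis .
qed

text \<open>Only the addition of \<open>e\<close> produces the edge set of \<open>stE e D\<close>,
  and the sign is positive because the source has no edges that could precede
  \<open>e\<close>.\<close>

lemma dcoef_stE: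
  assumes e: "e \<in> E" and st: "fst st = {}"
  shows "dcoef V E rk st (stE e D) = (if dE V e st = Some (stE e D) then 1 else 0)"
proof -
  obtain c where c: "st = ({}, c)" using st by (cases st) auto
  have only: "dE V e' st \<noteq> Some (stE e D)" if e': "e' \<in> E" "e' \<noteq> e" for e'
  proof -
    obtain a b where ab: "e' = {a, b}" using e'(1) by (rule edgeE)
    show ?thesis unfolding c ab dE_no_edge[OF e'(1)[unfolded ab]] using e'(2) by (auto simp: stE_def ab)
  qed
  have "dcoef V E rk st (stE e D) = (\<Sum>e'\<in>E. if dE V e' st = Some (stE e D) then 1 else 0)"
    unfolding dcoef_def st by (simp cong: if_cong)
  also have "\<dots> = (\<Sum>e'\<in>{e}. if dE V e' st = Some (stE e D) then 1 else 0)"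
    using e finite_E only by (intro sum.mono_neutral_right) auto
  finally show ?thesis by simp
qed

abbreviation "C0 \<equiv> ES V E 0 top_degree"
abbreviation "C1 \<equiv> ES V E 1 top_degree"
abbreviation "diff01 \<equiv> lin C0 C1 (dcoef V E rk)"

lemma finite_pairs: "finite pairs"
  using finite_V by (auto simp: pairs_def intro: finite_subset[of _ "V \<times> V"])

lemma finite_triples: "finite triples"
  using finite_V by (auto simp: triples_def)

lemma finite_C0: "finite C0"
  by (simp add: ES_0 finite_pairs finite_triples)

lemma finite_C1: "finite C1"
proof -
  have "C1 = case_prod stE ` (SIGMA e:E. comps V {e})" unfolding ES_1 by auto
  then show ?thesis using finite_E finite_V by (simp add: comps_def)
qed

lemma d_as_sum:
  assumes "e \<in> E" "D \<in> comps V {e}"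
  shows "diff01 f (stE e D) = (\<Sum>st\<in>{st \<in> C0. dE V e st = Some (stE e D)}. f st)"
proof -
  have "stE e D \<in> C1" unfolding ES_1 using assms by blast
  then have "diff01 f (stE e D) = (\<Sum>st\<in>C0. f st * dcoef V E rk st (stE e D))" by (simp add: lin_def)
  also have "\<dots> = (\<Sum>st\<in>C0. if dE V e st = Some (stE e D) then f st else 0)"
  proof (rule sum.cong[OF refl])
    fix st assume "st \<in> C0"
    then have "fst st = {}" by (auto simp: ES_0 stP_def stT_def)
    from dcoef_stE[OF assms(1) this] show "f st * dcoef V E rk st (stE e D)
      = (if dE V e st = Some (stE e D) then f st else 0)" by simp
  qed
  also have "\<dots> = (\<Sum>st\<in>{st \<in> C0. dE V e st = Some (stE e D)}. f st)"
    using finite_C0 by (simp add: sum.If_cases Int_def)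
  finally show ?thesis .
qed

lemma d_edge:
  assumes e: "{a, b} \<in> E" shows "diff01 f (stE {a, b} {a, b}) = f (stP a b) + f (stP b a)"
proof -
  have ab: "a \<noteq> b" "(a, b) \<in> pairs" "(b, a) \<in> pairs" using edge_endpoints[OF e] by (auto simp: pairs_def)
  have D: "{a, b} \<in> comps V {{a, b}}" using comps_edge[OF e] by auto
  have "{st \<in> C0. dE V {a, b} st = Some (stE {a, b} {a, b})} = {stP a b, stP b a}"
    unfolding ES_0 using stP_hits[OF e D] stT_hits[OF e D] ab by (auto simp: doubleton_eq_iff)
  moreover have "stP a b \<noteq> stP b a" using stP_eq_iff[OF ab(2,3)] ab(1) by simp
  ultimately show ?thesis using d_as_sum[OF e D] by simp
qed

lemma d_vertex:
  assumes e: "{a, b} \<in> E" and z: "z \<in> V" "z \<noteq> a" "z \<noteq> b"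
  shows "diff01 f (stE {a, b} {z}) = f (stP a z) + f (stP b z) + f (stT {a, b, z})"
proof -
  have ab: "a \<noteq> b" "a \<in> V" "b \<in> V" using edge_endpoints[OF e] by auto
  have p: "(a, z) \<in> pairs" "(b, z) \<in> pairs" using ab z by (auto simp: pairs_def)
  have T: "{a, b, z} \<in> triples" using ab z by (auto simp: triples_def)
  have D: "{z} \<in> comps V {{a, b}}" using comps_edge[OF e] z by auto
  have ne: "{z} \<noteq> {a, b}" using ab by auto
  have "{st \<in> C0. dE V {a, b} st = Some (stE {a, b} {z})} = {stP a z, stP b z, stT {a, b, z}}"
  proof -
    have "stP x y \<in> {stP a z, stP b z, stT {a, b, z}}"
      if "(x, y) \<in> pairs" "dE V {a, b} (stP x y) = Some (stE {a, b} {z})" for x y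
      using stP_hits[OF e D that(1)] that(2) ne by auto
    moreover have "stT T' \<in> {stP a z, stP b z, stT {a, b, z}}"
      if "T' \<in> triples" "dE V {a, b} (stT T') = Some (stE {a, b} {z})" for T'
      using stT_hits[OF e D that(1)] that(2) by (auto simp: insert_commute)
    moreover have "dE V {a, b} (stP a z) = Some (stE {a, b} {z})" "dE V {a, b} (stP b z) = Some (stE {a, b} {z})"
      "dE V {a, b} (stT {a, b, z}) = Some (stE {a, b} {z})"
      using stP_hits[OF e D p(1)] stP_hits[OF e D p(2)] stT_hits[OF e D T] ne by auto
    moreover have "stP a z \<in> C0" "stP b z \<in> C0" "stT {a, b, z} \<in> C0"
      unfolding ES_0 using p T by force+
    moreover have "(\<exists>x y. (x, y) \<in> pairs \<and> st = stP x y) \<or> (\<exists>T\<in>triples. st = stT T)" if "st \<in> C0" for st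
      using that unfolding ES_0 by auto
    ultimately show ?thesis by (intro equalityI subsetI) (blast, fastforce)
  qed
  moreover have "stP a z \<noteq> stP b z" using stP_eq_iff[OF p] ab(1) by simp
  moreover have "stP a z \<noteq> stT {a, b, z}" "stP b z \<noteq> stT {a, b, z}" using stP_neq_stT p by auto
  ultimately show ?thesis using d_as_sum[OF e D] by simp
qed

text \<open>The cocycle equations modulo \<open>k\<close>, with \<open>k = 0\<close> for genuine
  cocycles. Outside \<open>C1\<close> the differential is 0, which everything divides.\<close>

lemma dvd_d_iff:
  "(\<forall>st. k dvd diff01 f st) \<longleftrightarrow> (\<forall>a b. {a, b} \<in> E \<longrightarrow> k dvd f (stP a b) + f (stP b a)) \<and>
    (\<forall>a b z. {a, b} \<in> E \<longrightarrow> z \<in> V \<longrightarrow> z \<noteq> a \<longrightarrow> z \<noteq> b \<longrightarrow> k dvd f (stP a z) + f (stP b z) + f (stT {a, b, z}))"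
    (is "?L \<longleftrightarrow> ?R")
proof
  assume ?L then show ?R using d_edge d_vertex by metis
next
  assume R: ?R
  show ?L
  proof
    fix st
    show "k dvd diff01 f st"
    proof (cases "st \<in> C1")
      case True
      then obtain e D where st: "st = stE e D" "e \<in> E" "D \<in> comps V {e}" unfolding ES_1 by blast
      obtain a b where ab: "e = {a, b}" using st(2) by (rule edgeE)
      then consider "D = {a, b}" | z where "D = {z}" "z \<in> V" "z \<noteq> a" "z \<noteq> b"
        using st comps_edge[OF st(2)] by auto
      then show ?thesis
      proof cases
        case 1 then show ?thesis using R st ab d_edge[of a b f] by auto
      next
        case 2 then show ?thesis using R st ab d_vertex[of a b _ f] by auto
      qed
    qed (simp add: lin_def)
  qed
qed

end

section \<open>The coboundary of the cell complex\<close>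

context graph_setup
begin

text \<open>Evaluation of a 1-cochain on the edge run from \<open>x\<close> to \<open>y\<close>,
  negative against the chosen orientation.\<close>

definition oval :: "('a set \<Rightarrow> int) \<Rightarrow> 'a \<Rightarrow> 'a \<Rightarrow> int" where
  "oval g x y = (if ori {x, y} = x then g {x, y} else - g {x, y})"

lemma oval_swap: "{x, y} \<in> E \<Longrightarrow> oval g y x = - oval g x y"
  using ori edge_endpoints[of x y] by (auto simp: oval_def insert_commute)

lemma sum_oc: "{x, y} \<in> E \<Longrightarrow> (\<Sum>e\<in>E. g e * oc ori x y e) = oval g x y"
  using finite_E by (simp add: oc_def oval_def if_distrib[of "(*) _"] sum.delta cong: if_cong)

lemma trav3:
  assumes "S \<in> cycles3 E"
  obtains a b c where "trav3 S = (a, b, c)" "distinct [a, b, c]" "S = {{a, b}, {b, c}, {c, a}}"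
    "{a, b} \<in> E" "{b, c} \<in> E" "{c, a} \<in> E"
proof -
  have "\<exists>t. case t of (a, b, c) \<Rightarrow> distinct [a, b, c] \<and> S = {{a, b}, {b, c}, {c, a}}"
    using assms unfolding cycles3_def by auto
  then have "case trav3 S of (a, b, c) \<Rightarrow> distinct [a, b, c] \<and> S = {{a, b}, {b, c}, {c, a}}"
    unfolding trav3_def by (rule someI_ex)
  moreover obtain a b c where "trav3 S = (a, b, c)" by (cases "trav3 S")
  moreover have "S \<subseteq> E" using assms by (simp add: cycles3_def)
  ultimately show thesis using that[of a b c] by simp
qed

lemma trav4:
  assumes "S \<in> cycles4 E"
  obtains a b c d where "trav4 S = (a, b, c, d)" "distinct [a, b, c, d]" "S = {{a, b}, {b, c}, {c, d}, {d, a}}"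
    "{a, b} \<in> E" "{b, c} \<in> E" "{c, d} \<in> E" "{d, a} \<in> E"
proof -
  have "\<exists>t. case t of (a, b, c, d) \<Rightarrow> distinct [a, b, c, d] \<and> S = {{a, b}, {b, c}, {c, d}, {d, a}}"
    using assms unfolding cycles4_def by auto
  then have "case trav4 S of (a, b, c, d) \<Rightarrow> distinct [a, b, c, d] \<and> S = {{a, b}, {b, c}, {c, d}, {d, a}}"
    unfolding trav4_def by (rule someI_ex)
  moreover obtain a b c d where "trav4 S = (a, b, c, d)" by (cases "trav4 S")
  moreover have "S \<subseteq> E" using assms by (simp add: cycles4_def)
  ultimately show thesis using that[of a b c d] by simp
qed

text \<open>This and \<open>tri_sum\<close> are the boundary words evaluated on a function of
  ordered pairs, so that different traversals can be compared by antisymmetry alone.\<close>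

definition sq_sum :: "('a \<Rightarrow> 'a \<Rightarrow> int) \<Rightarrow> 'a \<Rightarrow> 'a \<Rightarrow> 'a \<Rightarrow> 'a \<Rightarrow> int" where
  "sq_sum G a b c d = G a b + G b c + G c d + G d a"

definition tri_sum :: "('a \<Rightarrow> 'a \<Rightarrow> int) \<Rightarrow> 'a \<Rightarrow> 'a \<Rightarrow> 'a \<Rightarrow> int" where
  "tri_sum G a b c = 2 * G c a - G b c - G a b"

abbreviation "\<delta> \<equiv> lin E (cells2 E) (bd ori)"

lemma coboundary_square:
  assumes "S \<in> cycles4 E" "trav4 S = (a, b, c, d)" "{a, b} \<in> E" "{b, c} \<in> E" "{c, d} \<in> E" "{d, a} \<in> E"
  shows "\<delta> g (S, 0) = sq_sum (oval g) a b c d"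
proof -
  have "(S, 0) \<in> cells2 E" using assms(1) by (simp add: cells2_def)
  then have "\<delta> g (S, 0) = (\<Sum>e\<in>E. g e * oc ori a b e + g e * oc ori b c e + g e * oc ori c d e + g e * oc ori d a e)"
    using assms(2) by (simp add: lin_def bd_def algebra_simps)
  then show ?thesis using assms(3-6) by (simp add: sum.distrib sum_oc sq_sum_def)
qed

lemma coboundary_triangle:
  assumes "S \<in> cycles3 E" "trav3 S = (a, b, c)" "{a, b} \<in> E" "{b, c} \<in> E" "{c, a} \<in> E"
  shows "\<delta> g (S, 1) = tri_sum (oval g) a b c" "\<delta> g (S, 2) = tri_sum (oval g) b c a"
proof -
  have "(S, 1) \<in> cells2 E" "(S, 2) \<in> cells2 E" using assms(1) by (auto simp: cells2_def)
  then have "\<delta> g (S, 1) = (\<Sum>e\<in>E. 2 * (g e * oc ori c a e) - g e * oc ori b c e - g e * oc ori a b e)"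
    "\<delta> g (S, 2) = (\<Sum>e\<in>E. 2 * (g e * oc ori a b e) - g e * oc ori c a e - g e * oc ori b c e)"
    using assms(2) by (simp_all add: lin_def bd_def algebra_simps)
  then show "\<delta> g (S, 1) = tri_sum (oval g) a b c" "\<delta> g (S, 2) = tri_sum (oval g) b c a"
    using assms(3-5) by (simp_all add: sum_subtractf sum_distrib_left[symmetric] sum_oc tri_sum_def)
qed

text \<open>Every permutation of three vertices is a symmetry of the triangle, so equality of the
  vertex sets suffices.\<close>

lemma triangle_traversals:
  assumes "distinct [a, b, c]" "distinct [a', b', c']"
    "{{a, b}, {b, c}, {c, a}} = {{a', b'}, {b', c'}, {c', a'}}"
  shows "(a', b', c') \<in> {(a, b, c), (b, c, a), (c, a, b), (c, b, a), (b, a, c), (a, c, b)}"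
proof -
  have "\<Union>{{a, b}, {b, c}, {c, a}} = \<Union>{{a', b'}, {b', c'}, {c', a'}}" using assms(3) by (rule arg_cong)
  then have "{a, b, c} = {a', b', c'}" by auto
  then have "a' \<in> {a, b, c}" "b' \<in> {a, b, c}" "c' \<in> {a, b, c}" by blast+
  then show ?thesis using assms(2) by auto
qed

text \<open>Four vertices carry three different 4-cycles, so here the edges matter: the edges
  \<open>a' b'\<close> and \<open>b' c'\<close> leave eight possible paths of three vertices, and
  \<open>d'\<close> is the vertex that remains.\<close>

lemma square_traversals:
  assumes "distinct [a, b, c, d]" "distinct [a', b', c', d']"
    "{{a, b}, {b, c}, {c, d}, {d, a}} = {{a', b'}, {b', c'}, {c', d'}, {d', a'}}"
  shows "(a', b', c', d') \<in> {(a, b, c, d), (b, c, d, a), (c, d, a, b), (d, a, b, c),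
    (d, c, b, a), (c, b, a, d), (b, a, d, c), (a, d, c, b)}"
proof -
  let ?S = "{{a, b}, {b, c}, {c, d}, {d, a}}"
  have nb: "p = a \<and> q = b \<or> p = a \<and> q = d \<or> p = b \<and> q = a \<or> p = b \<and> q = c \<or>
      p = c \<and> q = b \<or> p = c \<and> q = d \<or> p = d \<and> q = a \<or> p = d \<and> q = c" if "{p, q} \<in> ?S" for p q
    using that by (simp add: doubleton_eq_iff) blast
  have edges: "{a', b'} \<in> ?S" "{b', c'} \<in> ?S" unfolding assms(3) by simp_all
  have "\<Union>?S = \<Union>{{a', b'}, {b', c'}, {c', d'}, {d', a'}}" using assms(3) by (rule arg_cong)
  then have "{a, b, c, d} = {a', b', c', d'}" by auto
  then have d': "d' = a \<or> d' = b \<or> d' = c \<or> d' = d" by blast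
  have ne: "a' \<noteq> c'" "d' \<noteq> a'" "d' \<noteq> b'" "d' \<noteq> c'" using assms(2) by auto
  have "(a', b', c') \<in> {(a, b, c), (b, c, d), (c, d, a), (d, a, b), (d, c, b), (c, b, a), (b, a, d), (a, d, c)}"
    using nb[OF edges(1)] nb[OF edges(2)] ne(1) assms(1) by (elim disjE conjE) simp_all
  then show ?thesis
    using d' ne(2-4) assms(1) by (simp only: insert_iff empty_iff prod.inject simp_thms) (elim disjE conjE, simp_all)
qed

text \<open>Removes the arbitrary choices in \<open>trav3\<close> and \<open>trav4\<close>: another
  traversal changes a square sum at most by a sign, and permutes the three rotations of a triangle
  sum up to sign.\<close>

lemma dvd_coboundary_iff:
  "(\<forall>y. k dvd \<delta> g y) \<longleftrightarrow>
    (\<forall>a b c d. distinct [a, b, c, d] \<longrightarrow> {a, b} \<in> E \<longrightarrow> {b, c} \<in> E \<longrightarrow> {c, d} \<in> E \<longrightarrow> {d, a} \<in> E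
      \<longrightarrow> k dvd sq_sum (oval g) a b c d) \<and>
    (\<forall>a b c. distinct [a, b, c] \<longrightarrow> {a, b} \<in> E \<longrightarrow> {b, c} \<in> E \<longrightarrow> {c, a} \<in> E \<longrightarrow> k dvd tri_sum (oval g) a b c)"
    (is "?L \<longleftrightarrow> ?R")
proof
  assume L: ?L
  show ?R
  proof (intro conjI allI impI)
    fix a b c d assume d: "distinct [a, b, c, d]" and e: "{a, b} \<in> E" "{b, c} \<in> E" "{c, d} \<in> E" "{d, a} \<in> E"
    let ?S = "{{a, b}, {b, c}, {c, d}, {d, a}}"
    have S: "?S \<in> cycles4 E" using d e unfolding cycles4_def by blast
    obtain a' b' c' d' where t: "trav4 ?S = (a', b', c', d')" "distinct [a', b', c', d']"
      "?S = {{a', b'}, {b', c'}, {c', d'}, {d', a'}}"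
      "{a', b'} \<in> E" "{b', c'} \<in> E" "{c', d'} \<in> E" "{d', a'} \<in> E"
      using trav4[OF S] .
    have "k dvd sq_sum (oval g) a' b' c' d'" using L coboundary_square[OF S t(1,4-7), of g] by metis
    moreover have "sq_sum (oval g) a' b' c' d' = sq_sum (oval g) a b c d
        \<or> sq_sum (oval g) a' b' c' d' = - sq_sum (oval g) a b c d"
      using square_traversals[OF d t(2,3)] oval_swap[OF e(1), of g] oval_swap[OF e(2), of g]
        oval_swap[OF e(3), of g] oval_swap[OF e(4), of g] by (auto simp: sq_sum_def)
    ultimately show "k dvd sq_sum (oval g) a b c d" by auto
  next
    fix a b c assume d: "distinct [a, b, c]" and e: "{a, b} \<in> E" "{b, c} \<in> E" "{c, a} \<in> E"
    let ?S = "{{a, b}, {b, c}, {c, a}}"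
    have S: "?S \<in> cycles3 E" using d e unfolding cycles3_def by blast
    obtain a' b' c' where t: "trav3 ?S = (a', b', c')" "distinct [a', b', c']"
      "?S = {{a', b'}, {b', c'}, {c', a'}}" "{a', b'} \<in> E" "{b', c'} \<in> E" "{c', a'} \<in> E"
      using trav3[OF S] .
    have 12: "k dvd tri_sum (oval g) a' b' c'" "k dvd tri_sum (oval g) b' c' a'"
      using L coboundary_triangle[OF S t(1,4-6), of g] by metis+
    \<comment> \<open>The three rotations sum to zero, so the two 2-cells of a triangle also control
      the third rotation.\<close>
    moreover have "tri_sum (oval g) c' a' b' = - (tri_sum (oval g) a' b' c' + tri_sum (oval g) b' c' a')"
      by (simp add: tri_sum_def)
    ultimately have 3: "k dvd tri_sum (oval g) c' a' b'" by (metis dvd_add dvd_minus_iff)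
    have "tri_sum (oval g) a b c \<in> (\<lambda>x. x) ` {tri_sum (oval g) a' b' c', tri_sum (oval g) b' c' a', tri_sum (oval g) c' a' b'}
        \<union> uminus ` {tri_sum (oval g) a' b' c', tri_sum (oval g) b' c' a', tri_sum (oval g) c' a' b'}"
      using triangle_traversals[OF t(2) d t(3)[symmetric]] oval_swap[OF t(4), of g] oval_swap[OF t(5), of g]
        oval_swap[OF t(6), of g] by (auto simp: tri_sum_def)
    then show "k dvd tri_sum (oval g) a b c" using 12 3 by auto
  qed
next
  assume R: ?R
  show ?L
  proof
    fix y
    show "k dvd \<delta> g y"
    proof (cases "y \<in> cells2 E")
      case True
      then consider S where "y = (S, 0)" "S \<in> cycles4 E" | S where "y = (S, 1) \<or> y = (S, 2)" "S \<in> cycles3 E"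
        unfolding cells2_def by auto
      then show ?thesis
      proof cases
        case 1
        obtain a b c d where t: "trav4 S = (a, b, c, d)" "distinct [a, b, c, d]" "S = {{a, b}, {b, c}, {c, d}, {d, a}}"
          "{a, b} \<in> E" "{b, c} \<in> E" "{c, d} \<in> E" "{d, a} \<in> E" using trav4[OF 1(2)] .
        show ?thesis unfolding 1(1) coboundary_square[OF 1(2) t(1,4-7)] using R t by blast
      next
        case 2
        obtain a b c where t: "trav3 S = (a, b, c)" "distinct [a, b, c]" "S = {{a, b}, {b, c}, {c, a}}"
          "{a, b} \<in> E" "{b, c} \<in> E" "{c, a} \<in> E" using trav3[OF 2(2)] .
        have "distinct [b, c, a]" using t(2) by auto
        then have "k dvd tri_sum (oval g) a b c" "k dvd tri_sum (oval g) b c a" using R t by blast+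
        then show ?thesis using 2(1) coboundary_triangle[OF 2(2) t(1,4-6), of g] by metis
      qed
    qed (simp add: lin_def)
  qed
qed

end

section \<open>Comparison of the two complexes\<close>

context graph_setup
begin

text \<open>The cochain reads \<open>f\<close> at the state with weight 0 at the start and weight 1
  at the end of the oriented edge.\<close>

definition edge_values :: "('a estate \<Rightarrow> int) \<Rightarrow> 'a set \<Rightarrow> int" where
  "edge_values f e = (if e \<in> E then f (stP (ori e) (the_elem (e - {ori e}))) else 0)"

definition linked :: "'a \<Rightarrow> 'a \<Rightarrow> bool" where
  "linked x y \<longleftrightarrow> (\<exists>z. {x, z} \<in> E \<and> {z, y} \<in> E)"

text \<open>The choice depends only on the set, so it favours the same vertex for both orderings of
  a pair.\<close>

definition chosen_end :: "'a set \<Rightarrow> 'a" where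
  "chosen_end p = (SOME v. v \<in> p)"

text \<open>Of the two orderings of a pair at distance 2, only one is a free coordinate.\<close>
definition free_pairs :: "('a \<times> 'a) set" where
  "free_pairs = {(x, y) \<in> pairs. {x, y} \<notin> E \<and> (linked x y \<longrightarrow> chosen_end {x, y} = x)}"

definition free_triples :: "'a set set" where
  "free_triples = {T \<in> triples. \<not> (\<exists>e\<in>E. e \<subseteq> T)}"

definition free_states :: "'a estate set" where
  "free_states = case_prod stP ` free_pairs \<union> stT ` free_triples"

definition free_values :: "('a estate \<Rightarrow> int) \<Rightarrow> 'a estate \<Rightarrow> int" where
  "free_values f st = (if st \<in> free_states then f st else 0)"

lemma edge_values:
  assumes "{x, y} \<in> E" "ori {x, y} = x" shows "edge_values f {x, y} = f (stP x y)"
proof -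
  have "{x, y} - {x} = {y}" using edge_endpoints[OF assms(1)] by auto
  then show ?thesis using assms by (simp add: edge_values_def)
qed

lemma ori_cases:
  assumes "{x, y} \<in> E" shows "ori {x, y} = x \<or> ori {y, x} = y"
  using ori assms by (auto simp: insert_commute)

lemma linked_swap: "linked x y \<longleftrightarrow> linked y x"
  by (auto simp: linked_def insert_commute)

lemma free_pairs_cases:
  assumes "(x, y) \<in> pairs" "{x, y} \<notin> E" shows "(x, y) \<in> free_pairs \<or> (y, x) \<in> free_pairs"
proof -
  have "chosen_end {x, y} \<in> {x, y}" unfolding chosen_end_def by (rule someI[of _ x]) simp
  then show ?thesis using assms linked_swap[of x y] by (auto simp: free_pairs_def pairs_def insert_commute)
qed

lemma free_pairs_swap:
  assumes "(x, y) \<in> free_pairs" "linked x y" shows "(y, x) \<notin> free_pairs"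
  using assms linked_swap[of x y] by (auto simp: free_pairs_def pairs_def insert_commute)

lemma free_pairs_not_linked:
  "(x, y) \<in> pairs \<Longrightarrow> {x, y} \<notin> E \<Longrightarrow> (x, y) \<notin> free_pairs \<Longrightarrow> linked x y"
  by (auto simp: free_pairs_def)

text \<open>Along the orientation this is an equality; against it, the edge component of the
  differential makes the sign correct modulo \<open>k\<close>.\<close>

lemma dvd_oval_edge_values:
  assumes f: "\<forall>st. k dvd diff01 f st" and e: "{x, y} \<in> E"
  shows "k dvd oval (edge_values f) x y - f (stP x y)"
proof (cases "ori {x, y} = x")
  case True then show ?thesis using edge_values[OF e] by (simp add: oval_def)
next
  case False
  then have o: "ori {y, x} = y" using ori_cases[OF e] by simp
  have e': "{y, x} \<in> E" using e by (simp add: insert_commute)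
  have "oval (edge_values f) x y = - f (stP y x)"
    using False edge_values[OF e' o] by (simp add: oval_def insert_commute)
  moreover have "k dvd f (stP x y) + f (stP y x)" using f e unfolding dvd_d_iff by blast
  then have "k dvd - (f (stP x y) + f (stP y x))" by (simp only: dvd_minus_iff)
  moreover have "- f (stP y x) - f (stP x y) = - (f (stP x y) + f (stP y x))" by simp
  ultimately show ?thesis by metis
qed

text \<open>The triple \<open>{a, b, z}\<close> is eliminated between the components at \<open>(a b, z)\<close> and \<open>(b z, a)\<close>.\<close>
lemma dvd_path:
  assumes f: "\<forall>st. k dvd diff01 f st" and e: "{a, b} \<in> E" "{b, z} \<in> E" and ne: "a \<noteq> z"
  shows "k dvd (f (stP a z) + f (stP b z)) - (f (stP b a) + f (stP z a))"
proof -
  have V: "z \<in> V" "z \<noteq> a" "z \<noteq> b" "a \<in> V" "a \<noteq> b" using edge_endpoints[OF e(1)] edge_endpoints[OF e(2)] ne by auto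
  have "k dvd f (stP a z) + f (stP b z) + f (stT {a, b, z})" using f e(1) V unfolding dvd_d_iff by blast
  moreover have "k dvd f (stP b a) + f (stP z a) + f (stT {b, z, a})"
    using f e(2) V ne unfolding dvd_d_iff by blast
  moreover have "{b, z, a} = {a, b, z}" by auto
  ultimately have "k dvd (f (stP a z) + f (stP b z) + f (stT {a, b, z})) - (f (stP b a) + f (stP z a) + f (stT {a, b, z}))"
    using dvd_diff by metis
  then show ?thesis by (simp add: algebra_simps)
qed

lemma coboundary_edge_values:
  assumes f: "\<forall>st. k dvd diff01 f st" shows "\<forall>y. k dvd \<delta> (edge_values f) y"
  unfolding dvd_coboundary_iff
proof (intro conjI allI impI)
  let ?G = "oval (edge_values f)" and ?F = "\<lambda>x y. f (stP x y)"
  have G: "k dvd ?G x y - ?F x y" if "{x, y} \<in> E" for x y using dvd_oval_edge_values[OF f that] .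
  have swap: "k dvd ?F x y + ?F y x" if "{x, y} \<in> E" for x y using f that unfolding dvd_d_iff by blast
  {
    fix a b c d assume d: "distinct [a, b, c, d]" and e: "{a, b} \<in> E" "{b, c} \<in> E" "{c, d} \<in> E" "{d, a} \<in> E"
    have e': "{a, d} \<in> E" "{d, c} \<in> E" using e by (simp_all add: insert_commute)
    have "k dvd (?F a c + ?F b c) - (?F b a + ?F c a)" using dvd_path[OF f e(1,2)] d by simp
    moreover have "k dvd (?F a c + ?F d c) - (?F d a + ?F c a)" using dvd_path[OF f e'] d by simp
    ultimately obtain u u' w w' g1 g2 g3 g4 where
      "(?F a c + ?F b c) - (?F b a + ?F c a) = k * u" "(?F a c + ?F d c) - (?F d a + ?F c a) = k * u'"
      "?F a b + ?F b a = k * w" "?F c d + ?F d c = k * w'"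
      "?G a b - ?F a b = k * g1" "?G b c - ?F b c = k * g2" "?G c d - ?F c d = k * g3" "?G d a - ?F d a = k * g4"
      using G[OF e(1)] G[OF e(2)] G[OF e(3)] G[OF e(4)] swap[OF e(1)] swap[OF e(3)] by (elim dvdE) blast
    \<comment> \<open>\<open>u - u'\<close> cancels both values on the diagonal from
      \<open>a\<close> to \<open>c\<close>, \<open>w\<close> and \<open>w'\<close> reverse
      \<open>b a\<close> and \<open>d c\<close>, and the remaining terms replace \<open>?F\<close>
      by \<open>?G\<close>.\<close>
    then have "sq_sum ?G a b c d = k * (u - u' + w + w' + g1 + g2 + g3 + g4)"
      unfolding sq_sum_def ring_distribs by linarith
    then show "k dvd sq_sum ?G a b c d" by simp
  }
  fix a b c assume d: "distinct [a, b, c]" and e: "{a, b} \<in> E" "{b, c} \<in> E" "{c, a} \<in> E"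
  have "k dvd (?F a c + ?F b c) - (?F b a + ?F c a)" using dvd_path[OF f e(1,2)] d by simp
  then obtain u w w' g1 g2 g3 where "(?F a c + ?F b c) - (?F b a + ?F c a) = k * u"
    "?F a b + ?F b a = k * w" "?F c a + ?F a c = k * w'"
    "?G a b - ?F a b = k * g1" "?G b c - ?F b c = k * g2" "?G c a - ?F c a = k * g3"
    using G[OF e(1)] G[OF e(2)] G[OF e(3)] swap[OF e(1)] swap[OF e(3)] by (elim dvdE) blast
  \<comment> \<open>The part \<open>?F c a - ?F a c\<close> of the negated path relation becomes
    \<open>2 * ?F c a\<close> by adding \<open>w'\<close>.\<close>
  then have "tri_sum ?G a b c = k * (w' - u - w + 2 * g3 - g2 - g1)"
    unfolding tri_sum_def ring_distribs by linarith
  then show "k dvd tri_sum ?G a b c" by simp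
qed

text \<open>The values on edges, on eliminated orderings and on triples with an edge are treated in
  this order, each tied by one relation modulo \<open>k\<close> to values already known to be
  divisible.\<close>

lemma divisible_if_values_vanish:
  assumes f: "f \<in> carrier (ZF C0)" "edge_values f = (\<lambda>_. 0)" "free_values f = (\<lambda>_. 0)"
    and k: "\<forall>st. k dvd diff01 f st"
  shows "\<forall>st. k dvd f st"
proof -
  have free: "f st = 0" if "st \<in> free_states" for st
    using fun_cong[OF f(3), of st] that by (simp add: free_values_def)
  have edge: "k dvd f (stP x y)" if e: "{x, y} \<in> E" for x y
  proof -
    have "k dvd oval (edge_values f) x y - f (stP x y)" by (rule dvd_oval_edge_values[OF k e])
    moreover have "oval (edge_values f) x y = 0" unfolding f(2) by (simp add: oval_def)
    ultimately show ?thesis by simp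
  qed
  have pair: "k dvd f (stP x y)" if p: "(x, y) \<in> pairs" for x y
  proof (cases "{x, y} \<in> E \<or> (x, y) \<in> free_pairs")
    case True
    then show ?thesis
    proof
      assume "(x, y) \<in> free_pairs"
      then have "stP x y \<in> free_states" by (force simp: free_states_def)
      then show ?thesis using free by simp
    qed (rule edge)
  next
    case False
    then obtain n where n: "{x, n} \<in> E" "{n, y} \<in> E"
      using free_pairs_not_linked[OF p] by (auto simp: linked_def)
    have n': "{n, x} \<in> E" using n by (simp add: insert_commute)
    have "(y, x) \<in> free_pairs" using free_pairs_cases[OF p] False by blast
    then have "stP y x \<in> free_states" by (force simp: free_states_def)
    then have "f (stP y x) = 0" by (rule free)
    moreover have "k dvd (f (stP x y) + f (stP n y)) - (f (stP n x) + f (stP y x))"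
      using p by (intro dvd_path[OF k n]) (auto simp: pairs_def)
    ultimately obtain u w w' where "f (stP x y) + f (stP n y) - f (stP n x) = k * u"
      "f (stP n y) = k * w" "f (stP n x) = k * w'"
      using edge[OF n(2)] edge[OF n'] by (elim dvdE) auto
    then have "f (stP x y) = k * (u - w + w')" unfolding ring_distribs by linarith
    then show ?thesis by simp
  qed
  have triple: "k dvd f (stT T)" if T: "T \<in> triples" for T
  proof (cases "T \<in> free_triples")
    case True
    then have "stT T \<in> free_states" by (simp add: free_states_def)
    then show ?thesis using free by simp
  next
    case False
    then obtain e where e: "e \<in> E" "e \<subseteq> T" using T by (auto simp: free_triples_def)
    obtain a b where ab: "a \<noteq> b" "a \<in> V" "b \<in> V" "e = {a, b}" using e(1) by (rule edgeE)
    have "card (T - e) = 1" using T e ab card_edge[OF e(1)] by (subst card_Diff_subset) (auto simp: triples_def)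
    then obtain z where z: "T - e = {z}" by (auto simp: card_1_singleton_iff)
    then have z': "z \<in> V" "z \<noteq> a" "z \<noteq> b" "T = {a, b, z}" using T e ab by (auto simp: triples_def)
    have "k dvd f (stP a z) + f (stP b z) + f (stT {a, b, z})"
      using k e(1) ab(4) z' unfolding dvd_d_iff by blast
    moreover have "k dvd f (stP a z)" "k dvd f (stP b z)" using pair ab z' by (auto simp: pairs_def)
    ultimately have "k dvd f (stP a z) + f (stP b z) + f (stT {a, b, z}) - f (stP a z) - f (stP b z)"
      by (intro dvd_diff)
    then show ?thesis using z'(4) by simp
  qed
  show ?thesis
  proof
    fix st
    show "k dvd f st"
    proof (cases "st \<in> C0")
      case True then show ?thesis unfolding ES_0 using pair triple by auto
    next
      case False then show ?thesis using ZF_outside[OF f(1)] by simp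
    qed
  qed
qed

text \<open>The states \<open>stP\<close> and \<open>stT\<close> are pairwise distinct, so values on
  pairs and on triples can be prescribed independently.\<close>

lemma state_function:
  obtains f where "f \<in> carrier (ZF C0)" "\<And>x y. (x, y) \<in> pairs \<Longrightarrow> f (stP x y) = F x y"
    "\<And>T. T \<in> triples \<Longrightarrow> f (stT T) = H T"
proof -
  define f where "f st = (if st \<in> case_prod stP ` pairs then case_prod F (inv_into pairs (case_prod stP) st)
    else if st \<in> stT ` triples then H (inv_into triples stT st) else 0)" for st
  have inj: "inj_on (case_prod stP) pairs" "inj_on stT triples"
    using stP_eq_iff stT_eq_iff by (auto simp: inj_on_def triples_def)
  show thesis
  proof (rule that)
    show "f \<in> carrier (ZF C0)" by (simp add: f_def ES_0)
    show "f (stP x y) = F x y" if "(x, y) \<in> pairs" for x y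
    proof -
      have "stP x y = case_prod stP (x, y)" by simp
      then show ?thesis using inv_into_f_f[OF inj(1) that] that unfolding f_def by (metis case_prod_conv imageI)
    qed
    show "f (stT T) = H T" if "T \<in> triples" for T
    proof -
      have "stT T \<notin> case_prod stP ` pairs"
      proof
        assume "stT T \<in> case_prod stP ` pairs"
        then obtain x y where "(x, y) \<in> pairs" "stT T = stP x y" by (elim imageE) (auto split: prod.splits)
        then show False using stP_neq_stT[of x y T] by simp
      qed
      then show ?thesis using inv_into_f_f[OF inj(2) that] that by (simp add: f_def)
    qed
  qed
qed

text \<open>Each eliminated value is defined by solving one relation, at some common neighbour or
  some edge of the triple. The other relations then say that this choice does not matter modulo
  \<open>k\<close>, and here the square and triangle conditions enter.\<close>

lemma lift_values:
  assumes g: "g \<in> carrier (ZF E)" and h: "h \<in> carrier (ZF free_states)" and k: "\<forall>y. k dvd \<delta> g y"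
  shows "\<exists>f\<in>carrier (ZF C0). edge_values f = g \<and> free_values f = h \<and> (\<forall>st. k dvd diff01 f st)"
proof -
  let ?G = "oval g"
  define n where "n x y = (SOME z. {x, z} \<in> E \<and> {z, y} \<in> E)" for x y
  \<comment> \<open>The last case solves \<open>F x y + F (n x y) y = F (n x y) x + F y x\<close>
    for \<open>F x y\<close>, where \<open>(y, x)\<close> is the free ordering.\<close>
  define F where "F x y = (if {x, y} \<in> E then ?G x y else if (x, y) \<in> free_pairs then h (stP x y)
    else h (stP y x) + ?G (n x y) x + ?G y (n x y))" for x y
  define abz where "abz T = (SOME t. case t of (a, b, z) \<Rightarrow> T = {a, b, z} \<and> {a, b} \<in> E \<and> z \<noteq> a \<and> z \<noteq> b)" for T
  define H where "H T = (if T \<in> free_triples then h (stT T) else case abz T of (a, b, z) \<Rightarrow> - F a z - F b z)" for T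
  have FE: "F x y = ?G x y" if "{x, y} \<in> E" for x y using that by (simp add: F_def)
  have anti: "?G y x = - ?G x y" if "{x, y} \<in> E" for x y using oval_swap[OF that] .
  \<comment> \<open>The relation through an arbitrary common neighbour \<open>b\<close>. It holds
    for \<open>n a z\<close> by definition, and the square \<open>a, b, z, n a z\<close> transfers
    it to \<open>b\<close>.\<close>
  have path: "k dvd (F a z - F z a) - (?G b a + ?G z b)"
    if e: "{a, b} \<in> E" "{b, z} \<in> E" "{a, z} \<notin> E" "a \<noteq> z" and nf: "(a, z) \<notin> free_pairs" for a b z
  proof -
    have p: "(a, z) \<in> pairs" using edge_endpoints[OF e(1)] edge_endpoints[OF e(2)] e(4) by (auto simp: pairs_def)
    have fr: "(z, a) \<in> free_pairs" using free_pairs_cases[OF p e(3)] nf by blast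
    have za: "{z, a} \<notin> E" using e(3) by (simp add: insert_commute)
    have "{a, n a z} \<in> E \<and> {n a z, z} \<in> E"
      unfolding n_def using e(1,2) by (rule someI[of "\<lambda>u. {a, u} \<in> E \<and> {u, z} \<in> E" b, OF conjI])
    then have m: "{a, n a z} \<in> E" "{n a z, z} \<in> E" "{z, n a z} \<in> E" "{n a z, a} \<in> E" by (auto simp: insert_commute)
    have eq: "(F a z - F z a) - (?G b a + ?G z b) = ?G (n a z) a + ?G z (n a z) - ?G b a - ?G z b"
      using e(3) za nf fr by (simp add: F_def)
    show ?thesis
    proof (cases "n a z = b")
      case True then show ?thesis unfolding eq by simp
    next
      case False
      have "distinct [a, b, z, n a z]"
        using False e(4) edge_endpoints[OF e(1)] edge_endpoints[OF e(2)] edge_endpoints[OF m(1)]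
          edge_endpoints[OF m(2)] by auto
      then have "k dvd sq_sum ?G a b z (n a z)"
        using k e(1,2) m(3,4) unfolding dvd_coboundary_iff by blast
      moreover have "sq_sum ?G a b z (n a z) = ?G (n a z) a + ?G z (n a z) - ?G b a - ?G z b"
        using anti[OF e(1)] anti[OF e(2)] by (simp add: sq_sum_def)
      ultimately show ?thesis unfolding eq by simp
    qed
  qed
  \<comment> \<open>The edges \<open>a b\<close> and \<open>b z\<close> prescribe two values for the
    triple \<open>{a, b, z}\<close>; they agree modulo \<open>k\<close>.\<close>
  have key: "k dvd (F a z + F b z) - (F b a + F z a)" if e: "{a, b} \<in> E" "{b, z} \<in> E" "a \<noteq> z" for a b z
  proof -
    have e': "{b, a} \<in> E" "{z, b} \<in> E" using e by (simp_all add: insert_commute)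
    consider "{a, z} \<in> E" | "{a, z} \<notin> E" "(a, z) \<notin> free_pairs" | "{a, z} \<notin> E" "(a, z) \<in> free_pairs" by blast
    then show ?thesis
    proof cases
      case 1
      then have za: "{z, a} \<in> E" by (simp add: insert_commute)
      have "distinct [a, b, z]" using e edge_endpoints[OF e(1)] edge_endpoints[OF e(2)] by auto
      then have "k dvd tri_sum ?G a b z" using k e(1,2) za unfolding dvd_coboundary_iff by blast
      moreover have "(F a z + F b z) - (F b a + F z a) = - tri_sum ?G a b z"
        using FE[OF 1] FE[OF e(2)] FE[OF e'(1)] FE[OF za] anti[OF 1] anti[OF e(1)] by (simp add: tri_sum_def)
      ultimately show ?thesis by simp
    next
      case 2
      have "(F a z + F b z) - (F b a + F z a) = (F a z - F z a) - (?G b a + ?G z b)"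
        using FE[OF e(2)] FE[OF e'(1)] anti[OF e(2)] by simp
      then show ?thesis using path[OF e(1,2) 2(1) e(3) 2(2)] by metis
    next
      case 3
      \<comment> \<open>If \<open>(a, z)\<close> is the free ordering, then \<open>(z, a)\<close> is
        the eliminated one, and the path is read backwards.\<close>
      have "linked a z" using e by (auto simp: linked_def)
      then have "(z, a) \<notin> free_pairs" using free_pairs_swap[OF 3(2)] by blast
      moreover have "{z, a} \<notin> E" using 3(1) by (simp add: insert_commute)
      ultimately have "k dvd (F z a - F a z) - (?G b z + ?G a b)" using path[OF e'(2,1)] e(3) by blast
      then have "k dvd - ((F z a - F a z) - (?G b z + ?G a b))" by (simp only: dvd_minus_iff)
      moreover have "(F a z + F b z) - (F b a + F z a) = - ((F z a - F a z) - (?G b z + ?G a b))"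
        using FE[OF e(2)] FE[OF e'(1)] anti[OF e(1)] by simp
      ultimately show ?thesis by metis
    qed
  qed
  obtain f where f: "f \<in> carrier (ZF C0)" "\<And>x y. (x, y) \<in> pairs \<Longrightarrow> f (stP x y) = F x y"
    "\<And>T. T \<in> triples \<Longrightarrow> f (stT T) = H T"
    by (rule state_function[of F H]) (rule that)
  have ev: "edge_values f = g"
  proof
    fix e
    show "edge_values f e = g e"
    proof (cases "e \<in> E")
      case True
      obtain a b where ab: "a \<noteq> b" "a \<in> V" "b \<in> V" "e = {a, b}" using True by (rule edgeE)
      have E': "{x, y} = e \<Longrightarrow> ori {x, y} = x \<Longrightarrow> x \<noteq> y \<Longrightarrow> x \<in> V \<Longrightarrow> y \<in> V \<Longrightarrow> edge_values f e = g e" for x y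
        using edge_values[of x y f] True f(2)[of x y] FE[of x y] by (auto simp: pairs_def oval_def)
      show ?thesis
        using ori_cases[of a b] True E'[of a b] E'[of b a] ab by (auto simp: insert_commute)
    next
      case False then show ?thesis using g by (simp add: edge_values_def)
    qed
  qed
  have fv: "free_values f = h"
  proof
    fix st
    show "free_values f st = h st"
    proof (cases "st \<in> free_states")
      case True
      then consider x y where "(x, y) \<in> free_pairs" "st = stP x y" | T where "T \<in> free_triples" "st = stT T"
        by (auto simp: free_states_def)
      then show ?thesis
      proof cases
        case 1
        then show ?thesis using True f(2)[of x y] by (auto simp: free_values_def free_pairs_def F_def)
      next
        case 2
        then show ?thesis using True f(3)[of T] by (auto simp: free_values_def free_triples_def H_def)
      qed
    next
      case False then show ?thesis using ZF_outside[OF h] by (simp add: free_values_def)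
    qed
  qed
  have "\<forall>st. k dvd diff01 f st"
    unfolding dvd_d_iff
  proof (intro conjI allI impI)
    fix a b assume e: "{a, b} \<in> E"
    then have "{b, a} \<in> E" by (simp add: insert_commute)
    moreover have "(a, b) \<in> pairs" "(b, a) \<in> pairs" using edge_endpoints[OF e] by (auto simp: pairs_def)
    ultimately show "k dvd f (stP a b) + f (stP b a)" using f(2) FE e anti[OF e] by simp
  next
    fix a b z assume e: "{a, b} \<in> E" and z: "z \<in> V" "z \<noteq> a" "z \<noteq> b"
    have ab: "a \<noteq> b" "a \<in> V" "b \<in> V" using edge_endpoints[OF e] by auto
    let ?T = "{a, b, z}"
    have T: "?T \<in> triples" using ab z by (auto simp: triples_def)
    have pairs: "(a, z) \<in> pairs" "(b, z) \<in> pairs" using ab z by (auto simp: pairs_def)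
    have "?T \<notin> free_triples" using e by (auto simp: free_triples_def intro!: bexI[of _ "{a, b}"])
    moreover obtain a' b' z' where t: "abz ?T = (a', b', z')" by (cases "abz ?T")
    ultimately have H: "H ?T = - F a' z' - F b' z'" by (simp add: H_def)
    have "case abz ?T of (u, v, w) \<Rightarrow> ?T = {u, v, w} \<and> {u, v} \<in> E \<and> w \<noteq> u \<and> w \<noteq> v"
      unfolding abz_def by (rule someI[of _ "(a, b, z)"]) (use e z in simp)
    then have t': "{a, b, z} = {a', b', z'}" "{a', b'} \<in> E" "z' \<noteq> a'" "z' \<noteq> b'" by (simp_all add: t)
    have ba: "{b, a} \<in> E" using e by (simp add: insert_commute)
    have "a' \<noteq> b'" using edge_endpoints[OF t'(2)] by blast
    have rest: "{a', b'} = {a, b, z} - {z'}" unfolding t'(1) using t'(3,4) by auto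
    \<comment> \<open>\<open>abz\<close> may have picked another edge of the triple; the vertex
      \<open>z'\<close> opposite to it tells which one.\<close>
    have "z' = z \<or> z' = a \<or> z' = b" using t'(1) by blast
    then have "k dvd F a z + F b z - (F a' z' + F b' z')"
    proof (elim disjE)
      assume "z' = z"
      then have "{a', b'} = {a, b}" unfolding rest using ab z by auto
      then have "F a' z' + F b' z' = F a z + F b z" using \<open>z' = z\<close> by (auto simp: doubleton_eq_iff)
      then show ?thesis by simp
    next
      assume "z' = a"
      then have ab': "{a', b'} = {b, z}" unfolding rest using ab z by auto
      then have "F a' z' + F b' z' = F b a + F z a" using \<open>z' = a\<close> by (auto simp: doubleton_eq_iff)
      moreover have "{b, z} \<in> E" using ab' t'(2) by simp
      ultimately show ?thesis using key[OF e] z by simp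
    next
      assume "z' = b"
      then have ab': "{a', b'} = {a, z}" unfolding rest using ab z by auto
      then have "F a' z' + F b' z' = F a b + F z b" using \<open>z' = b\<close> by (auto simp: doubleton_eq_iff)
      moreover have "{a, z} \<in> E" using ab' t'(2) by simp
      ultimately show ?thesis using key[OF ba, of z] z by (simp add: add.commute)
    qed
    moreover have "f (stP a z) + f (stP b z) + f (stT ?T) = F a z + F b z - (F a' z' + F b' z')"
      unfolding f(2)[OF pairs(1)] f(2)[OF pairs(2)] f(3)[OF T] H by simp
    ultimately show "k dvd f (stP a z) + f (stP b z) + f (stT ?T)" by metis
  qed
  with f(1) ev fv show ?thesis by blast
qed

end

section \<open>Counting\<close>

lemma card_symmetric_pairs:
  assumes "finite S" "S = R \<union> R\<inverse>" "R \<inter> R\<inverse> = {}" shows "card S = 2 * card R"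
  using assms card_Un_disjoint[of R "R\<inverse>"] by simp

context graph_setup
begin

lemma additive_edge_values: "additive_on K edge_values"
  by (auto simp: additive_on_def edge_values_def)

lemma additive_free_values: "additive_on K free_values"
  by (auto simp: additive_on_def free_values_def)

lemma finite_cells2: "finite (cells2 E)"
proof -
  have "cells2 E \<subseteq> Pow E \<times> {0, 1, 2}" by (auto simp: cells2_def cycles3_def cycles4_def)
  then show ?thesis using finite_E by (meson finite.emptyI finite.insertI finite_Pow_iff finite_SigmaI finite_subset)
qed

lemma finite_free_pairs: "finite free_pairs"
  using finite_pairs by (rule finite_subset[rotated]) (auto simp: free_pairs_def)

lemma finite_free_triples: "finite free_triples"
  using finite_triples by (rule finite_subset[rotated]) (auto simp: free_triples_def)

lemma finite_free_states: "finite free_states"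
  by (simp add: free_states_def finite_free_pairs finite_free_triples)

lemma card_states:
  assumes "P \<subseteq> pairs" "T \<subseteq> triples"
  shows "card (case_prod stP ` P \<union> stT ` T) = card P + card T"
proof -
  have "inj_on (case_prod stP) P" "inj_on stT T"
  proof -
    show "inj_on (case_prod stP) P"
    proof (rule inj_onI)
      fix p q assume "p \<in> P" "q \<in> P" "case_prod stP p = case_prod stP q"
      then show "p = q" using stP_eq_iff[of "fst p" "snd p" "fst q" "snd q"] assms(1) by (auto simp: split_beta prod_eq_iff)
    qed
    show "inj_on stT T"
    proof (rule inj_onI)
      fix S U assume "S \<in> T" "U \<in> T" "stT S = stT U"
      then show "S = U" using stT_eq_iff[of S U] assms(2) by (auto simp: triples_def)
    qed
  qed
  moreover have "case_prod stP ` P \<inter> stT ` T = {}"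
  proof -
    have "case_prod stP p \<noteq> stT S" if "p \<in> P" for p S
      using stP_neq_stT[of "fst p" "snd p" S] that assms(1) by (auto simp: split_beta)
    then show ?thesis by blast
  qed
  moreover have "finite P" "finite T" using assms finite_pairs finite_triples finite_subset by blast+
  ultimately show ?thesis by (simp add: card_Un_disjoint card_image)
qed

lemma card_C0: "card C0 = card pairs + card triples"
  unfolding ES_0 by (rule card_states) simp_all

lemma card_free_states: "card free_states = card free_pairs + card free_triples"
  unfolding free_states_def by (rule card_states) (auto simp: free_pairs_def free_triples_def)

definition edges_in :: "'a set \<Rightarrow> nat" where
  "edges_in T = card {e \<in> E. e \<subseteq> T}"

lemma card_free_triples: "card free_triples = t0 V E"
proof -
  have "card {e \<in> E. e \<subseteq> T} = 0 \<longleftrightarrow> \<not> (\<exists>e\<in>E. e \<subseteq> T)" for T using finite_E by auto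
  then have "free_triples = {T. T \<subseteq> V \<and> card T = 3 \<and> card {e \<in> E. e \<subseteq> T} = 0}"
    unfolding free_triples_def triples_def by auto
  then show ?thesis by (simp add: t0_def)
qed

lemma pairs_at_distance:
  "d2 V E = card {(x, y) \<in> pairs. {x, y} \<notin> E \<and> linked x y}"
  "d3 V E = card {(x, y) \<in> pairs. {x, y} \<notin> E \<and> \<not> linked x y}"
  unfolding d2_def d3_def adj_def linked_def pairs_def by (auto intro: arg_cong[of _ _ card])

text \<open>Exactly one ordering of each pair at distance 2 is free. In particular
  \<open>d2 V E\<close> is even, so \<open>div 2\<close> loses nothing.\<close>

lemma card_linked_free_pairs: "d2 V E = 2 * card {(x, y) \<in> free_pairs. linked x y}"
  unfolding pairs_at_distance
proof (rule card_symmetric_pairs)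
  let ?S = "{(x, y) \<in> pairs. {x, y} \<notin> E \<and> linked x y}" and ?R = "{(x, y) \<in> free_pairs. linked x y}"
  show "finite ?S" using finite_pairs by (rule finite_subset[rotated]) auto
  show "?R \<inter> ?R\<inverse> = {}" using free_pairs_swap by auto
  have sub: "?R \<subseteq> ?S" by (auto simp: free_pairs_def)
  have sym: "(x, y) \<in> ?S \<longleftrightarrow> (y, x) \<in> ?S" for x y
    using linked_swap[of x y] by (auto simp: pairs_def insert_commute)
  show "?S = ?R \<union> ?R\<inverse>"
  proof
    show "?R \<union> ?R\<inverse> \<subseteq> ?S" using sub sym by fast
    show "?S \<subseteq> ?R \<union> ?R\<inverse>" using free_pairs_cases linked_swap by auto
  qed
qed

lemma card_free_pairs: "card free_pairs = d2 V E div 2 + d3 V E"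
proof -
  have "free_pairs = {(x, y) \<in> free_pairs. linked x y} \<union> {(x, y) \<in> pairs. {x, y} \<notin> E \<and> \<not> linked x y}"
    by (auto simp: free_pairs_def)
  moreover have "card ({(x, y) \<in> free_pairs. linked x y} \<union> {(x, y) \<in> pairs. {x, y} \<notin> E \<and> \<not> linked x y})
      = card {(x, y) \<in> free_pairs. linked x y} + card {(x, y) \<in> pairs. {x, y} \<notin> E \<and> \<not> linked x y}"
    by (rule card_Un_disjoint)
      (auto intro: finite_subset[OF _ finite_free_pairs] finite_subset[OF _ finite_pairs])
  ultimately show ?thesis using card_linked_free_pairs pairs_at_distance(2) by simp
qed

lemma card_pairs: "card pairs = 2 * card E + d2 V E + d3 V E"
proof -
  let ?A = "{(x, y) \<in> pairs. {x, y} \<in> E}"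
  let ?B = "{(x, y) \<in> pairs. {x, y} \<notin> E \<and> linked x y}"
  let ?C = "{(x, y) \<in> pairs. {x, y} \<notin> E \<and> \<not> linked x y}"
  let ?O = "{(x, y). {x, y} \<in> E \<and> ori {x, y} = x}"
  have fin: "finite ?A" "finite ?B" "finite ?C" using finite_pairs by (auto intro: finite_subset)
  have "pairs = ?A \<union> (?B \<union> ?C)" by auto
  moreover have "card (?A \<union> (?B \<union> ?C)) = card ?A + card (?B \<union> ?C)" "card (?B \<union> ?C) = card ?B + card ?C"
    using fin by (intro card_Un_disjoint; auto)+
  \<comment> \<open>The orientation selects one of the two orderings of the ends of each
    edge.\<close>
  moreover have "card ?A = 2 * card ?O"
  proof (rule card_symmetric_pairs[OF fin(1)])
    have sw: "{y, x} = {x, y}" for x y :: 'a by auto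
    have "(x, y) \<in> ?A \<longleftrightarrow> (x, y) \<in> ?O \<or> (y, x) \<in> ?O" for x y
      using ori_cases[of x y] edge_endpoints[of x y] sw[of x y] by (auto simp: pairs_def)
    then show "?A = ?O \<union> ?O\<inverse>" by (intro equalityI subrelI) blast+
    have False if xy: "{x, y} \<in> E" "ori {x, y} = x" "ori {y, x} = y" for x y
    proof -
      have "ori {x, y} = y" using xy(3) unfolding sw[of x y] .
      then show False using xy edge_endpoints[OF xy(1)] by simp
    qed
    then show "?O \<inter> ?O\<inverse> = {}" by blast
  qed
  moreover have "bij_betw (\<lambda>(x, y). {x, y}) ?O E"
    unfolding bij_betw_def
  proof
    have inj: "x = x' \<and> y = y'" if "ori {x, y} = x" "ori {x', y'} = x'" "{x, y} = {x', y'}" for x y x' y'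
      using that(1,2) unfolding that(3) using that(3) by (auto simp: doubleton_eq_iff)
    show "inj_on (\<lambda>(x, y). {x, y}) ?O"
    proof (rule inj_onI)
      fix p q assume "p \<in> ?O" "q \<in> ?O" "(\<lambda>(x, y). {x, y}) p = (\<lambda>(x, y). {x, y}) q"
      then show "p = q"
        using inj[of "fst p" "snd p" "fst q" "snd q"] unfolding split_beta prod_eq_iff mem_Collect_eq by blast
    qed
    have "e \<in> (\<lambda>(x, y). {x, y}) ` ?O" if e: "e \<in> E" for e
    proof -
      obtain a b where "e = {a, b}" using e by (rule edgeE)
      then have ba: "e = {b, a}" by auto
      have "ori e = a \<or> ori e = b" using ori e \<open>e = {a, b}\<close> by auto
      then show ?thesis
      proof
        assume "ori e = a"
        then show ?thesis using e \<open>e = {a, b}\<close> by (intro image_eqI[of _ _ "(a, b)"]) auto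
      next
        assume "ori e = b"
        then have "(b, a) \<in> ?O" using e unfolding ba by simp
        then show ?thesis using ba by (intro image_eqI[of _ _ "(b, a)"]) auto
      qed
    qed
    then show "(\<lambda>(x, y). {x, y}) ` ?O = E" by auto
  qed
  then have "card ?O = card E" by (rule bij_betw_same_card)
  ultimately show ?thesis unfolding pairs_at_distance by simp
qed

text \<open>A state with edge \<open>e\<close> has its weight 1 on \<open>e\<close> or on a further
  vertex, which completes \<open>e\<close> to a triple. Exchanging the order of counting turns
  triples around an edge into edges inside a triple.\<close>

lemma card_C1: "card C1 = card E + sum edges_in triples"
proof -
  have "C1 = case_prod stE ` (SIGMA e:E. comps V {e})" unfolding ES_1 by auto
  moreover have "inj_on (case_prod stE) (SIGMA e:E. comps V {e})"
    unfolding inj_on_def using stE_eq_iff by auto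
  moreover have fin: "finite (comps V {e})" for e using finite_V by (simp add: comps_def)
  ultimately have "card C1 = (\<Sum>e\<in>E. card (comps V {e}))" using finite_E by (simp add: card_image)
  also have "\<dots> = (\<Sum>e\<in>E. 1 + card {T \<in> triples. e \<subseteq> T})"
  proof (rule sum.cong[OF refl])
    fix e assume e: "e \<in> E"
    have e2: "card e = 2" "finite e" "e \<subseteq> V"
      using card_edge[OF e] edge_subset[OF e] finite_subset[OF edge_subset[OF e] finite_V] by auto
    have "{T \<in> triples. e \<subseteq> T} = (\<lambda>z. insert z e) ` (V - e)"
    proof (intro equalityI subsetI)
      fix T assume "T \<in> {T \<in> triples. e \<subseteq> T}"
      then have T: "T \<subseteq> V" "card T = 3" "e \<subseteq> T" by (auto simp: triples_def)
      then have "card (T - e) = 1" using e2 by (simp add: card_Diff_subset)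
      then obtain z where "T - e = {z}" by (auto simp: card_1_singleton_iff)
      then have "T = insert z e" "z \<in> V - e" using T by auto
      then show "T \<in> (\<lambda>z. insert z e) ` (V - e)" by blast
    qed (use e2 in \<open>auto simp: triples_def\<close>)
    moreover have "inj_on (\<lambda>z. insert z e) (V - e)" by (auto simp: inj_on_def)
    moreover have "comps V {e} = insert e ((\<lambda>z. {z}) ` (V - e))" by (rule comps_edge[OF e])
    moreover have "e \<notin> (\<lambda>z. {z}) ` (V - e)" by auto
    moreover have "inj_on (\<lambda>z. {z}) (V - e)" by auto
    ultimately show "card (comps V {e}) = 1 + card {T \<in> triples. e \<subseteq> T}"
      using finite_V by (simp add: card_image)
  qed
  also have "\<dots> = card E + (\<Sum>e\<in>E. card {T \<in> triples. e \<subseteq> T})" by (simp add: sum_Suc)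
  also have "(\<Sum>e\<in>E. card {T \<in> triples. e \<subseteq> T}) = sum edges_in triples"
    by (rule sum_multicount_gen) (auto simp: finite_E finite_triples edges_in_def)
  finally show ?thesis .
qed

lemma edges_in_triple:
  assumes "distinct [a, b, c]"
  shows "{e \<in> E. e \<subseteq> {a, b, c}} \<subseteq> {{a, b}, {b, c}, {c, a}}"
proof
  fix e assume e: "e \<in> {e \<in> E. e \<subseteq> {a, b, c}}"
  then have "e \<in> E" by simp
  then obtain x y where xy: "x \<noteq> y" "x \<in> V" "y \<in> V" "e = {x, y}" by (rule edgeE)
  then have "x = a \<or> x = b \<or> x = c" "y = a \<or> y = b \<or> y = c" using e by auto
  then show "e \<in> {{a, b}, {b, c}, {c, a}}"
    unfolding xy(4) using xy(1) by (elim disjE) (simp_all add: insert_commute)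
qed

lemma tripleE:
  assumes "T \<in> triples" obtains a b c where "distinct [a, b, c]" "T = {a, b, c}"
proof -
  have "card T = 3" using assms by (simp add: triples_def)
  then obtain a b c where "T = {a, b, c}" "a \<noteq> b" "b \<noteq> c" "a \<noteq> c" by (auto simp: card_3_iff)
  then show thesis using that[of a b c] by simp
qed

lemma card_three_edges: "card {{a, b}, {b, c}, {c, a}} \<le> 3"
  using card_length[of "[{a, b}, {b, c}, {c, a}]"] by simp

lemma edges_in_le: "T \<in> triples \<Longrightarrow> edges_in T \<le> 3"
proof -
  assume "T \<in> triples"
  then obtain a b c where abc: "distinct [a, b, c]" "T = {a, b, c}" by (rule tripleE)
  have "edges_in T \<le> card {{a, b}, {b, c}, {c, a}}"
    unfolding edges_in_def abc(2) by (rule card_mono[OF _ edges_in_triple[OF abc(1)]]) simp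
  then show ?thesis using card_three_edges[of a b c] by linarith
qed

lemma card_cycles3: "card (cycles3 E) = card {T \<in> triples. edges_in T = 3}"
proof -
  have "bij_betw (\<lambda>T. {e \<in> E. e \<subseteq> T}) {T \<in> triples. edges_in T = 3} (cycles3 E)"
  proof (rule bij_betw_byWitness[where f' = Union])
    have full: "\<exists>a b c. distinct [a, b, c] \<and> T = {a, b, c} \<and> {e \<in> E. e \<subseteq> T} = {{a, b}, {b, c}, {c, a}}"
      if T: "T \<in> triples" "edges_in T = 3" for T
    proof -
      obtain a b c where abc: "distinct [a, b, c]" "T = {a, b, c}" using T(1) by (rule tripleE)
      have "card {{a, b}, {b, c}, {c, a}} \<le> card {e \<in> E. e \<subseteq> {a, b, c}}"
        using card_three_edges[of a b c] T(2) unfolding edges_in_def abc(2) by simp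
      then have "{e \<in> E. e \<subseteq> {a, b, c}} = {{a, b}, {b, c}, {c, a}}"
        using card_seteq[OF _ edges_in_triple[OF abc(1)]] by blast
      then show ?thesis using abc by blast
    qed
    show "\<forall>T\<in>{T \<in> triples. edges_in T = 3}. \<Union>{e \<in> E. e \<subseteq> T} = T"
    proof
      fix T assume "T \<in> {T \<in> triples. edges_in T = 3}"
      then obtain a b c where abc: "T = {a, b, c}" "{e \<in> E. e \<subseteq> T} = {{a, b}, {b, c}, {c, a}}"
        using full[of T] by blast
      show "\<Union>{e \<in> E. e \<subseteq> T} = T" unfolding abc(2) unfolding abc(1) by auto
    qed
    show "(\<lambda>T. {e \<in> E. e \<subseteq> T}) ` {T \<in> triples. edges_in T = 3} \<subseteq> cycles3 E"
    proof (rule image_subsetI)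
      fix T assume "T \<in> {T \<in> triples. edges_in T = 3}"
      then obtain a b c where abc: "distinct [a, b, c]" "{e \<in> E. e \<subseteq> T} = {{a, b}, {b, c}, {c, a}}"
        using full[of T] by blast
      show "{e \<in> E. e \<subseteq> T} \<in> cycles3 E"
        unfolding cycles3_def using abc by (intro CollectI conjI exI) auto
    qed
    have cyc: "\<Union>S \<in> triples \<and> {e \<in> E. e \<subseteq> \<Union>S} = S \<and> card S = 3" if "S \<in> cycles3 E" for S
    proof -
      obtain a b c where abc: "distinct [a, b, c]" "S = {{a, b}, {b, c}, {c, a}}" "S \<subseteq> E"
        using \<open>S \<in> cycles3 E\<close> unfolding cycles3_def by blast
      have U: "\<Union>S = {a, b, c}" using abc(2) by auto
      have "{a, b, c} \<subseteq> V" using abc edge_subset by auto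
      then have "\<Union>S \<in> triples" unfolding U triples_def using abc(1) by simp
      moreover have "{e \<in> E. e \<subseteq> \<Union>S} = S"
        using edges_in_triple[OF abc(1)] abc(2,3) unfolding U by auto
      moreover have "card S = 3" using abc(1,2) by (auto simp: doubleton_eq_iff)
      ultimately show ?thesis by blast
    qed
    then show "\<forall>S\<in>cycles3 E. {e \<in> E. e \<subseteq> \<Union>S} = S" by blast
    show "\<Union> ` cycles3 E \<subseteq> {T \<in> triples. edges_in T = 3}"
      using cyc by (auto simp: edges_in_def)
  qed
  then show ?thesis by (rule bij_betw_same_card[symmetric])
qed

lemma card_cells2: "card (cells2 E) = sq E + 2 * card {T \<in> triples. edges_in T = 3}"
proof -
  have "cells2 E = (\<lambda>S. (S, 0)) ` cycles4 E \<union> cycles3 E \<times> {1, 2}" by (auto simp: cells2_def)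
  moreover have "finite (cycles4 E)" "finite (cycles3 E)"
    using finite_E by (auto simp: cycles4_def cycles3_def)
  moreover have "card ((\<lambda>S. (S, 0::nat)) ` cycles4 E) = sq E"
    unfolding sq_def by (rule card_image) (auto simp: inj_on_def)
  moreover have "(\<lambda>S. (S, 0::nat)) ` cycles4 E \<inter> cycles3 E \<times> {1, 2} = {}" by auto
  ultimately show ?thesis by (simp add: card_Un_disjoint card_cartesian_product card_cycles3)
qed

text \<open>For a number \<open>i \<le> 3\<close> of edges,
  \<open>i + [i = 0] = 1 + [i = 2] + 2 * [i = 3]\<close>. The last term equals the contribution of
  the two 2-cells per triangle, so triangles cancel from the rank formula.\<close>

lemma sum_edges_in:
  "int (sum edges_in triples) + int (t0 V E) = int (card triples) + int (t2 V E) + 2 * int (card {T \<in> triples. edges_in T = 3})"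
proof -
  have t: "t0 V E = card {T \<in> triples. edges_in T = 0}" "t2 V E = card {T \<in> triples. edges_in T = 2}"
    by (auto simp: t0_def t2_def triples_def edges_in_def intro: arg_cong[of _ _ card])
  have count: "int (card {T \<in> triples. edges_in T = i}) = (\<Sum>T\<in>triples. if edges_in T = i then 1 else 0)" for i
    using finite_triples by (simp add: sum.If_cases Int_def)
  have "(\<Sum>T\<in>triples. int (edges_in T) + (if edges_in T = 0 then 1 else 0))
    = (\<Sum>T\<in>triples. 1 + (if edges_in T = 2 then 1 else 0) + 2 * (if edges_in T = 3 then 1 else 0))"
  proof (rule sum.cong[OF refl])
    fix T assume "T \<in> triples"
    then have "edges_in T \<le> 3" by (rule edges_in_le)
    then have "edges_in T = 0 \<or> edges_in T = 1 \<or> edges_in T = 2 \<or> edges_in T = 3" by arith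
    then show "int (edges_in T) + (if edges_in T = 0 then 1 else 0)
      = 1 + (if edges_in T = 2 then 1 else 0) + 2 * (if edges_in T = 3 then 1 else 0)" by auto
  qed
  then show ?thesis unfolding t count by (simp add: sum.distrib sum_distrib_left)
qed

lemma top_degree_cohomology:
  shows "\<exists>n::nat. KhA3 V E rk 0 top_degree \<cong> ZF {..<n}"
    and "KhA3 V E rk 0 top_degree \<cong> XH1 E ori \<times>\<times> ZF {..<t0 V E + d2 V E div 2 + d3 V E}"
    and "torsion_subgroup (KhA3 V E rk 1 top_degree) \<cong> torsion_subgroup (XH2 E ori)"
    and "int (ab_rank (KhA3 V E rk 1 top_degree))
      = int (ab_rank (XH2 E ori)) + int (t2 V E) - int (d2 V E div 2) - int (sq E)"
proof -
  have Kh0: "KhA3 V E rk 0 top_degree = cohom {} C0 C1 (dcoef V E rk) (dcoef V E rk)"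
    by (simp add: KhA3_def)
  have Kh1: "KhA3 V E rk 1 top_degree = cohom C0 C1 {} (dcoef V E rk) (dcoef V E rk)"
    using ES_2_empty by (simp add: KhA3_def numeral_2_eq_2)
  have B: "card free_states = t0 V E + d2 V E div 2 + d3 V E"
    by (simp add: card_free_states card_free_pairs card_free_triples)
  have into: "edge_values ` carrier (ZF C0) \<subseteq> carrier (ZF E)" "free_values ` carrier (ZF C0) \<subseteq> carrier (ZF free_states)"
    by (auto simp: edge_values_def free_values_def)
  note comparison = two_term_comparison[OF finite_C0 finite_C1 finite_E finite_cells2 finite_free_states
      additive_edge_values into(1) additive_free_values into(2) coboundary_edge_values lift_values
      divisible_if_values_vanish]
  \<comment> \<open>The incoming differentials vanish: one has an empty source, the other has zero
    coefficients because every 1-cell is a loop.\<close>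
  have Z: "lin {} C0 (dcoef V E rk) f = (\<lambda>_. 0)" "lin {()} E (\<lambda>_ _. 0) g = (\<lambda>_. 0)" for f g
    by (auto simp: lin_def)
  show "\<exists>n::nat. KhA3 V E rk 0 top_degree \<cong> ZF {..<n}" unfolding Kh0
    by (rule comparison(1)[OF _ _ _ _ _ _ _ _ Z])
  show "KhA3 V E rk 0 top_degree \<cong> XH1 E ori \<times>\<times> ZF {..<t0 V E + d2 V E div 2 + d3 V E}"
    unfolding Kh0 XH1_def B[symmetric] by (rule comparison(2)[OF _ _ _ _ _ _ _ _ Z])
  show "torsion_subgroup (KhA3 V E rk 1 top_degree) \<cong> torsion_subgroup (XH2 E ori)"
    unfolding Kh1 XH2_def by (rule comparison(3)[OF _ _ _ _ _ _ _ _ Z])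
  have "ab_rank (KhA3 V E rk 1 top_degree) + card C0 + card (cells2 E)
      = ab_rank (XH2 E ori) + card C1 + card E + card free_states"
    unfolding Kh1 XH2_def by (rule comparison(4)[OF _ _ _ _ _ _ _ _ Z])
  \<comment> \<open>Exact halving ties \<open>d2 V E\<close>, which enters through the number of
    pairs, to \<open>d2 V E div 2\<close>, which enters through the free states.\<close>
  moreover have "int (d2 V E) = 2 * int (d2 V E div 2)" using card_linked_free_pairs by simp
  ultimately show "int (ab_rank (KhA3 V E rk 1 top_degree))
      = int (ab_rank (XH2 E ori)) + int (t2 V E) - int (d2 V E div 2) - int (sq E)"
    using sum_edges_in unfolding card_C0 card_cells2 card_C1 card_pairs B by linarith
qed

end

theorem theorem4p1:
  fixes V :: "'a set" and E :: "'a set set"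
    and rk :: "'a set \<Rightarrow> nat" and ori :: "'a set \<Rightarrow> 'a"
  assumes G: "simple_graph V E"
    and order: "inj_on rk E"
    and orient: "\<forall>e\<in>E. ori e \<in> e"
  shows "((\<exists>n::nat. KhA3 V E rk 0 (2 * int (card V) - 3) \<cong> ZF {..<n})
       \<and> KhA3 V E rk 0 (2 * int (card V) - 3)
           \<cong> XH1 E ori \<times>\<times> ZF {..<t0 V E + d2 V E div 2 + d3 V E})
       \<and> (torsion_subgroup (KhA3 V E rk 1 (2 * int (card V) - 3)) \<cong> torsion_subgroup (XH2 E ori)
       \<and> int (ab_rank (KhA3 V E rk 1 (2 * int (card V) - 3)))
           = int (ab_rank (XH2 E ori)) + int (t2 V E) - int (d2 V E div 2) - int (sq E))"
proof -
  interpret graph_setup V E rk ori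
    using G orient by unfold_locales
  show ?thesis
    using top_degree_cohomology by blast
qed

end
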